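(* Let $q$ be a fixed power of an odd prime. Then, as $n\to\infty$, $$EX_{2n}=\tfrac32\log n+O(1),$$ where the expectation is taken over a uniformly random element of $Sp(2n,q)$.
   Context: $Sp(2n,q)$ is the subgroup of $GL(2n,q)$ preserving a non-degenerate alternating form on $F_q^{2n}$. For $\alpha\in Sp(2n,q)$, $X_{2n}(\alpha)$ is the number of irreducible polynomials over $F_q$ counted with multiplicity occurring in the canonical form of $\alpha$; that is, the number of irreducible factors over $F_q$, counted with multiplicity, of the characteristic polynomial of $\alpha$. The $O(1)$ constant may depend on $q$. *)

theory Defs
  imports
    "HOL-Probability.Probability_Mass_Function"
    "HOL-Library.Landau_Symbols"
    "HOL-Computational_Algebra.Polynomial_Factorial"
    "Jordan_Normal_Form.Char_Poly"
begin

definition bilinear_form :: "nat \<Rightarrow> ('a::field vec \<Rightarrow> 'a vec \<Rightarrow> 'a) \<Rightarrow> bool" where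
  "bilinear_form m B \<longleftrightarrow>
     (\<forall>u\<in>carrier_vec m. \<forall>v\<in>carrier_vec m. \<forall>w\<in>carrier_vec m.
        B (u + v) w = B u w + B v w \<and> B u (v + w) = B u v + B u w) \<and>
     (\<forall>c. \<forall>u\<in>carrier_vec m. \<forall>v\<in>carrier_vec m.
        B (c \<cdot>\<^sub>v u) v = c * B u v \<and> B u (c \<cdot>\<^sub>v v) = c * B u v)"

definition alternating_form :: "nat \<Rightarrow> ('a::field vec \<Rightarrow> 'a vec \<Rightarrow> 'a) \<Rightarrow> bool" where
  "alternating_form m B \<longleftrightarrow> bilinear_form m B \<and> (\<forall>u\<in>carrier_vec m. B u u = 0)"

(* One-sided nondegeneracy suffices: an alternating form is skew-symmetric. *)
definition nondegenerate_alternating_form :: "nat \<Rightarrow> ('a::field vec \<Rightarrow> 'a vec \<Rightarrow> 'a) \<Rightarrow> bool" where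
  "nondegenerate_alternating_form m B \<longleftrightarrow> alternating_form m B \<and>
     (\<forall>u\<in>carrier_vec m. (\<forall>v\<in>carrier_vec m. B u v = 0) \<longrightarrow> u = 0\<^sub>v m)"

definition general_linear :: "nat \<Rightarrow> 'a::field mat set" where
  "general_linear m = {A \<in> carrier_mat m m. invertible_mat A}"

definition symplectic :: "nat \<Rightarrow> ('a::field vec \<Rightarrow> 'a vec \<Rightarrow> 'a) \<Rightarrow> 'a mat set" where
  "symplectic m B = {A \<in> general_linear m.
     \<forall>u\<in>carrier_vec m. \<forall>v\<in>carrier_vec m. B (A *\<^sub>v u) (A *\<^sub>v v) = B u v}"

(* The library's multiplicity of an irreducible factor would require a gcd operation on 'a,
   hence the explicit exponent. Factors are taken monic, i.e. up to associates. *)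
definition num_irred_factors :: "'a::field poly \<Rightarrow> nat" where
  "num_irred_factors p =
     (\<Sum>f | lead_coeff f = 1 \<and> irreducible f \<and> f dvd p. Max {k. f ^ k dvd p})"

lemma monic_irred_dvd_eq:
  fixes f g :: "'a::field poly"
  assumes "lead_coeff f = 1" "irreducible f" "lead_coeff g = 1" "irreducible g" "g dvd f"
  shows "g = f"
proof -
  from assms(5) obtain h where h: "f = g * h" by (elim dvdE)
  with assms(2,4) have "is_unit h" by (auto dest: irreducibleD)
  then obtain c where c: "h = [:c:]" using is_unit_poly_iff by blast
  have "lead_coeff f = lead_coeff g * lead_coeff h" using h by (simp add: lead_coeff_mult)
  with assms(1,3) c have "c = 1" by simp
  with h c show ?thesis by simp
qed

lemma irred_dvd_prod_mset:
  fixes f :: "'a::field poly"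
  assumes "lead_coeff f = 1" "irreducible f"
    and "\<And>g. g \<in># M \<Longrightarrow> lead_coeff g = 1 \<and> irreducible g"
  shows "f dvd prod_mset M \<longleftrightarrow> f \<in># M"
proof
  assume "f dvd prod_mset M"
  moreover have "prime_elem f" using assms(2) by (rule field_poly_irreducible_imp_prime)
  ultimately obtain g where "g \<in># M" "f dvd g" using prime_elem_dvd_prod_mset by blast
  with assms show "f \<in># M" using monic_irred_dvd_eq[of g f] by blast
qed (rule dvd_prod_mset)

lemma Max_power_dvd_prod_mset:
  fixes f :: "'a::field poly"
  assumes f: "lead_coeff f = 1" "irreducible f"
    and M: "\<And>g. g \<in># M \<Longrightarrow> lead_coeff g = 1 \<and> irreducible g"
  shows "Max {k. f ^ k dvd prod_mset M} = count M f"
proof -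
  define N where "N = filter_mset (\<lambda>g. g \<noteq> f) M"
  have "M = replicate_mset (count M f) f + N"
    unfolding N_def by (metis filter_eq_replicate_mset multiset_partition)
  then have prod: "prod_mset M = f ^ count M f * prod_mset N"
    by (metis prod_mset_Un prod_mset_replicate_mset)
  have N: "\<not> f dvd prod_mset N"
    using irred_dvd_prod_mset[OF f, of N] M by (auto simp: N_def)
  have f0: "f \<noteq> 0" using f(1) by auto
  have "f ^ k dvd prod_mset M \<longleftrightarrow> k \<le> count M f" for k
  proof
    assume dvd: "f ^ k dvd prod_mset M"
    show "k \<le> count M f"
    proof (rule ccontr)
      assume "\<not> k \<le> count M f"
      then have "f ^ Suc (count M f) dvd f ^ k" by (intro le_imp_power_dvd) simp
      with dvd have "f ^ Suc (count M f) dvd prod_mset M" by (rule dvd_trans[rotated])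
      then have "f ^ count M f * f dvd f ^ count M f * prod_mset N"
        by (simp only: prod power_Suc2)
      with f0 have "f dvd prod_mset N" by simp
      with N show False by contradiction
    qed
  qed (simp add: prod le_imp_power_dvd dvd_mult2)
  then have "{k. f ^ k dvd prod_mset M} = {..count M f}" by auto
  then show ?thesis by (auto intro!: Max_eqI)
qed

lemma num_irred_factors_prod_mset:
  fixes M :: "'a::field poly multiset"
  assumes "\<And>f. f \<in># M \<Longrightarrow> lead_coeff f = 1 \<and> irreducible f"
  shows "num_irred_factors (prod_mset M) = size M"
proof -
  have "{f. lead_coeff f = 1 \<and> irreducible f \<and> f dvd prod_mset M} = set_mset M"
    using assms irred_dvd_prod_mset[OF _ _ assms] by blast
  then have "num_irred_factors (prod_mset M) = (\<Sum>f\<in>#M. 1)"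
    unfolding num_irred_factors_def
    using assms by (simp add: Max_power_dvd_prod_mset size_multiset_overloaded_eq)
  then show ?thesis by simp
qed

lemma finite_monic_irred_divisors:
  fixes p :: "'a::{finite,field} poly"
  assumes "p \<noteq> 0"
  shows "finite {f. lead_coeff f = 1 \<and> irreducible f \<and> f dvd p}"
proof (rule finite_subset)
  show "{f. lead_coeff f = 1 \<and> irreducible f \<and> f dvd p} \<subseteq>
    Poly ` {xs. set xs \<subseteq> UNIV \<and> length xs \<le> Suc (degree p)}"
  proof
    fix f assume "f \<in> {f. lead_coeff f = 1 \<and> irreducible f \<and> f dvd p}"
    then have "degree f \<le> degree p" using assms by (auto intro: dvd_imp_degree_le)
    then have "length (coeffs f) \<le> Suc (degree p)" by (cases "f = 0") (auto simp: length_coeffs_degree)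
    moreover have "f = Poly (coeffs f)" by simp
    ultimately show "f \<in> Poly ` {xs. set xs \<subseteq> UNIV \<and> length xs \<le> Suc (degree p)}" by blast
  qed
  show "finite (Poly ` {xs::'a list. set xs \<subseteq> UNIV \<and> length xs \<le> Suc (degree p)})"
    by (intro finite_imageI finite_lists_length_le) simp
qed

lemma finite_symplectic:
  fixes B :: "'a::{finite,field} vec \<Rightarrow> 'a vec \<Rightarrow> 'a"
  shows "finite (symplectic m B)"
proof (rule finite_subset)
  let ?L = "{xs::'a list. set xs \<subseteq> UNIV \<and> length xs = m}"
  let ?R = "{rs. set rs \<subseteq> vec_of_list ` ?L \<and> length rs = m}"
  show "symplectic m B \<subseteq> mat_of_rows m ` ?R"
  proof
    fix A assume "A \<in> symplectic m B"
    then have A: "A \<in> carrier_mat m m" by (simp add: symplectic_def general_linear_def)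
    have "set (rows A) \<subseteq> vec_of_list ` ?L"
    proof
      fix r assume "r \<in> set (rows A)"
      then have "length (list_of_vec r) = m" using A by (auto simp: rows_def)
      moreover have "r = vec_of_list (list_of_vec r)" by (simp add: vec_list)
      ultimately show "r \<in> vec_of_list ` ?L" by blast
    qed
    moreover have "length (rows A) = m" using A by simp
    moreover have "A = mat_of_rows m (rows A)" using A mat_of_rows_rows[of A] by simp
    ultimately show "A \<in> mat_of_rows m ` ?R" by blast
  qed
  show "finite (mat_of_rows m ` ?R)"
    by (intro finite_imageI finite_lists_length_eq) simp
qed

lemma one_mat_in_symplectic: "1\<^sub>m m \<in> symplectic m B"
  by (auto simp: symplectic_def general_linear_def invertible_mat_def inverts_mat_def
      intro!: exI[of _ "1\<^sub>m m"])

lemma nondegenerate_alternating_form_exists: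
  "nondegenerate_alternating_form (2 * n)
     (\<lambda>u v :: 'a::field vec. \<Sum>i<n. u $ i * v $ (n + i) - u $ (n + i) * v $ i)"
  (is "nondegenerate_alternating_form _ ?B")
  unfolding nondegenerate_alternating_form_def alternating_form_def
proof (intro conjI ballI impI)
  show "bilinear_form (2 * n) ?B"
    unfolding bilinear_form_def
    by (auto simp: sum.distrib[symmetric] sum_distrib_left algebra_simps intro!: sum.cong)
next
  fix u :: "'a vec"
  show "?B u u = 0" by (simp add: mult.commute)
next
  fix u :: "'a vec"
  assume u: "u \<in> carrier_vec (2 * n)" and 0: "\<forall>v\<in>carrier_vec (2 * n). ?B u v = 0"
  have "u $ j = 0 \<and> u $ (n + j) = 0" if "j < n" for j
  proof
    have "?B u (unit_vec (2 * n) (n + j)) = (\<Sum>i<n. if i = j then u $ i else 0)"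
      using that by (intro sum.cong) (auto simp: unit_vec_def)
    moreover have "\<dots> = u $ j" using that by simp
    ultimately show "u $ j = 0" using 0 by simp
    have "?B u (unit_vec (2 * n) j) = (\<Sum>i<n. if i = j then - u $ (n + i) else 0)"
      using that by (intro sum.cong) (auto simp: unit_vec_def)
    moreover have "\<dots> = - u $ (n + j)" using that by simp
    ultimately show "u $ (n + j) = 0" using 0 by simp
  qed
  then have "u $ j = 0" if "j < 2 * n" for j
    using that by (metis add_diff_inverse_nat mult_2 nat_add_left_cancel_less)
  with u show "u = 0\<^sub>v (2 * n)" by (intro eq_vecI) auto
qed

end

theory Submission
  imports Defs "HOL-Analysis.Harmonic_Numbers"
begin

text \<open>
  Let \<open>\<phi>\<close> be monic irreducible of degree \<open>d\<close> and \<open>Q = q\<^sup>d\<close>. By Witt's theorem the pairs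
  \<open>(\<alpha>, v)\<close> with \<open>v\<close> of annihilator exactly \<open>\<phi>\<^sup>j\<close> under \<open>\<alpha> \<in> Sp(2n, q)\<close> number at most \<open>|Sp(2n, q)|\<close>
  times the number of possible Gram matrices of \<open>v, \<alpha> v, \<alpha>\<^sup>2 v, \<dots>\<close>: at most \<open>Q\<^sup>j\<^sup>/\<^sup>2\<close> in general,
  and only the zero matrix, which forces \<open>d \<le> n\<close>, if \<open>\<phi>\<close> is prime to its reciprocal polynomial.
  A convexity estimate turns this into upper bounds for the mean multiplicity of \<open>\<phi>\<close> in the
  characteristic polynomial: \<open>Q\<^sup>-\<^sup>1\<^sup>/\<^sup>2\<close> for self-dual \<open>\<phi>\<close> and \<open>Q\<^sup>-\<^sup>1\<close> for the others, up to summable errors.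

  No lower bounds are needed. The mean multiplicities weighted by degree add up to exactly \<open>2n\<close>,
  whereas the weighted main terms add up to at most \<open>2n\<close>, as one sees by averaging the degrees of the
  distinct irreducible factors over the palindromic polynomials of degree \<open>2n\<close>. So the upper bounds are
  sharp up to \<open>O(1)\<close> in total, and each of the two classes contributes a weighted main term \<open>n + O(1)\<close>.
  Partial summation gives \<open>log n\<close> for the non-self-dual and \<open>log n / 2\<close> for the self-dual factors.
\<close>

unbundle no vec_syntax and no inner_syntax

section \<open>Frames and Gram matrices\<close>

text \<open>Exact averages over the group would require generating functions over all conjugacy
  classes. Asking only for upper bounds avoids them: a multiplicity is at most the logarithm of the
  size of a torsion module, concavity bounds that logarithm linearly by the numbers of vectors with
  given annihilator, and the pairs of an isometry and such a vector can be counted with Witt's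
  theorem alone. Upper bounds suffice because the excess of each bound over the true mean is
  nonnegative and degrees are at least 1, so the plain total excess is at most the degree-weighted
  one, which the total degree 2n controls. The same identity works backwards: the lower bound on the
  number of self-dual irreducible polynomials is extracted from the group. A self-dual factor of
  degree 2k has main term q^(-k) but weight 2k, which is why this class yields only half a
  logarithm. Odd q enters through the fact that self-dual irreducible polynomials of degree at least
  2 are palindromic of even degree. Linear factors are at most q in number and have bounded means;
  they are why the constant depends on q.\<close>

lemma card_carrier_vec: "card (carrier_vec n :: 'a::finite vec set) = CARD('a) ^ n"
proof -
  have "bij_betw vec_of_list {xs :: 'a list. set xs \<subseteq> UNIV \<and> length xs = n} (carrier_vec n)"
    by (rule bij_betwI[where g = list_of_vec]) (auto simp: list_vec vec_list intro!: carrier_vecI)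
  from bij_betw_same_card[OF this] show ?thesis
    by (simp only: card_lists_length_eq[OF finite])
qed

lemma finite_carrier_vec [simp]: "finite (carrier_vec n :: 'a::finite vec set)"
  by (rule card_ge_0_finite) (simp only: card_carrier_vec zero_less_power zero_less_card_finite)

text \<open>An ordered list of \<open>m\<close> linearly independent vectors, stored as the columns
  of a matrix. Injectivity is the form of independence that suits counting: dimension arguments
  become cardinality arguments over the finite field.\<close>

definition frame :: "nat \<Rightarrow> nat \<Rightarrow> 'a::field mat \<Rightarrow> bool" where
  "frame N m P \<longleftrightarrow> P \<in> carrier_mat N m \<and> (\<forall>u\<in>carrier_vec m. P *\<^sub>v u = 0\<^sub>v N \<longrightarrow> u = 0\<^sub>v m)"

definition append_col :: "'a mat \<Rightarrow> 'a vec \<Rightarrow> 'a mat" where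
  "append_col P x = mat (dim_row P) (Suc (dim_col P))
     (\<lambda>(i, j). if j < dim_col P then P $$ (i, j) else x $ i)"

definition take_cols :: "nat \<Rightarrow> 'a mat \<Rightarrow> 'a mat" where
  "take_cols m R = mat (dim_row R) m (\<lambda>(i, j). R $$ (i, j))"

lemma frame_carrier: "frame N m P \<Longrightarrow> P \<in> carrier_mat N m"
  by (simp add: frame_def)

lemma frame_inj_on:
  assumes "frame N m P"
  shows "inj_on ((*\<^sub>v) P) (carrier_vec m)"
proof (rule inj_onI)
  fix u v assume uv: "u \<in> carrier_vec m" "v \<in> carrier_vec m" and eq: "P *\<^sub>v u = P *\<^sub>v v"
  have P: "P \<in> carrier_mat N m" using assms by (rule frame_carrier)
  have "P *\<^sub>v (u - v) = 0\<^sub>v N"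
    using uv P eq by (simp add: mult_minus_distrib_mat_vec)
  then have "u - v = 0\<^sub>v m"
    using assms uv unfolding frame_def by auto
  then have "u $ i - v $ i = 0" if "i < m" for i
    using that uv by (metis carrier_vecD index_minus_vec(1) index_zero_vec(1))
  then show "u = v" using uv by (intro eq_vecI) auto
qed

lemma append_col_carrier [simp]:
  "P \<in> carrier_mat N m \<Longrightarrow> append_col P x \<in> carrier_mat N (Suc m)"
  by (auto simp: append_col_def)

lemma take_cols_append_col [simp]: "P \<in> carrier_mat N m \<Longrightarrow> take_cols m (append_col P x) = P"
  by (auto simp: append_col_def take_cols_def)

lemma take_cols_take_cols: "m \<le> k \<Longrightarrow> take_cols m (take_cols k R) = take_cols m R"
  by (auto simp: take_cols_def)

lemma take_cols_mult:
  assumes "A \<in> carrier_mat M N" "R \<in> carrier_mat N k" "m \<le> k"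
  shows "take_cols m (A * R) = A * take_cols m R"
  using assms by (intro eq_matI) (auto simp: take_cols_def scalar_prod_def)

lemma append_col_mult_vec:
  fixes P :: "'a::field mat"
  assumes "P \<in> carrier_mat N m" "x \<in> carrier_vec N" "u \<in> carrier_vec (Suc m)"
  shows "append_col P x *\<^sub>v u = P *\<^sub>v vec m (\<lambda>i. u $ i) + u $ m \<cdot>\<^sub>v x"
  using assms by (intro eq_vecI) (auto simp: append_col_def scalar_prod_def mult.commute[of "u $ m"])

lemma frame_append_col:
  assumes P: "frame N m P" and x: "x \<in> carrier_vec N" "x \<notin> (*\<^sub>v) P ` carrier_vec m"
  shows "frame N (Suc m) (append_col P x)"
  unfolding frame_def
proof (intro conjI ballI impI)
  have Pc: "P \<in> carrier_mat N m" using P by (rule frame_carrier)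
  then show "append_col P x \<in> carrier_mat N (Suc m)" by simp
  fix u assume u: "u \<in> carrier_vec (Suc m)" and "append_col P x *\<^sub>v u = 0\<^sub>v N"
  then have eq: "P *\<^sub>v vec m (\<lambda>i. u $ i) + u $ m \<cdot>\<^sub>v x = 0\<^sub>v N"
    using append_col_mult_vec[OF Pc x(1) u] by simp
  have eqi: "(P *\<^sub>v vec m (\<lambda>i. u $ i)) $ k + u $ m * x $ k = 0" if "k < N" for k
    using arg_cong[OF eq, of "\<lambda>w. w $ k"] that x(1) Pc by simp
  have um: "u $ m = 0"
  proof (rule ccontr)
    assume nz: "u $ m \<noteq> 0"
    let ?c = "(- inverse (u $ m)) \<cdot>\<^sub>v vec m (\<lambda>i. u $ i)"
    have "P *\<^sub>v ?c = (- inverse (u $ m)) \<cdot>\<^sub>v (P *\<^sub>v vec m (\<lambda>i. u $ i))"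
      using Pc by (intro mult_mat_vec) auto
    also have "\<dots> = x"
    proof (rule eq_vecI)
      fix k assume "k < dim_vec x"
      then have k: "k < N" using x by simp
      have "(P *\<^sub>v vec m (\<lambda>i. u $ i)) $ k = - (u $ m * x $ k)"
        using eqi[OF k] by (simp add: eq_neg_iff_add_eq_0)
      then show "((- inverse (u $ m)) \<cdot>\<^sub>v (P *\<^sub>v vec m (\<lambda>i. u $ i))) $ k = x $ k"
        using k Pc nz by simp
    qed (use Pc x in auto)
    finally show False using x(2) by (metis image_eqI smult_carrier_vec vec_carrier)
  qed
  have "P *\<^sub>v vec m (\<lambda>i. u $ i) = 0\<^sub>v N"
    using eqi um Pc by (intro eq_vecI) auto
  then have "vec m (\<lambda>i. u $ i) = 0\<^sub>v m" using P unfolding frame_def by auto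
  then have "u $ i = 0" if "i < m" for i
    by (metis index_vec index_zero_vec(1) that)
  with um u show "u = 0\<^sub>v (Suc m)"
    by (intro eq_vecI) (auto simp: less_Suc_eq)
qed

lemma card_frame_image:
  fixes P :: "'a::{finite,field} mat"
  assumes "frame N m P"
  shows "card ((*\<^sub>v) P ` carrier_vec m) = CARD('a) ^ m"
  using frame_inj_on[OF assms] by (simp add: card_image card_carrier_vec)

lemma one_less_CARD_field: "1 < CARD('a::{finite,field})"
proof -
  have "card {0, 1 :: 'a} \<le> CARD('a)" by (rule card_mono) auto
  then show ?thesis by simp
qed

text \<open>Dimensions are compared by size: the injective image of \<open>carrier_vec m\<close> has
  q^m elements and lies in a set of q^N.\<close>

lemma frame_le:
  fixes P :: "'a::{finite,field} mat"
  assumes "frame N m P"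
  shows "m \<le> N"
proof -
  have "CARD('a) ^ m \<le> CARD('a) ^ N"
    using card_frame_image[OF assms] card_mono[of "carrier_vec N :: 'a vec set" "(*\<^sub>v) P ` carrier_vec m"]
      frame_carrier[OF assms] by (auto simp: card_carrier_vec image_subset_iff)
  then show ?thesis
    by (rule power_le_imp_le_exp[OF one_less_CARD_field])
qed

lemma frame_not_spanning:
  fixes P :: "'a::{finite,field} mat"
  assumes "frame N m P" "m < N"
  shows "\<exists>x\<in>carrier_vec N. x \<notin> (*\<^sub>v) P ` carrier_vec m"
proof -
  have "card ((*\<^sub>v) P ` carrier_vec m) < card (carrier_vec N :: 'a vec set)"
    using assms one_less_CARD_field[where 'a = 'a]
    by (simp add: card_frame_image card_carrier_vec power_strict_increasing)
  then have "\<not> carrier_vec N \<subseteq> (*\<^sub>v) P ` carrier_vec m"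
    by (meson card_mono finite_carrier_vec finite_imageI not_le)
  then show ?thesis by blast
qed

lemma frame_extend:
  fixes P :: "'a::{finite,field} mat"
  assumes "frame N m P"
  shows "\<exists>R. frame N N R \<and> take_cols m R = P"
proof -
  have "m \<le> N" using assms by (rule frame_le)
  then show ?thesis using assms
  proof (induction m arbitrary: P rule: inc_induct)
    case base
    then show ?case
      by (intro exI[of _ P]) (auto simp: take_cols_def dest!: frame_carrier)
  next
    case (step m)
    obtain x where x: "x \<in> carrier_vec N" "x \<notin> (*\<^sub>v) P ` carrier_vec m"
      using frame_not_spanning step by blast
    from step.IH[OF frame_append_col[OF step.prems x]]
    obtain R where R: "frame N N R" "take_cols (Suc m) R = append_col P x" by blast
    have "take_cols m R = take_cols m (take_cols (Suc m) R)" by (simp add: take_cols_take_cols)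
    then have "take_cols m R = P"
      using R(2) frame_carrier[OF step.prems] by simp
    with R show ?case by blast
  qed
qed

lemma square_frame_iff_det:
  "R \<in> carrier_mat N N \<Longrightarrow> frame N N R \<longleftrightarrow> det R \<noteq> 0"
  by (auto simp: frame_def det_0_iff_vec_prod_zero)

lemma bij_betw_square_frame:
  fixes R :: "'a::{finite,field} mat"
  assumes "frame N N R"
  shows "bij_betw ((*\<^sub>v) R) (carrier_vec N) (carrier_vec N)"
proof -
  have "(*\<^sub>v) R ` carrier_vec N \<subseteq> carrier_vec N" using frame_carrier[OF assms] by auto
  then have "(*\<^sub>v) R ` carrier_vec N = carrier_vec N"
    by (intro card_subset_eq) (simp_all add: card_frame_image[OF assms] card_carrier_vec)
  then show ?thesis using frame_inj_on[OF assms] by (simp add: bij_betw_def)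
qed

lemma square_frame_inverse:
  assumes "frame N N (R :: 'a::field mat)"
  obtains S where "S \<in> carrier_mat N N" "R * S = 1\<^sub>m N" "S * R = 1\<^sub>m N"
proof -
  have R: "R \<in> carrier_mat N N" "det R \<noteq> 0"
    using assms frame_carrier square_frame_iff_det by blast+
  from det_non_zero_imp_unit[OF this] show ?thesis
    by (auto simp: Units_def ring_mat_def intro: that)
qed

lemma card_vec_prefix:
  fixes g :: "'a::finite vec"
  assumes "g \<in> carrier_vec m" "m \<le> N"
  shows "card {y \<in> carrier_vec N. vec m (\<lambda>i. y $ i) = g} = CARD('a) ^ (N - m)"
proof -
  have "bij_betw (\<lambda>z. g @\<^sub>v z) (carrier_vec (N - m)) {y \<in> carrier_vec N. vec m (\<lambda>i. y $ i) = g}"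
  proof (rule bij_betwI[where g = "\<lambda>y. vec (N - m) (\<lambda>i. y $ (m + i))"])
    have "vec m (\<lambda>i. (g @\<^sub>v z) $ i) = g" for z
      using assms(1) by (intro eq_vecI) auto
    moreover have "g @\<^sub>v z \<in> carrier_vec N" if "z \<in> carrier_vec (N - m)" for z
      using append_carrier_vec[OF assms(1) that] assms(2) by simp
    ultimately show "(\<lambda>z. g @\<^sub>v z) \<in> carrier_vec (N - m) \<rightarrow> {y \<in> carrier_vec N. vec m (\<lambda>i. y $ i) = g}"
      by simp
    show "vec (N - m) (\<lambda>i. (g @\<^sub>v z) $ (m + i)) = z" if "z \<in> carrier_vec (N - m)" for z
      using that assms by (intro eq_vecI) auto
    show "g @\<^sub>v vec (N - m) (\<lambda>i. y $ (m + i)) = y"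
      if "y \<in> {y \<in> carrier_vec N. vec m (\<lambda>i. y $ i) = g}" for y
      using that assms(2) by (intro eq_vecI) auto
  qed simp
  then show ?thesis by (simp add: bij_betw_same_card[symmetric] card_carrier_vec)
qed

text \<open>The frame is completed to a basis \<open>R\<close>. The map given by
  \<open>R\<^sup>T * J\<close> is a bijection of the space, and the condition on \<open>x\<close>
  fixes exactly the first \<open>m\<close> coordinates of its image.\<close>

lemma card_gram_fibre:
  fixes P :: "'a::{finite,field} mat"
  assumes P: "frame N m P" and J: "J \<in> carrier_mat N N" "det J \<noteq> 0" and g: "g \<in> carrier_vec m"
  shows "card {x \<in> carrier_vec N. P\<^sup>T *\<^sub>v (J *\<^sub>v x) = g} = CARD('a) ^ (N - m)"
proof -
  obtain R where R: "frame N N R" "take_cols m R = P" using frame_extend[OF P] by blast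
  have Rc: "R \<in> carrier_mat N N" and mN: "m \<le> N" using R P frame_carrier frame_le by blast+
  have "det R \<noteq> 0" using R Rc square_frame_iff_det by blast
  then have "det (R\<^sup>T * J) \<noteq> 0" using Rc J by (simp add: det_mult[of _ N] det_transpose)
  then have K: "frame N N (R\<^sup>T * J)" using Rc J by (subst square_frame_iff_det) auto
  have *: "P\<^sup>T *\<^sub>v (J *\<^sub>v x) = vec m (\<lambda>i. ((R\<^sup>T * J) *\<^sub>v x) $ i)" if "x \<in> carrier_vec N" for x
  proof -
    have "(R\<^sup>T * J) *\<^sub>v x = R\<^sup>T *\<^sub>v (J *\<^sub>v x)" using Rc J that by simp
    moreover have "P\<^sup>T *\<^sub>v w = vec m (\<lambda>i. (R\<^sup>T *\<^sub>v w) $ i)" if "w \<in> carrier_vec N" for w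
      unfolding R(2)[symmetric] using Rc mN that
      by (intro eq_vecI) (auto simp: take_cols_def scalar_prod_def intro!: sum.cong)
    then have "P\<^sup>T *\<^sub>v (J *\<^sub>v x) = vec m (\<lambda>i. (R\<^sup>T *\<^sub>v (J *\<^sub>v x)) $ i)"
      using J that by simp
    ultimately show ?thesis by simp
  qed
  have "(*\<^sub>v) (R\<^sup>T * J) ` {x \<in> carrier_vec N. P\<^sup>T *\<^sub>v (J *\<^sub>v x) = g}
      = {y \<in> (*\<^sub>v) (R\<^sup>T * J) ` carrier_vec N. vec m (\<lambda>i. y $ i) = g}"
    using * by auto
  also have "(*\<^sub>v) (R\<^sup>T * J) ` carrier_vec N = carrier_vec N"
    using bij_betw_square_frame[OF K] by (simp add: bij_betw_def)
  finally have "bij_betw ((*\<^sub>v) (R\<^sup>T * J)) {x \<in> carrier_vec N. P\<^sup>T *\<^sub>v (J *\<^sub>v x) = g}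
      {y \<in> carrier_vec N. vec m (\<lambda>i. y $ i) = g}"
    using inj_on_subset[OF frame_inj_on[OF K]] by (simp add: bij_betw_def)
  then show ?thesis using card_vec_prefix[OF g mN] by (simp add: bij_betw_same_card)
qed

definition gram :: "'a::comm_semiring_0 mat \<Rightarrow> 'a mat \<Rightarrow> 'a mat" where
  "gram J P = P\<^sup>T * (J * P)"

lemma gram_carrier [simp]: "J \<in> carrier_mat N N \<Longrightarrow> P \<in> carrier_mat N m \<Longrightarrow> gram J P \<in> carrier_mat m m"
  by (auto simp: gram_def)

text \<open>Of the q^(N-m) solutions of the linear condition, those in the span of the frame are the
  \<open>P *\<^sub>v c\<close> with \<open>gram J P *\<^sub>v c = g\<close>. Hence the number of
  solutions outside the span depends on \<open>P\<close> only through its Gram matrix. This replaces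
  orthogonal complements in the proof of Witt's theorem.\<close>

lemma card_gram_fibre_off_image:
  fixes P :: "'a::{finite,field} mat"
  assumes P: "frame N m P" and J: "J \<in> carrier_mat N N" "det J \<noteq> 0" and g: "g \<in> carrier_vec m"
  shows "card {x \<in> carrier_vec N. x \<notin> (*\<^sub>v) P ` carrier_vec m \<and> P\<^sup>T *\<^sub>v (J *\<^sub>v x) = g}
    + card {c \<in> carrier_vec m. gram J P *\<^sub>v c = g} = CARD('a) ^ (N - m)"
proof -
  have Pc: "P \<in> carrier_mat N m" using P by (rule frame_carrier)
  let ?X = "{x \<in> carrier_vec N. x \<notin> (*\<^sub>v) P ` carrier_vec m \<and> P\<^sup>T *\<^sub>v (J *\<^sub>v x) = g}"
  let ?C = "{c \<in> carrier_vec m. gram J P *\<^sub>v c = g}"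
  have eq: "gram J P *\<^sub>v c = P\<^sup>T *\<^sub>v (J *\<^sub>v (P *\<^sub>v c))" if "c \<in> carrier_vec m" for c
    unfolding gram_def using assoc_mult_mat_vec[of "P\<^sup>T" m N "J * P" m c] Pc J that by simp
  have split: "{x \<in> carrier_vec N. P\<^sup>T *\<^sub>v (J *\<^sub>v x) = g} = ?X \<union> (*\<^sub>v) P ` ?C"
    using eq Pc by auto
  have "finite ?X" by (rule finite_subset[of _ "carrier_vec N"]) auto
  then have "card {x \<in> carrier_vec N. P\<^sup>T *\<^sub>v (J *\<^sub>v x) = g} = card ?X + card ((*\<^sub>v) P ` ?C)"
    unfolding split by (intro card_Un_disjoint) auto
  also have "card ((*\<^sub>v) P ` ?C) = card ?C"
    by (intro card_image inj_on_subset[OF frame_inj_on[OF P]]) auto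
  finally show ?thesis using card_gram_fibre[OF assms] by simp
qed

text \<open>With zero Gram matrix and \<open>g = 0\<close>, all q^m combinations of the columns lie
  in a fibre of only q^(N-m) elements.\<close>

lemma isotropic_frame_le:
  fixes P :: "'a::{finite,field} mat"
  assumes P: "frame N m P" and J: "J \<in> carrier_mat N N" "det J \<noteq> 0" and "gram J P = 0\<^sub>m m m"
  shows "2 * m \<le> N"
proof -
  have "{c \<in> carrier_vec m. gram J P *\<^sub>v c = 0\<^sub>v m} = carrier_vec m"
    unfolding assms(4) by auto
  then have "CARD('a) ^ m \<le> CARD('a) ^ (N - m)"
    using card_gram_fibre_off_image[OF P J zero_carrier_vec] by (simp add: card_carrier_vec)
  then have "m \<le> N - m"
    by (rule power_le_imp_le_exp[OF one_less_CARD_field])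
  with frame_le[OF P] show ?thesis by simp
qed

section \<open>Witt's theorem and intertwining isometries\<close>

definition symplectic_gram :: "nat \<Rightarrow> 'a::field mat \<Rightarrow> bool" where
  "symplectic_gram N J \<longleftrightarrow> J \<in> carrier_mat N N \<and> det J \<noteq> 0 \<and> (\<forall>u\<in>carrier_vec N. u \<bullet> (J *\<^sub>v u) = 0)"

definition isometries :: "nat \<Rightarrow> 'a::field mat \<Rightarrow> 'a mat set" where
  "isometries N J = {A \<in> carrier_mat N N. gram J A = J}"

lemma symplectic_gramD:
  assumes "symplectic_gram N J"
  shows "J \<in> carrier_mat N N" "det J \<noteq> 0" "u \<in> carrier_vec N \<Longrightarrow> u \<bullet> (J *\<^sub>v u) = 0"
  using assms by (auto simp: symplectic_gram_def)

lemma symplectic_gram_skew: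
  assumes J: "symplectic_gram N J" and u: "u \<in> carrier_vec N" and v: "v \<in> carrier_vec N"
  shows "u \<bullet> (J *\<^sub>v v) = - (v \<bullet> (J *\<^sub>v u))"
proof -
  note Jc = symplectic_gramD(1)[OF J]
  have Ju: "J *\<^sub>v u \<in> carrier_vec N" "J *\<^sub>v v \<in> carrier_vec N" using Jc u v by auto
  have "0 = (u + v) \<bullet> (J *\<^sub>v (u + v))"
    using symplectic_gramD(3)[OF J, of "u + v"] u v by simp
  also have "\<dots> = (u + v) \<bullet> (J *\<^sub>v u + J *\<^sub>v v)"
    using mult_add_distrib_mat_vec[OF Jc u v] by simp
  also have "\<dots> = u \<bullet> (J *\<^sub>v u) + u \<bullet> (J *\<^sub>v v) + (v \<bullet> (J *\<^sub>v u) + v \<bullet> (J *\<^sub>v v))"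
    using u v Ju by (simp add: add_scalar_prod_distrib[of _ N] scalar_prod_add_distrib[of _ N])
  finally show ?thesis
    using symplectic_gramD(3)[OF J] u v by (simp add: eq_neg_iff_add_eq_0)
qed

lemma gram_index:
  assumes "J \<in> carrier_mat N N" "P \<in> carrier_mat N m" "i < m" "j < m"
  shows "gram J P $$ (i, j) = col P i \<bullet> (J *\<^sub>v col P j)"
proof -
  have "col (J * P) j = J *\<^sub>v col P j" using assms by (intro eq_vecI) auto
  then show ?thesis using assms by (simp add: gram_def)
qed

lemma gram_mult:
  assumes "J \<in> carrier_mat N N" "P \<in> carrier_mat N m" "T \<in> carrier_mat m k"
  shows "gram J (P * T) = gram (gram J P) T"
proof -
  have "gram J (P * T) = (T\<^sup>T * P\<^sup>T) * (J * (P * T))"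
    using assms by (simp add: gram_def transpose_mult)
  also have "\<dots> = T\<^sup>T * (P\<^sup>T * (J * (P * T)))"
    using assms by (intro assoc_mult_mat[of _ _ m _ N _ k]) auto
  also have "J * (P * T) = (J * P) * T"
    using assms by (intro assoc_mult_mat[symmetric, of _ _ N _ m]) auto
  also have "P\<^sup>T * ((J * P) * T) = (P\<^sup>T * (J * P)) * T"
    using assms by (intro assoc_mult_mat[symmetric, of _ _ N _ m]) auto
  finally show ?thesis by (simp add: gram_def)
qed

lemma isometriesD:
  assumes "A \<in> isometries N J"
  shows "A \<in> carrier_mat N N" "gram J A = J"
  using assms by (auto simp: isometries_def)

lemma gram_isometry:
  assumes "J \<in> carrier_mat N N" "A \<in> isometries N J" "P \<in> carrier_mat N m"
  shows "gram J (A * P) = gram J P"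
  using assms by (simp add: gram_mult[of _ N _ N _ m] isometriesD)

lemma isometries_mult:
  assumes "J \<in> carrier_mat N N" "A \<in> isometries N J" "A' \<in> isometries N J"
  shows "A * A' \<in> isometries N J"
  using assms gram_isometry[of J N A A' N] by (auto simp: isometries_def)

lemma frame_isometry:
  assumes J: "symplectic_gram N J" and A: "A \<in> isometries N J"
  shows "frame N N A"
proof -
  note c = symplectic_gramD[OF J] isometriesD[OF A]
  have "det (A\<^sup>T * (J * A)) = det J" using c by (simp add: gram_def)
  then have "det A \<noteq> 0"
    using c by (auto simp: det_mult[of _ N] det_transpose)
  then show ?thesis using c by (simp add: square_frame_iff_det)
qed

text \<open>The new diagonal entry vanishes because the form is alternating, and the new row is the
  negated transpose of the new column, so only the products of the old columns with the new vector
  have to agree.\<close>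

lemma gram_append_col_eq:
  assumes J: "symplectic_gram N J"
    and P: "P \<in> carrier_mat N m" "P' \<in> carrier_mat N m"
    and x: "x \<in> carrier_vec N" "x' \<in> carrier_vec N"
    and G: "gram J P = gram J P'" and g: "P\<^sup>T *\<^sub>v (J *\<^sub>v x) = P'\<^sup>T *\<^sub>v (J *\<^sub>v x')"
  shows "gram J (append_col P x) = gram J (append_col P' x')"
proof -
  note Jc = symplectic_gramD(1)[OF J]
  have cols: "col (append_col R y) i = (if i < m then col R i else y)"
    if "i < Suc m" "R \<in> carrier_mat N m" "y \<in> carrier_vec N" for R y i
    using that by (intro eq_vecI) (auto simp: append_col_def)
  have e: "col P i \<bullet> (J *\<^sub>v x) = col P' i \<bullet> (J *\<^sub>v x')" if "i < m" for i
    using arg_cong[OF g, of "\<lambda>w. w $ i"] that P by simp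
  have e': "x \<bullet> (J *\<^sub>v col P i) = x' \<bullet> (J *\<^sub>v col P' i)" if "i < m" for i
    using e[OF that] symplectic_gram_skew[OF J x(1), of "col P i"]
      symplectic_gram_skew[OF J x(2), of "col P' i"] that P by simp
  have e'': "col P i \<bullet> (J *\<^sub>v col P j) = col P' i \<bullet> (J *\<^sub>v col P' j)" if "i < m" "j < m" for i j
    using gram_index[OF Jc P(1) that] gram_index[OF Jc P(2) that] G by simp
  show ?thesis
  proof (rule eq_matI)
    fix i j assume "i < dim_row (gram J (append_col P' x'))" "j < dim_col (gram J (append_col P' x'))"
    then have ij: "i < Suc m" "j < Suc m" using P Jc by (auto simp: gram_def append_col_def)
    show "gram J (append_col P x) $$ (i, j) = gram J (append_col P' x') $$ (i, j)"
      unfolding gram_index[OF Jc append_col_carrier[OF P(1)] ij]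
        gram_index[OF Jc append_col_carrier[OF P(2)] ij]
      using cols[OF ij(1) P(1) x(1)] cols[OF ij(2) P(1) x(1)]
        cols[OF ij(1) P(2) x(2)] cols[OF ij(2) P(2) x(2)] e e' e'' symplectic_gramD(3)[OF J] x
      by simp
  qed (use P in \<open>auto simp: gram_def append_col_def\<close>)
qed

text \<open>Both frames are enlarged by one vector at a time until they are bases, where the
  isometry is the change of basis. Some \<open>x\<close> extends \<open>P\<close>; the admissible
  partners \<open>x'\<close> for \<open>P'\<close> are equally many, as both counts are determined
  by the common Gram matrix, so one exists. Degenerate and nondegenerate spans need no separate
  treatment.\<close>

theorem witt_extension:
  fixes P P' :: "'a::{finite,field} mat"
  assumes J: "symplectic_gram N J" and P: "frame N m P" and P': "frame N m P'"
    and G: "gram J P = gram J P'"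
  shows "\<exists>A\<in>isometries N J. A * P = P'"
proof -
  note Jc = symplectic_gramD(1,2)[OF J]
  have "m \<le> N" using P by (rule frame_le)
  then show ?thesis using P P' G
  proof (induction m arbitrary: P P' rule: inc_induct)
    case base
    note Pc = frame_carrier[OF base(1)] frame_carrier[OF base(2)]
    obtain S where S: "S \<in> carrier_mat N N" "P * S = 1\<^sub>m N" "S * P = 1\<^sub>m N"
      using square_frame_inverse[OF base(1)] by metis
    have "gram J (P' * S) = gram J (P * S)"
      using base(3) gram_mult[OF Jc(1) Pc(1) S(1)] gram_mult[OF Jc(1) Pc(2) S(1)] by simp
    also have "\<dots> = J" using S Jc by (simp add: gram_def)
    finally have "P' * S \<in> isometries N J" using S Pc by (simp add: isometries_def)
    moreover have "P' * S * P = P'"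
      using S Pc by (simp add: assoc_mult_mat[of _ N N _ N _ N])
    ultimately show ?case by blast
  next
    case (step m)
    note Pc = frame_carrier[OF step.prems(1)] frame_carrier[OF step.prems(2)]
    let ?X = "\<lambda>P g. {x \<in> carrier_vec N. x \<notin> (*\<^sub>v) P ` carrier_vec m \<and> P\<^sup>T *\<^sub>v (J *\<^sub>v x) = g}"
    obtain x where x: "x \<in> carrier_vec N" "x \<notin> (*\<^sub>v) P ` carrier_vec m"
      using frame_not_spanning step by blast
    define g where "g = P\<^sup>T *\<^sub>v (J *\<^sub>v x)"
    have "J *\<^sub>v x \<in> carrier_vec N" using Jc(1) x(1) by (rule mult_mat_vec_carrier)
    then have g: "g \<in> carrier_vec m"
      unfolding g_def using Pc(1) by (intro mult_mat_vec_carrier[of _ m N]) (simp_all only: transpose_carrier_mat)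
    have "finite (?X P g)" by (rule finite_subset[of _ "carrier_vec N"]) auto
    moreover have "x \<in> ?X P g" using x by (simp add: g_def)
    ultimately have "0 < card (?X P g)" by (auto simp: card_gt_0_iff)
    then have "0 < card (?X P' g)"
      using card_gram_fibre_off_image[OF step.prems(1) Jc g]
        card_gram_fibre_off_image[OF step.prems(2) Jc g] step.prems(3) by simp
    then obtain x' where x': "x' \<in> ?X P' g" by (metis (lifting) card.empty equals0I less_irrefl)
    have "gram J (append_col P x) = gram J (append_col P' x')"
      using gram_append_col_eq[OF J Pc x(1)] x' step.prems(3) by (simp add: g_def)
    with step.IH[of "append_col P x" "append_col P' x'"] x x' step.prems
    obtain A where A: "A \<in> isometries N J" "A * append_col P x = append_col P' x'"
      by (auto simp: frame_append_col)
    have "A * P = take_cols m (A * append_col P x)"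
      using take_cols_mult[of A N N "append_col P x" "Suc m" m] isometriesD(1)[OF A(1)] Pc by simp
    also have "\<dots> = P'" using A(2) Pc by simp
    finally show ?case using A(1) by blast
  qed
qed

lemma finite_carrier_mat: "finite (carrier_mat N m :: 'a::finite mat set)"
proof (rule finite_subset)
  show "carrier_mat N m \<subseteq> mat_of_cols N ` {xs :: 'a vec list. set xs \<subseteq> carrier_vec N \<and> length xs = m}"
  proof
    fix A :: "'a mat" assume A: "A \<in> carrier_mat N m"
    have "A = mat_of_cols N (cols A)" using mat_of_cols_cols[of A] A by simp
    moreover have "set (cols A) \<subseteq> carrier_vec N" "length (cols A) = m"
      using A cols_dim[of A] by auto
    ultimately show "A \<in> mat_of_cols N ` {xs. set xs \<subseteq> carrier_vec N \<and> length xs = m}" by blast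
  qed
qed (intro finite_imageI finite_lists_length_eq finite_carrier_vec)

lemma finite_isometries: "finite (isometries N (J :: 'a::{finite,field} mat))"
  by (rule finite_subset[OF _ finite_carrier_mat[of N N]]) (auto simp: isometries_def)

lemma square_frame_cancel_left:
  assumes "frame N N R" "A \<in> carrier_mat N k" "A' \<in> carrier_mat N k" "R * A = R * A'"
  shows "A = A'"
proof -
  obtain S where S: "S \<in> carrier_mat N N" "R * S = 1\<^sub>m N" "S * R = 1\<^sub>m N"
    using square_frame_inverse[OF assms(1)] by metis
  have "S * (R * X) = X" if "X \<in> carrier_mat N k" for X
    using assoc_mult_mat[of S N N R N X k] that S frame_carrier[OF assms(1)] by simp
  from this[OF assms(2)] this[OF assms(3)] assms(4) show ?thesis by (metis (lifting))
qed

lemma square_frame_cancel_right: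
  assumes "frame N N R" "A \<in> carrier_mat k N" "A' \<in> carrier_mat k N" "A * R = A' * R"
  shows "A = A'"
proof -
  obtain S where S: "S \<in> carrier_mat N N" "R * S = 1\<^sub>m N" "S * R = 1\<^sub>m N"
    using square_frame_inverse[OF assms(1)] by metis
  have "X * R * S = X" if "X \<in> carrier_mat k N" for X
    using assoc_mult_mat[of X k N R N S N] that S frame_carrier[OF assms(1)] by simp
  from this[OF assms(2)] this[OF assms(3)] assms(4) show ?thesis by (metis (lifting))
qed

text \<open>This is orbit counting: by Witt's theorem the frames with Gram matrix \<open>G\<close>
  form at most one orbit, and for a given \<open>P\<close> the isometries taking \<open>P\<close> to
  \<open>P * T\<close> form a coset of its stabiliser or the empty set. The product of the two
  counts is at most the group order. The argument is carried out as one injection into the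
  group.\<close>

lemma card_intertwining_fixed_gram:
  fixes T :: "'a::{finite,field} mat"
  assumes J: "symplectic_gram N J" and T: "T \<in> carrier_mat m m"
  shows "card {(A, P). A \<in> isometries N J \<and> frame N m P \<and> A * P = P * T \<and> gram J P = G}
    \<le> card (isometries N J)"
proof -
  let ?S = "{(A, P). A \<in> isometries N J \<and> frame N m P \<and> A * P = P * T \<and> gram J P = G}"
  note Jc = symplectic_gramD(1)[OF J]
  show ?thesis
  proof (cases "?S = {}")
    case False
    then obtain A0 P0 where P0: "frame N m P0" "gram J P0 = G" by blast
    have ex1: "\<exists>C\<in>isometries N J. C * P0 = P" if "(A, P) \<in> ?S" for A P
      using witt_extension[OF J P0(1), of P] that P0(2) by auto
    have ex2: "\<exists>D\<in>isometries N J. D * (P * T) = P" if "(A, P) \<in> ?S" for A P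
    proof -
      have A: "A \<in> isometries N J" "frame N m P" "A * P = P * T" using that by auto
      note c = isometriesD(1)[OF A(1)] frame_carrier[OF A(2)]
      have "frame N m (A * P)"
        using A(2) frame_isometry[OF J A(1)] c
        by (auto simp: frame_def assoc_mult_mat_vec[of A N N P m])
      moreover have "gram J (A * P) = gram J P" by (rule gram_isometry[OF Jc A(1) c(2)])
      ultimately show ?thesis using witt_extension[OF J _ A(2), of "A * P"] A(3) by simp
    qed
    \<comment> \<open>\<open>C P\<close> moves the reference frame \<open>P0\<close> to
      \<open>P\<close>, and \<open>D P\<close> moves \<open>P * T\<close>, which is
      \<open>A * P\<close>, back to \<open>P\<close>. Both depend on \<open>P\<close> alone. So
      \<open>D P * (A * C P)\<close> sends \<open>P0\<close> to \<open>P\<close>, which reveals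
      \<open>P\<close>, and then \<open>A\<close> is found by cancelling \<open>D P\<close> and
      \<open>C P\<close>.\<close>
    define C where "C P = (SOME C. C \<in> isometries N J \<and> C * P0 = P)" for P
    define D where "D P = (SOME D. D \<in> isometries N J \<and> D * (P * T) = P)" for P
    have C: "C P \<in> isometries N J" "C P * P0 = P" if "(A, P) \<in> ?S" for A P
      using someI_ex[OF ex1[OF that, unfolded Bex_def]] unfolding C_def by auto
    have D: "D P \<in> isometries N J" "D P * (P * T) = P" if "(A, P) \<in> ?S" for A P
      using someI_ex[OF ex2[OF that, unfolded Bex_def]] unfolding D_def by auto
    have recover: "(D P * (A * C P)) * P0 = P" if S: "(A, P) \<in> ?S" for A P
    proof -
      have A: "A \<in> isometries N J" "A * P = P * T" using S by auto
      note c = isometriesD(1)[OF A(1)] isometriesD(1)[OF C(1)[OF S]] isometriesD(1)[OF D(1)[OF S]]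
        frame_carrier[OF P0(1)]
      have "(D P * (A * C P)) * P0 = D P * ((A * C P) * P0)"
        using c by (intro assoc_mult_mat) auto
      also have "(A * C P) * P0 = A * (C P * P0)"
        using c by (intro assoc_mult_mat) auto
      finally show ?thesis using C(2)[OF S] D(2)[OF S] A(2) by simp
    qed
    have "inj_on (\<lambda>(A, P). D P * (A * C P)) ?S"
    proof (rule inj_onI)
      fix s s' assume s: "s \<in> ?S" "s' \<in> ?S"
        and eq: "(case s of (A, P) \<Rightarrow> D P * (A * C P)) = (case s' of (A, P) \<Rightarrow> D P * (A * C P))"
      obtain A P A' P' where ss: "s = (A, P)" "s' = (A', P')" by (metis surj_pair)
      have S: "(A, P) \<in> ?S" "(A', P') \<in> ?S" using s ss by simp_all
      have eq': "D P * (A * C P) = D P' * (A' * C P')" using eq ss by simp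
      have PP: "P = P'" using recover[OF S(1)] recover[OF S(2)] eq' by simp
      have A: "A \<in> isometries N J" "A' \<in> isometries N J" using S by auto
      note c = isometriesD(1)[OF A(1)] isometriesD(1)[OF A(2)] isometriesD(1)[OF C(1)[OF S(1)]]
      have "A * C P = A' * C P"
        using square_frame_cancel_left[OF frame_isometry[OF J D(1)[OF S(1)]], of "A * C P" N "A' * C P"]
          eq' PP c by simp
      then have "A = A'"
        using square_frame_cancel_right[OF frame_isometry[OF J C(1)[OF S(1)]]] c by blast
      with PP ss show "s = s'" by simp
    qed
    moreover have "(\<lambda>(A, P). D P * (A * C P)) ` ?S \<subseteq> isometries N J"
      using C D isometries_mult[OF Jc] by fastforce
    ultimately show ?thesis using card_inj_on_le finite_isometries by blast
  next
    case True
    then show ?thesis by (metis card.empty le0)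
  qed
qed

section \<open>Cyclic frames of isometries\<close>

lemma irreducible_degree_pos: "irreducible f \<Longrightarrow> 0 < degree (f :: 'a::field poly)"
  using is_unit_iff_degree[of f] by auto

text \<open>A nonzero element of least degree in the ideal generated by \<open>p\<close> and
  \<open>q\<close> divides every element of that ideal, by division with remainder.\<close>

lemma poly_bezout:
  fixes p q :: "'a::field poly"
  assumes "p \<noteq> 0"
  shows "\<exists>a b d. d = a * p + b * q \<and> d \<noteq> 0 \<and> d dvd p \<and> d dvd q"
proof -
  define S where "S = {d. d \<noteq> 0 \<and> (\<exists>a b. d = a * p + b * q)}"
  have "p = 1 * p + 0 * q" by simp
  with assms have "p \<in> S" unfolding S_def by blast
  from arg_min_nat_lemma[of "\<lambda>d. d \<in> S", OF this, of degree]
  obtain d where d: "d \<in> S" "\<And>y. y \<in> S \<Longrightarrow> degree d \<le> degree y" by blast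
  then obtain a b where ab: "d = a * p + b * q" and d0: "d \<noteq> 0" by (auto simp: S_def)
  have dvd: "d dvd x" if x: "x = a' * p + b' * q" for x a' b'
  proof (rule ccontr)
    assume "\<not> d dvd x"
    then have nz: "x mod d \<noteq> 0" by (simp add: mod_eq_0_iff_dvd)
    have "x mod d = x - (x div d) * d" by (simp add: minus_div_mult_eq_mod)
    also have "\<dots> = (a' - (x div d) * a) * p + (b' - (x div d) * b) * q"
      by (simp only: x ab) (simp add: algebra_simps)
    finally have "x mod d \<in> S" using nz unfolding S_def by blast
    with d(2) degree_mod_less[OF d0, of x] nz show False by fastforce
  qed
  have "d dvd p" using dvd[of p 1 0] by simp
  moreover have "d dvd q" using dvd[of q 0 1] by simp
  ultimately show ?thesis using ab d0 by blast
qed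

text \<open>Irreducibility makes the common divisor of \<open>f\<close> and \<open>r\<close> a unit.
  Multiplying the identity for \<open>f ^ j\<close> by the resulting identity for \<open>f\<close>
  gives the one for \<open>f ^ Suc j\<close>.\<close>

lemma irreducible_bezout:
  fixes f r :: "'a::field poly"
  assumes f: "irreducible f" and r: "\<not> f dvd r"
  shows "\<exists>a b. a * f ^ j + b * r = 1"
proof (induction j)
  case 0
  show ?case by (intro exI[of _ 1] exI[of _ 0]) simp
next
  case (Suc j)
  then obtain a b where ab: "a * f ^ j + b * r = 1" by blast
  obtain a' b' d where d: "d = a' * f + b' * r" "d \<noteq> 0" "d dvd f" "d dvd r"
    using poly_bezout[of f r] f by auto
  from d(3) obtain h where h: "f = d * h" by (elim dvdE)
  have "\<not> is_unit h"
  proof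
    assume "is_unit h"
    then obtain h' where "h * h' = 1" by (elim dvdE) simp
    then have "f * h' = d" by (simp add: h mult.assoc)
    then have "f dvd d" by (metis dvd_triv_left)
    with d(4) r dvd_trans show False by blast
  qed
  then have "is_unit d" using irreducibleD[OF f h] by blast
  then obtain d' where "1 = d * d'" by (elim dvdE)
  then have "1 = d * d' * (a * f ^ j + b * r)" by (simp add: ab)
  also have "\<dots> = (d' * a' * a) * f ^ Suc j + (d' * a' * f * b + d' * b' * (a * f ^ j + b * r)) * r"
    by (simp add: d(1) algebra_simps)
  finally show ?case by metis
qed

text \<open>This is p(A) v, evaluated by Horner's rule directly on vectors. It makes the space a
  module over the polynomial ring without forming powers of the matrix.\<close>

definition act :: "'a::field mat \<Rightarrow> 'a poly \<Rightarrow> 'a vec \<Rightarrow> 'a vec" where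
  "act A p v = fold_coeffs (\<lambda>c w. c \<cdot>\<^sub>v v + A *\<^sub>v w) p (0\<^sub>v (dim_vec v))"

context
  fixes A :: "'a::field mat" and N :: nat
  assumes A: "A \<in> carrier_mat N N"
begin

lemma act_0 [simp]: "v \<in> carrier_vec N \<Longrightarrow> act A 0 v = 0\<^sub>v N"
  by (simp add: act_def)

lemma act_pCons:
  assumes "v \<in> carrier_vec N"
  shows "act A (pCons c p) v = c \<cdot>\<^sub>v v + A *\<^sub>v act A p v"
proof (cases "p = 0 \<and> c = 0")
  case True
  then show ?thesis using assms A by (auto simp: act_def)
next
  case False
  then show ?thesis by (auto simp: act_def fold_coeffs_pCons_coeff_not_0_eq fold_coeffs_pCons_not_0_0_eq)
qed

lemma act_carrier [simp]: "v \<in> carrier_vec N \<Longrightarrow> act A p v \<in> carrier_vec N"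
  by (induction p) (use A in \<open>auto simp: act_pCons\<close>)

lemma act_add:
  assumes v: "v \<in> carrier_vec N"
  shows "act A (p + q) v = act A p v + act A q v"
proof (induction p q rule: poly_induct2)
  case (pCons c p d q)
  have "act A (pCons c p + pCons d q) v = (c + d) \<cdot>\<^sub>v v + (A *\<^sub>v act A p v + A *\<^sub>v act A q v)"
    using v A pCons by (simp add: act_pCons mult_add_distrib_mat_vec[OF A])
  also have "\<dots> = (c \<cdot>\<^sub>v v + A *\<^sub>v act A p v) + (d \<cdot>\<^sub>v v + A *\<^sub>v act A q v)"
    using v A by (intro eq_vecI) (auto simp: algebra_simps)
  finally show ?case using v by (simp add: act_pCons)
qed (use v in simp)

lemma act_smult:
  assumes v: "v \<in> carrier_vec N"
  shows "act A (Polynomial.smult c p) v = c \<cdot>\<^sub>v act A p v"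
proof (induction p)
  case (pCons a p)
  have "act A (Polynomial.smult c (pCons a p)) v = (c * a) \<cdot>\<^sub>v v + A *\<^sub>v (c \<cdot>\<^sub>v act A p v)"
    using v pCons by (simp add: act_pCons)
  also have "\<dots> = (c * a) \<cdot>\<^sub>v v + c \<cdot>\<^sub>v (A *\<^sub>v act A p v)"
    using v by (simp add: mult_mat_vec[OF A])
  also have "\<dots> = c \<cdot>\<^sub>v (a \<cdot>\<^sub>v v + A *\<^sub>v act A p v)"
    using v A by (intro eq_vecI) (auto simp: algebra_simps)
  finally show ?case using v by (simp add: act_pCons)
qed (use v in \<open>auto\<close>)

lemma act_add_vec:
  assumes v: "u \<in> carrier_vec N" "v \<in> carrier_vec N"
  shows "act A p (u + v) = act A p u + act A p v"
proof (induction p)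
  case (pCons a p)
  have "act A (pCons a p) (u + v) = a \<cdot>\<^sub>v (u + v) + (A *\<^sub>v act A p u + A *\<^sub>v act A p v)"
    using v pCons by (simp add: act_pCons mult_add_distrib_mat_vec[OF A])
  also have "\<dots> = (a \<cdot>\<^sub>v u + A *\<^sub>v act A p u) + (a \<cdot>\<^sub>v v + A *\<^sub>v act A p v)"
    using v A by (intro eq_vecI) (auto simp: algebra_simps)
  finally show ?case using v by (simp add: act_pCons)
qed (use v in simp)

lemma act_mult_mat_vec:
  assumes v: "v \<in> carrier_vec N"
  shows "act A p (A *\<^sub>v v) = A *\<^sub>v act A p v"
proof (induction p)
  case (pCons a p)
  have Av: "A *\<^sub>v v \<in> carrier_vec N" using A v by simp
  have "act A (pCons a p) (A *\<^sub>v v) = a \<cdot>\<^sub>v (A *\<^sub>v v) + A *\<^sub>v (A *\<^sub>v act A p v)"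
    using Av pCons by (simp add: act_pCons)
  also have "\<dots> = A *\<^sub>v (a \<cdot>\<^sub>v v + A *\<^sub>v act A p v)"
    using v A by (simp add: mult_add_distrib_mat_vec[OF A] mult_mat_vec[OF A])
  finally show ?case using v by (simp add: act_pCons)
qed (use v A in auto)

lemma act_mult:
  assumes v: "v \<in> carrier_vec N"
  shows "act A (p * q) v = act A p (act A q v)"
proof (induction p)
  case (pCons a p)
  have "act A (pCons a p * q) v = a \<cdot>\<^sub>v act A q v + (0 \<cdot>\<^sub>v v + A *\<^sub>v act A p (act A q v))"
    using v pCons by (simp add: act_add act_smult act_pCons)
  also have "\<dots> = a \<cdot>\<^sub>v act A q v + A *\<^sub>v act A p (act A q v)"
    using v A by (intro eq_vecI) auto
  finally show ?case using v by (simp add: act_pCons)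
qed (use v in auto)

lemma act_1 [simp]: "v \<in> carrier_vec N \<Longrightarrow> act A 1 v = v"
  using A by (simp add: one_pCons act_pCons) (auto intro!: eq_vecI)

lemma act_zero_vec [simp]: "act A p (0\<^sub>v N) = 0\<^sub>v N"
  by (induction p) (use A in \<open>auto simp: act_pCons\<close>)

lemma funpow_mult_mat_vec_carrier [simp]:
  "v \<in> carrier_vec N \<Longrightarrow> ((*\<^sub>v) A ^^ j) v \<in> carrier_vec N"
  by (induction j) (use A in auto)

lemma act_index:
  assumes "v \<in> carrier_vec N" "i < N" "\<And>j. j \<ge> n \<Longrightarrow> coeff p j = 0"
  shows "act A p v $ i = (\<Sum>j<n. coeff p j * ((*\<^sub>v) A ^^ j) v $ i)"
  using assms
proof (induction p arbitrary: v n)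
  case (pCons c p)
  show ?case
  proof (cases n)
    case 0
    with pCons.prems(3)[of 0] pCons.prems(3)[of "Suc _"] have "c = 0" "p = 0"
      by (auto simp: poly_eq_iff)
    with pCons.hyps show ?thesis by simp
  next
    case (Suc n')
    have z: "coeff p j = 0" if "j \<ge> n'" for j
      using pCons.prems(3)[of "Suc j"] that Suc by simp
    have "act A (pCons c p) v $ i = c * v $ i + act A p (A *\<^sub>v v) $ i"
      using pCons.prems A by (simp add: act_pCons act_mult_mat_vec)
    also have "act A p (A *\<^sub>v v) $ i = (\<Sum>j<n'. coeff p j * ((*\<^sub>v) A ^^ j) (A *\<^sub>v v) $ i)"
      using pCons.prems A z by (intro pCons.IH) auto
    finally show ?thesis
      by (simp add: Suc sum.lessThan_Suc_shift funpow_swap1 del: sum.lessThan_Suc)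
  qed
qed simp

end

section \<open>Krylov matrices and companion matrices\<close>

definition vpoly :: "'a::zero vec \<Rightarrow> 'a poly" where
  "vpoly u = Poly (list_of_vec u)"

lemma coeff_vpoly: "coeff (vpoly u) j = (if j < dim_vec u then u $ j else 0)"
  by (simp add: vpoly_def nth_default_def list_of_vec_index)

definition krylov :: "'a::field mat \<Rightarrow> 'a vec \<Rightarrow> nat \<Rightarrow> 'a mat" where
  "krylov A v D = mat (dim_vec v) D (\<lambda>(i, j). ((*\<^sub>v) A ^^ j) v $ i)"

definition companion :: "'a::field poly \<Rightarrow> 'a mat" where
  "companion f = mat (degree f) (degree f)
     (\<lambda>(i, j). if Suc j = degree f then - coeff f i else if i = Suc j then 1 else 0)"

lemma companion_carrier [simp]: "companion f \<in> carrier_mat (degree f) (degree f)"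
  by (simp add: companion_def)

lemma krylov_carrier [simp]: "v \<in> carrier_vec N \<Longrightarrow> krylov A v D \<in> carrier_mat N D"
  by (auto simp: krylov_def)

lemma col_krylov:
  assumes "A \<in> carrier_mat N N" "v \<in> carrier_vec N" "j < D"
  shows "col (krylov A v D) j = ((*\<^sub>v) A ^^ j) v"
  using assms(2,3) carrier_vecD[OF funpow_mult_mat_vec_carrier[OF assms(1,2), of j]]
  by (intro eq_vecI) (auto simp: krylov_def)

lemma krylov_mult_vec:
  assumes A: "A \<in> carrier_mat N N" and v: "v \<in> carrier_vec N" and u: "u \<in> carrier_vec D"
  shows "krylov A v D *\<^sub>v u = act A (vpoly u) v"
proof (rule eq_vecI)
  fix i assume "i < dim_vec (act A (vpoly u) v)"
  then have i: "i < N" using carrier_vecD[OF act_carrier[OF A v]] by simp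
  have "(krylov A v D *\<^sub>v u) $ i = (\<Sum>j<D. u $ j * ((*\<^sub>v) A ^^ j) v $ i)"
    using i v u by (auto simp: krylov_def scalar_prod_def lessThan_atLeast0 mult.commute intro!: sum.cong)
  also have "\<dots> = act A (vpoly u) v $ i"
    using u by (subst act_index[OF A v i, of D]) (auto simp: coeff_vpoly)
  finally show "(krylov A v D *\<^sub>v u) $ i = act A (vpoly u) v $ i" .
qed (use carrier_vecD[OF act_carrier[OF A v]] v in \<open>auto simp: krylov_def\<close>)

lemma act_monom:
  assumes A: "A \<in> carrier_mat N N" and v: "v \<in> carrier_vec N"
  shows "act A (monom 1 k) v = ((*\<^sub>v) A ^^ k) v"
proof (induction k)
  case (Suc k)
  have "act A (monom 1 (Suc k)) v = 0 \<cdot>\<^sub>v v + A *\<^sub>v ((*\<^sub>v) A ^^ k) v"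
    using A v by (simp add: monom_Suc act_pCons Suc)
  then show ?case using A v by auto
qed (use A v in \<open>simp flip: one_pCons add: monom_0\<close>)

lemma vpoly_companion_col:
  assumes "j < degree f" "lead_coeff f = 1"
  shows "vpoly (col (companion f) j) = (if Suc j = degree f then monom 1 (degree f) - f else monom 1 (Suc j))"
  using assms by (auto simp: poly_eq_iff coeff_vpoly companion_def coeff_eq_0)

lemma krylov_companion:
  assumes A: "A \<in> carrier_mat N N" and v: "v \<in> carrier_vec N"
    and f: "lead_coeff f = 1" and v0: "act A f v = 0\<^sub>v N"
  shows "A * krylov A v (degree f) = krylov A v (degree f) * companion f"
proof (rule eq_matI)
  let ?K = "krylov A v (degree f)"
  note K = krylov_carrier[OF v, of A "degree f"]
  fix i j assume "i < dim_row (?K * companion f)" "j < dim_col (?K * companion f)"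
  then have i: "i < N" and j: "j < degree f" using K by (auto simp: companion_def)
  have "(?K * companion f) $$ (i, j) = (?K *\<^sub>v col (companion f) j) $ i"
    using K i j by (auto simp: companion_def)
  also have "?K *\<^sub>v col (companion f) j = act A (vpoly (col (companion f) j)) v"
    using j by (intro krylov_mult_vec[OF A v]) (auto simp: companion_def)
  also have "\<dots> = ((*\<^sub>v) A ^^ Suc j) v"
  proof (cases "Suc j = degree f")
    case True
    \<comment> \<open>The last column of the companion matrix encodes X^d - f. As \<open>f\<close>
      kills \<open>v\<close>, this polynomial acts on \<open>v\<close> like X^d.\<close>
    have "monom 1 (degree f) = (monom 1 (degree f) - f) + f" by simp
    then have "act A (monom 1 (degree f)) v = act A (monom 1 (degree f) - f) v + act A f v"
      using act_add[OF A v] by metis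
    then have "act A (monom 1 (degree f) - f) v = ((*\<^sub>v) A ^^ degree f) v"
      using A v v0 by (simp add: act_monom)
    then show ?thesis using vpoly_companion_col[OF j f] True by simp
  next
    case False
    then show ?thesis using vpoly_companion_col[OF j f] act_monom[OF A v, of "Suc j"] by simp
  qed
  also have "\<dots> $ i = (A * ?K) $$ (i, j)"
    using i j A K col_krylov[OF A v j] by simp
  finally show "(A * ?K) $$ (i, j) = (?K * companion f) $$ (i, j)" ..
qed (use A v in \<open>auto simp: krylov_def companion_def\<close>)

lemma irreducible_power_split:
  fixes f p :: "'a::field poly"
  assumes f: "irreducible f" and "p \<noteq> 0"
  shows "\<exists>i r. p = f ^ i * r \<and> \<not> f dvd r"
  using assms(2)
proof (induction "degree p" arbitrary: p rule: less_induct)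
  case less
  show ?case
  proof (cases "f dvd p")
    case True
    then obtain g where g: "p = f * g" by (elim dvdE)
    have "f \<noteq> 0" "g \<noteq> 0" using g less.prems by auto
    moreover have "0 < degree f" using f by (rule irreducible_degree_pos)
    ultimately obtain i r where "g = f ^ i * r" "\<not> f dvd r"
      using less.hyps[of g] g by (auto simp: degree_mult_eq)
    then show ?thesis using g by (intro exI[of _ "Suc i"] exI[of _ r]) simp
  next
    case False
    then show ?thesis by (intro exI[of _ 0] exI[of _ p]) simp
  qed
qed

text \<open>The annihilator of \<open>v\<close> is exactly \<open>f ^ Suc j\<close>. A nonzero
  \<open>p\<close> of smaller degree is \<open>f ^ i * r\<close> with \<open>i \<le> j\<close> and
  \<open>r\<close> prime to \<open>f\<close>, so \<open>f ^ j\<close> lies in the ideal generated by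
  \<open>p\<close> and \<open>f ^ Suc j\<close>; if \<open>p\<close> killed \<open>v\<close>, so
  would \<open>f ^ j\<close>.\<close>

lemma frame_krylov:
  assumes A: "A \<in> carrier_mat N N" and v: "v \<in> carrier_vec N"
    and f: "irreducible f" and v0: "act A (f ^ Suc j) v = 0\<^sub>v N" and v1: "act A (f ^ j) v \<noteq> 0\<^sub>v N"
  shows "frame N (degree (f ^ Suc j)) (krylov A v (degree (f ^ Suc j)))"
proof -
  let ?D = "degree (f ^ Suc j)"
  have f0: "f \<noteq> 0" and nu: "\<not> is_unit f" using f by auto
  have zero: "p = 0" if p: "degree p < ?D" "act A p v = 0\<^sub>v N" for p
  proof (rule ccontr)
    assume p0: "p \<noteq> 0"
    obtain i r where r: "p = f ^ i * r" "\<not> f dvd r" using irreducible_power_split[OF f p0] by blast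
    then obtain a b where ab: "a * f ^ Suc j + b * r = 1" using irreducible_bezout[OF f r(2)] by blast
    have "i \<le> j"
    proof (rule ccontr)
      assume "\<not> i \<le> j"
      then have "f ^ Suc j dvd p" unfolding r(1) by (intro dvd_mult2 le_imp_power_dvd) simp
      then have "?D \<le> degree p" using p0 by (rule dvd_imp_degree_le)
      with p show False by simp
    qed
    then have fj: "f ^ j = f ^ (j - i) * f ^ i" by (simp flip: power_add)
    have "f ^ j = (a * f ^ Suc j + b * r) * f ^ j" by (simp only: ab mult_1_left)
    also have "\<dots> = (a * f ^ j) * f ^ Suc j + (b * f ^ (j - i)) * p"
      by (simp add: r(1) fj algebra_simps)
    finally have "act A (f ^ j) v = act A (a * f ^ j) (act A (f ^ Suc j) v) + act A (b * f ^ (j - i)) (act A p v)"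
      using act_add[OF A v] act_mult[OF A v] by metis
    then show False using v0 v1 p A by simp
  qed
  show ?thesis
    unfolding frame_def
  proof (intro conjI ballI impI)
    fix u assume u: "u \<in> carrier_vec ?D" and "krylov A v ?D *\<^sub>v u = 0\<^sub>v N"
    then have "act A (vpoly u) v = 0\<^sub>v N" using krylov_mult_vec[OF A v u] by simp
    moreover have "degree (vpoly u) < ?D \<or> vpoly u = 0"
    proof -
      have "\<forall>i>?D - 1. coeff (vpoly u) i = 0" using u by (auto simp: coeff_vpoly)
      then have "degree (vpoly u) \<le> ?D - 1" by (rule degree_le)
      moreover have "0 < ?D" using nu is_unit_iff_degree[OF f0] by (simp only: degree_power_eq[OF f0]) simp
      ultimately show ?thesis by linarith
    qed
    ultimately have "vpoly u = 0" using zero by blast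
    then have "u $ i = 0" if "i < ?D" for i
      using coeff_vpoly[of u i] that u by simp
    then show "u = 0\<^sub>v ?D" using u by (intro eq_vecI) auto
  qed (use v in simp)
qed

lemma mult_mat_zero_vec:
  "A \<in> carrier_mat nr nc \<Longrightarrow> A *\<^sub>v 0\<^sub>v nc = (0\<^sub>v nr :: 'a::semiring_0 vec)"
  by (intro eq_vecI) auto

section \<open>The form on cyclic frames\<close>

lemma isometry_form:
  assumes J: "J \<in> carrier_mat N N" and A: "A \<in> isometries N J"
    and u: "u \<in> carrier_vec N" and w: "w \<in> carrier_vec N"
  shows "(A *\<^sub>v u) \<bullet> (J *\<^sub>v (A *\<^sub>v w)) = u \<bullet> (J *\<^sub>v w)"
proof -
  note Ac = isometriesD(1)[OF A]
  have c: "A *\<^sub>v u \<in> carrier_vec N" "A *\<^sub>v w \<in> carrier_vec N" "J *\<^sub>v (A *\<^sub>v w) \<in> carrier_vec N"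
    using Ac J u w by simp_all
  have "(A *\<^sub>v u) \<bullet> (J *\<^sub>v (A *\<^sub>v w)) = (J *\<^sub>v (A *\<^sub>v w)) \<bullet> (A *\<^sub>v u)"
    using c by (intro comm_scalar_prod)
  also have "\<dots> = (A\<^sup>T *\<^sub>v (J *\<^sub>v (A *\<^sub>v w))) \<bullet> u"
    using transpose_vec_mult_scalar[OF Ac u c(3)] by simp
  also have "A\<^sup>T *\<^sub>v (J *\<^sub>v (A *\<^sub>v w)) = gram J A *\<^sub>v w"
    using Ac J w assoc_mult_mat_vec[of "A\<^sup>T" N N "J * A" N w] by (simp add: gram_def)
  also have "\<dots> = J *\<^sub>v w" using isometriesD(2)[OF A] by simp
  also have "(J *\<^sub>v w) \<bullet> u = u \<bullet> (J *\<^sub>v w)"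
    using J u w by (intro comm_scalar_prod[of _ N]) auto
  finally show ?thesis .
qed

lemma isometry_form_funpow:
  assumes J: "J \<in> carrier_mat N N" and A: "A \<in> isometries N J"
    and u: "u \<in> carrier_vec N" and w: "w \<in> carrier_vec N"
  shows "((*\<^sub>v) A ^^ k) u \<bullet> (J *\<^sub>v ((*\<^sub>v) A ^^ k) w) = u \<bullet> (J *\<^sub>v w)"
proof (induction k)
  case (Suc k)
  then show ?case
    using isometry_form[OF J A, of "((*\<^sub>v) A ^^ k) u" "((*\<^sub>v) A ^^ k) w"] u w
      funpow_mult_mat_vec_carrier[OF isometriesD(1)[OF A]] by simp
qed simp

lemma form_act_right:
  assumes J: "J \<in> carrier_mat N N" and A: "A \<in> carrier_mat N N"
    and u: "u \<in> carrier_vec N" and w: "w \<in> carrier_vec N" and n: "\<And>j. j \<ge> n \<Longrightarrow> coeff p j = 0"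
  shows "u \<bullet> (J *\<^sub>v act A p w) = (\<Sum>l<n. coeff p l * (u \<bullet> (J *\<^sub>v ((*\<^sub>v) A ^^ l) w)))"
proof -
  have Ju: "J\<^sup>T *\<^sub>v u \<in> carrier_vec N" using J u by simp
  have t: "u \<bullet> (J *\<^sub>v x) = (\<Sum>i<N. (J\<^sup>T *\<^sub>v u) $ i * x $ i)" if x: "x \<in> carrier_vec N" for x
    using transpose_vec_mult_scalar[OF J x u] x by (simp add: scalar_prod_def lessThan_atLeast0)
  have "u \<bullet> (J *\<^sub>v act A p w) = (\<Sum>i<N. (J\<^sup>T *\<^sub>v u) $ i * (\<Sum>l<n. coeff p l * ((*\<^sub>v) A ^^ l) w $ i))"
    using t[of "act A p w"] act_index[OF A w _ n] act_carrier[OF A w] by simp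
  also have "\<dots> = (\<Sum>l<n. coeff p l * (\<Sum>i<N. (J\<^sup>T *\<^sub>v u) $ i * ((*\<^sub>v) A ^^ l) w $ i))"
    unfolding sum_distrib_left by (subst sum.swap) (simp add: mult_ac)
  also have "\<dots> = (\<Sum>l<n. coeff p l * (u \<bullet> (J *\<^sub>v ((*\<^sub>v) A ^^ l) w)))"
    using t funpow_mult_mat_vec_carrier[OF A w] by simp
  finally show ?thesis .
qed

lemma form_act_left:
  assumes J: "symplectic_gram N J" and A: "A \<in> carrier_mat N N"
    and u: "u \<in> carrier_vec N" and w: "w \<in> carrier_vec N" and n: "\<And>j. j \<ge> n \<Longrightarrow> coeff p j = 0"
  shows "act A p w \<bullet> (J *\<^sub>v u) = (\<Sum>l<n. coeff p l * (((*\<^sub>v) A ^^ l) w \<bullet> (J *\<^sub>v u)))"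
proof -
  have "act A p w \<bullet> (J *\<^sub>v u) = - (\<Sum>l<n. coeff p l * (u \<bullet> (J *\<^sub>v ((*\<^sub>v) A ^^ l) w)))"
    using symplectic_gram_skew[OF J act_carrier[OF A w] u]
      form_act_right[OF symplectic_gramD(1)[OF J] A u w n] by simp
  also have "\<dots> = (\<Sum>l<n. coeff p l * (((*\<^sub>v) A ^^ l) w \<bullet> (J *\<^sub>v u)))"
    using symplectic_gram_skew[OF J u funpow_mult_mat_vec_carrier[OF A w]]
    by (simp add: sum_negf[symmetric])
  finally show ?thesis .
qed

text \<open>By invariance of the form, the Gram matrix of v, A v, A^2 v, ... has entries depending
  only on the difference of the indices, so this one sequence determines it.\<close>

definition autocorr :: "'a::field mat \<Rightarrow> 'a mat \<Rightarrow> 'a vec \<Rightarrow> nat \<Rightarrow> 'a" where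
  "autocorr J A v t = v \<bullet> (J *\<^sub>v ((*\<^sub>v) A ^^ t) v)"

lemma form_funpow_autocorr:
  assumes J: "symplectic_gram N J" and A: "A \<in> isometries N J" and v: "v \<in> carrier_vec N"
  shows "((*\<^sub>v) A ^^ i) v \<bullet> (J *\<^sub>v ((*\<^sub>v) A ^^ j) v) =
    (if i \<le> j then autocorr J A v (j - i) else - autocorr J A v (i - j))"
proof -
  note Jc = symplectic_gramD(1)[OF J] and c = funpow_mult_mat_vec_carrier[OF isometriesD(1)[OF A] v]
  have *: "((*\<^sub>v) A ^^ i) v \<bullet> (J *\<^sub>v ((*\<^sub>v) A ^^ j) v) = autocorr J A v (j - i)" if "i \<le> j" for i j
  proof -
    have "((*\<^sub>v) A ^^ j) v = ((*\<^sub>v) A ^^ i) (((*\<^sub>v) A ^^ (j - i)) v)"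
      using that by (metis comp_apply funpow_add le_add_diff_inverse)
    then show ?thesis
      using isometry_form_funpow[OF Jc A v c, of i] by (simp add: autocorr_def)
  qed
  then show ?thesis
    using symplectic_gram_skew[OF J c c, of i j] by auto
qed

lemma gram_krylov_index:
  assumes J: "symplectic_gram N J" and A: "A \<in> isometries N J" and v: "v \<in> carrier_vec N"
    and "i < D" "j < D"
  shows "gram J (krylov A v D) $$ (i, j) =
    (if i \<le> j then autocorr J A v (j - i) else - autocorr J A v (i - j))"
  using gram_index[OF symplectic_gramD(1)[OF J] krylov_carrier[OF v] assms(4,5), of A]
    col_krylov[OF isometriesD(1)[OF A] v] assms(4,5) form_funpow_autocorr[OF J A v, of i j] by simp

text \<open>The recurrence satisfied by the autocorrelations, shifted to be centred, expresses the entry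
  with the largest index by the earlier ones, so half of the entries determine all of them.\<close>

lemma autocorr_determined:
  assumes J: "symplectic_gram N J" and f: "lead_coeff f = 1"
    and A: "A \<in> isometries N J" and v: "v \<in> carrier_vec N" and v0: "act A f v = 0\<^sub>v N"
    and A': "A' \<in> isometries N J" and v': "v' \<in> carrier_vec N" and v0': "act A' f v' = 0\<^sub>v N"
    and eq: "\<And>t. 1 \<le> t \<Longrightarrow> t \<le> degree f div 2 \<Longrightarrow> autocorr J A v t = autocorr J A' v' t"
    and "t < degree f"
  shows "autocorr J A v t = autocorr J A' v' t"
  using \<open>t < degree f\<close>
proof (induction t rule: less_induct)
  case (less t)
  let ?D = "degree f"
  consider "t = 0" | "1 \<le> t" "t \<le> ?D div 2" | "?D div 2 < t" by linarith
  then show ?case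
  proof cases
    case 1
    then show ?thesis using symplectic_gramD(3)[OF J] v v' by (simp add: autocorr_def)
  next
    case 2
    then show ?thesis by (rule eq)
  next
    case 3
    define s where "s = ?D - t"
    have s: "s < t" "t = ?D - s" "s \<le> ?D" using 3 less.prems by (auto simp: s_def)
    have rec: "autocorr J A v t = - (\<Sum>l<?D. coeff f l *
        (if s \<le> l then autocorr J A v (l - s) else - autocorr J A v (s - l)))"
      if A: "A \<in> isometries N J" and v: "v \<in> carrier_vec N" and v0: "act A f v = 0\<^sub>v N" for A v
    proof -
      note Jc = symplectic_gramD(1)[OF J] and Ac = isometriesD(1)[OF A]
      have "0 = ((*\<^sub>v) A ^^ s) v \<bullet> (J *\<^sub>v act A f v)"
        using v0 mult_mat_zero_vec[OF Jc] funpow_mult_mat_vec_carrier[OF Ac v] by simp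
      also have "\<dots> = (\<Sum>l<Suc ?D. coeff f l * (((*\<^sub>v) A ^^ s) v \<bullet> (J *\<^sub>v ((*\<^sub>v) A ^^ l) v)))"
        by (rule form_act_right[OF Jc Ac funpow_mult_mat_vec_carrier[OF Ac v] v]) (simp add: coeff_eq_0)
      also have "\<dots> = (\<Sum>l<?D. coeff f l * (((*\<^sub>v) A ^^ s) v \<bullet> (J *\<^sub>v ((*\<^sub>v) A ^^ l) v)))
          + autocorr J A v t"
        using f s form_funpow_autocorr[OF J A v, of s ?D] by simp
      finally show ?thesis
        unfolding form_funpow_autocorr[OF J A v] by (simp add: eq_neg_iff_add_eq_0 add.commute)
    qed
    have "autocorr J A v (l - s) = autocorr J A' v' (l - s)" if "l < ?D" for l
      using less.IH[of "l - s"] that s less.prems by fastforce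
    moreover have "autocorr J A v (s - l) = autocorr J A' v' (s - l)" for l
      using less.IH[of "s - l"] s less.prems by fastforce
    ultimately show ?thesis
      unfolding rec[OF A v v0] rec[OF A' v' v0']
      by (intro arg_cong[of _ _ uminus] sum.cong) auto
  qed
qed

text \<open>The map \<open>?h\<close> records the entries 1 to \<open>degree f div 2\<close> of the
  first row. It is injective by \<open>autocorr_determined\<close>: entry 0 vanishes because the
  form is alternating, and the remaining entries follow from the recurrence.\<close>

lemma card_krylov_grams:
  fixes J :: "'a::{finite,field} mat"
  assumes J: "symplectic_gram N J" and f: "lead_coeff f = 1"
  shows "card {gram J (krylov A v (degree f)) | A v.
      A \<in> isometries N J \<and> v \<in> carrier_vec N \<and> act A f v = 0\<^sub>v N} \<le> CARD('a) ^ (degree f div 2)"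
proof -
  let ?D = "degree f"
  let ?G = "{gram J (krylov A v ?D) | A v. A \<in> isometries N J \<and> v \<in> carrier_vec N \<and> act A f v = 0\<^sub>v N}"
  let ?h = "\<lambda>G :: 'a mat. vec (?D div 2) (\<lambda>t. G $$ (0, Suc t))"
  have "inj_on ?h ?G"
  proof (rule inj_onI)
    fix G G' assume "G \<in> ?G" "G' \<in> ?G" and h: "?h G = ?h G'"
    then obtain A v A' v' where
      A: "A \<in> isometries N J" "v \<in> carrier_vec N" "act A f v = 0\<^sub>v N" "G = gram J (krylov A v ?D)" and
      A': "A' \<in> isometries N J" "v' \<in> carrier_vec N" "act A' f v' = 0\<^sub>v N" "G' = gram J (krylov A' v' ?D)"
      by blast
    have t: "autocorr J A v t = autocorr J A' v' t" if "t < ?D" for t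
    proof (rule autocorr_determined[OF J f A(1-3) A'(1-3) _ that])
      fix t assume t: "1 \<le> t" "t \<le> ?D div 2"
      then have "t < ?D" by linarith
      moreover have "G $$ (0, t) = G' $$ (0, t)"
        using arg_cong[OF h, of "\<lambda>w. w $ (t - 1)"] t by simp
      ultimately show "autocorr J A v t = autocorr J A' v' t"
        using gram_krylov_index[OF J A(1,2), of 0 ?D t] gram_krylov_index[OF J A'(1,2), of 0 ?D t]
          A(4) A'(4) by simp
    qed
    show "G = G'"
    proof (rule eq_matI)
      fix i j assume "i < dim_row G'" "j < dim_col G'"
      then have "i < ?D" "j < ?D" using A'(4) by (auto simp: gram_def krylov_def)
      then show "G $$ (i, j) = G' $$ (i, j)"
        using t gram_krylov_index[OF J A(1,2)] gram_krylov_index[OF J A'(1,2)] A(4) A'(4) by simp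
    qed (auto simp: A(4) A'(4) gram_def krylov_def)
  qed
  moreover have "?h ` ?G \<subseteq> carrier_vec (?D div 2)" by auto
  ultimately have "card ?G \<le> card (carrier_vec (?D div 2) :: 'a vec set)"
    by (intro card_inj_on_le) simp_all
  then show ?thesis by (simp add: card_carrier_vec)
qed

text \<open>The adjoint of f(A) is f applied to the inverse of \<open>A\<close>, which up to a power
  of \<open>A\<close> is the reflected polynomial at \<open>A\<close>. So
  \<open>act A f v = 0\<close> makes \<open>v\<close> orthogonal to the image of
  \<open>act A (reflect_poly f)\<close>. By the Bezout identity that image contains everything
  killed by \<open>f\<close>, in particular all A^t v.\<close>

lemma krylov_isotropic:
  assumes J: "symplectic_gram N J" and A: "A \<in> isometries N J" and v: "v \<in> carrier_vec N"
    and v0: "act A f v = 0\<^sub>v N" and ab: "a * f + b * reflect_poly f = 1"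
  shows "gram J (krylov A v D) = 0\<^sub>m D D"
proof -
  note Jc = symplectic_gramD(1)[OF J] and Ac = isometriesD(1)[OF A]
  note c = funpow_mult_mat_vec_carrier[OF Ac]
  let ?d = "degree f"
  have refl: "v \<bullet> (J *\<^sub>v act A (reflect_poly f) w) = 0" if w: "w \<in> carrier_vec N" for w
  proof -
    \<comment> \<open>Pairing with the \<open>?d\<close>-th iterate of \<open>w\<close> instead of
      \<open>w\<close> lets invariance move A^l across the form with nonnegative exponents
      only.\<close>
    have "0 = act A f v \<bullet> (J *\<^sub>v ((*\<^sub>v) A ^^ ?d) w)"
      using v0 Jc c[OF w] by simp
    also have "\<dots> = (\<Sum>l<Suc ?d. coeff f l * (((*\<^sub>v) A ^^ l) v \<bullet> (J *\<^sub>v ((*\<^sub>v) A ^^ ?d) w)))"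
      by (rule form_act_left[OF J Ac c[OF w] v]) (simp add: coeff_eq_0)
    also have "\<dots> = (\<Sum>l<Suc ?d. coeff f l * (v \<bullet> (J *\<^sub>v ((*\<^sub>v) A ^^ (?d - l)) w)))"
    proof (intro sum.cong refl)
      fix l assume "l \<in> {..<Suc ?d}"
      then have "((*\<^sub>v) A ^^ ?d) w = ((*\<^sub>v) A ^^ l) (((*\<^sub>v) A ^^ (?d - l)) w)"
        by (metis comp_apply funpow_add le_add_diff_inverse lessThan_iff less_Suc_eq_le)
      then show "coeff f l * (((*\<^sub>v) A ^^ l) v \<bullet> (J *\<^sub>v ((*\<^sub>v) A ^^ ?d) w)) =
          coeff f l * (v \<bullet> (J *\<^sub>v ((*\<^sub>v) A ^^ (?d - l)) w))"
        using isometry_form_funpow[OF Jc A v c[OF w]] by simp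
    qed
    also have "\<dots> = (\<Sum>l<Suc ?d. coeff (reflect_poly f) l * (v \<bullet> (J *\<^sub>v ((*\<^sub>v) A ^^ l) w)))"
      by (rule sum.reindex_bij_witness[of _ "\<lambda>l. ?d - l" "\<lambda>l. ?d - l"]) (auto simp: coeff_reflect_poly)
    also have "\<dots> = v \<bullet> (J *\<^sub>v act A (reflect_poly f) w)"
      by (rule form_act_right[OF Jc Ac v w, symmetric]) (simp add: coeff_reflect_poly)
    finally show ?thesis ..
  qed
  have "autocorr J A v t = 0" for t
  proof -
    let ?w = "((*\<^sub>v) A ^^ t) v"
    have w: "?w \<in> carrier_vec N" by (rule c[OF v])
    have "act A f ?w = act A (f * monom 1 t) v"
      using act_mult[OF Ac v] act_monom[OF Ac v] by simp
    also have "\<dots> = act A (monom 1 t) (act A f v)"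
      using act_mult[OF Ac v] by (metis mult.commute)
    finally have fw: "act A f ?w = 0\<^sub>v N" using v0 Ac by simp
    \<comment> \<open>The first summand dies because \<open>f\<close> kills \<open>?w\<close>, so
      \<open>?w\<close> is in the image of the reflected polynomial.\<close>
    have "?w = act A (a * f + reflect_poly f * b) ?w"
      using ab Ac w by (simp add: mult.commute)
    also have "\<dots> = act A a (act A f ?w) + act A (reflect_poly f) (act A b ?w)"
      by (simp only: act_add[OF Ac w] act_mult[OF Ac w])
    also have "\<dots> = act A (reflect_poly f) (act A b ?w)"
      using fw Ac w by simp
    finally show ?thesis
      unfolding autocorr_def using refl[of "act A b ?w"] act_carrier[OF Ac w] by metis
  qed
  then have "gram J (krylov A v D) $$ (i, j) = 0" if "i < D" "j < D" for i j
    using gram_krylov_index[OF J A v that] by simp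
  moreover have "gram J (krylov A v D) \<in> carrier_mat D D"
    using Jc v by simp
  ultimately show ?thesis by (intro eq_matI) auto
qed

section \<open>Pairs of an isometry and a vector with prescribed annihilator\<close>

definition torsion :: "'a::field mat \<Rightarrow> nat \<Rightarrow> 'a poly \<Rightarrow> 'a vec set" where
  "torsion A N f = {v \<in> carrier_vec N. act A f v = 0\<^sub>v N}"

text \<open>For irreducible \<open>f\<close> these are the vectors with annihilator exactly
  \<open>f ^ Suc j\<close>; the index is shifted so that \<open>j = 0\<close> is the first
  nontrivial layer.\<close>

definition torsion_pairs :: "nat \<Rightarrow> 'a::field mat \<Rightarrow> 'a poly \<Rightarrow> nat \<Rightarrow> ('a mat \<times> 'a vec) set" where
  "torsion_pairs N J f j =
    {(A, v). A \<in> isometries N J \<and> v \<in> torsion A N (f ^ Suc j) - torsion A N (f ^ j)}"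

text \<open>A pair is replaced by \<open>A\<close> and the Krylov frame of \<open>v\<close>, which
  \<open>A\<close> intertwines with the companion matrix of \<open>F\<close>. Each Gram matrix then
  accounts for at most one group order of pairs, so only the number of possible Gram matrices
  remains to be bounded.\<close>

lemma card_torsion_pairs_le:
  fixes J :: "'a::{finite,field} mat" and j :: nat
  assumes J: "symplectic_gram N J" and f: "irreducible f" "lead_coeff f = 1"
  defines "F \<equiv> f ^ Suc j"
  defines "S \<equiv> torsion_pairs N J f j"
  shows "card S \<le> card {gram J (krylov A v (degree F)) | A v. (A, v) \<in> S} * card (isometries N J)"
proof -
  let ?D = "degree F"
  let ?G = "{gram J (krylov A v ?D) | A v. (A, v) \<in> S}"
  let ?S = "\<lambda>G. {(A, v). (A, v) \<in> S \<and> gram J (krylov A v ?D) = G}"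
  let ?R = "\<lambda>G. {(A, P). A \<in> isometries N J \<and> frame N ?D P \<and> A * P = P * companion F \<and> gram J P = G}"
  have S: "A \<in> isometries N J" "v \<in> carrier_vec N" "act A F v = 0\<^sub>v N" "act A (f ^ j) v \<noteq> 0\<^sub>v N"
    if "(A, v) \<in> S" for A v
    using that by (auto simp: S_def torsion_pairs_def torsion_def F_def)
  have lF: "lead_coeff F = 1" using f(2) by (simp add: F_def lead_coeff_power lead_coeff_mult)
  have D: "0 < ?D"
  proof -
    have "f \<noteq> 0" "\<not> is_unit f" using f(1) by auto
    then show ?thesis using is_unit_iff_degree[of f] by (simp add: F_def degree_mult_eq)
  qed
  have R: "A \<in> isometries N J \<and> frame N ?D (krylov A v ?D) \<and> A * krylov A v ?D = krylov A v ?D * companion F"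
    if "(A, v) \<in> S" for A v
    using frame_krylov[OF isometriesD(1)[OF S(1)[OF that]] S(2)[OF that] f(1)] S[OF that]
      krylov_companion[OF isometriesD(1)[OF S(1)[OF that]] S(2)[OF that] lF] by (simp add: F_def)
  have "S \<subseteq> carrier_mat N N \<times> carrier_vec N" using S by (auto dest: isometriesD)
  then have finS: "finite S" by (rule finite_subset) (simp add: finite_carrier_mat)
  have "?G = (\<lambda>(A, v). gram J (krylov A v ?D)) ` S" by auto
  then have finG: "finite ?G" using finS by simp
  have le: "card (?S G) \<le> card (isometries N J)" for G
  proof -
    have "inj_on (\<lambda>(A, v). (A, krylov A v ?D)) (?S G)"
    proof (rule inj_onI)
      fix s s' assume "s \<in> ?S G" "s' \<in> ?S G" and
        eq: "(case s of (A, v) \<Rightarrow> (A, krylov A v ?D)) = (case s' of (A, v) \<Rightarrow> (A, krylov A v ?D))"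
      then obtain A v A' v' where s: "s = (A, v)" "s' = (A', v')" "(A, v) \<in> S" "(A', v') \<in> S" by auto
      \<comment> \<open>The vector is the first column of its frame, which exists because
        \<open>F\<close> has positive degree.\<close>
      have "col (krylov A v ?D) 0 = v" "col (krylov A' v' ?D) 0 = v'"
        using col_krylov[OF isometriesD(1)[OF S(1)] S(2) D] s(3,4) by auto
      moreover have "A = A'" "krylov A v ?D = krylov A' v' ?D"
        using eq unfolding s(1,2) by auto
      ultimately show "s = s'" unfolding s(1,2) by (metis (no_types))
    qed
    moreover have "(\<lambda>(A, v). (A, krylov A v ?D)) ` ?S G \<subseteq> ?R G"
      using R by auto
    moreover have "?R G \<subseteq> carrier_mat N N \<times> carrier_mat N ?D"
      by (auto dest: frame_carrier isometriesD)
    then have "finite (?R G)" by (rule finite_subset) (simp add: finite_carrier_mat)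
    ultimately have "card (?S G) \<le> card (?R G)" by (rule card_inj_on_le)
    also have "\<dots> \<le> card (isometries N J)"
      by (rule card_intertwining_fixed_gram[OF J companion_carrier])
    finally show ?thesis .
  qed
  have "S = (\<Union>G\<in>?G. ?S G)" by auto
  then have "card S = card (\<Union>G\<in>?G. ?S G)" by (rule arg_cong)
  also have "\<dots> \<le> (\<Sum>G\<in>?G. card (?S G))" by (rule card_UN_le[OF finG])
  also have "\<dots> \<le> card ?G * card (isometries N J)"
    using sum_bounded_above[of ?G "\<lambda>G. card (?S G)" "card (isometries N J)"] le
    by (simp only: of_nat_id)
  finally show ?thesis .
qed

lemma card_torsion_pairs_half:
  fixes J :: "'a::{finite,field} mat" and j :: nat
  assumes J: "symplectic_gram N J" and f: "irreducible f" "lead_coeff f = 1"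
  defines "S \<equiv> torsion_pairs N J f j"
  shows "card S \<le> CARD('a) ^ (Suc j * degree f div 2) * card (isometries N J)"
proof -
  define F where "F = f ^ Suc j"
  let ?G = "{gram J (krylov A v (degree F)) | A v. (A, v) \<in> S}"
  let ?H = "{gram J (krylov A v (degree F)) | A v. A \<in> isometries N J \<and> v \<in> carrier_vec N \<and> act A F v = 0\<^sub>v N}"
  have f0: "f \<noteq> 0" using f(1) by auto
  have lF: "lead_coeff F = 1" using f(2) by (simp add: F_def lead_coeff_power lead_coeff_mult)
  have dF: "degree F = Suc j * degree f" by (simp only: F_def degree_power_eq[OF f0] mult.commute)
  have "?H \<subseteq> carrier_mat (degree F) (degree F)"
    using symplectic_gramD(1)[OF J] by auto
  then have "finite ?H" by (rule finite_subset) (rule finite_carrier_mat)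
  moreover have "?G \<subseteq> ?H" unfolding S_def torsion_pairs_def torsion_def F_def by blast
  ultimately have "card ?G \<le> card ?H" by (rule card_mono)
  also have "\<dots> \<le> CARD('a) ^ (degree F div 2)" by (rule card_krylov_grams[OF J lF])
  finally have le: "card ?G \<le> CARD('a) ^ (Suc j * degree f div 2)" by (simp only: dF)
  have "card S \<le> card ?G * card (isometries N J)"
    unfolding S_def F_def by (rule card_torsion_pairs_le[OF J f])
  then show ?thesis by (rule order_trans[OF _ mult_le_mono1[OF le]])
qed

lemma card_torsion_pairs_not_self_dual:
  fixes J :: "'a::{finite,field} mat" and j :: nat
  assumes J: "symplectic_gram N J" and f: "irreducible f" "lead_coeff f = 1"
    and nd: "\<not> f dvd reflect_poly f"
  defines "S \<equiv> torsion_pairs N J f j"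
  shows "card S \<le> (if 2 * degree f \<le> N then card (isometries N J) else 0)"
proof -
  define F where "F = f ^ Suc j"
  let ?D = "degree F"
  let ?G = "{gram J (krylov A v ?D) | A v. (A, v) \<in> S}"
  have f0: "f \<noteq> 0" using f(1) by auto
  have dF: "degree F = Suc j * degree f" by (simp only: F_def degree_power_eq[OF f0] mult.commute)
  \<comment> \<open>Primality of \<open>f\<close> passes the hypothesis from \<open>f\<close> to all
    its powers, so the whole cyclic frame of \<open>F\<close> is isotropic, not just the layer
    killed by \<open>f\<close>.\<close>
  have "\<not> f dvd reflect_poly F"
    using nd prime_elem_dvd_power[OF field_poly_irreducible_imp_prime[OF f(1)], of "reflect_poly f" "Suc j"]
    by (auto simp only: F_def reflect_poly_power)
  then obtain a b where ab: "a * F + b * reflect_poly F = 1"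
    using irreducible_bezout[OF f(1)] unfolding F_def by blast
  have S: "A \<in> isometries N J" "A \<in> carrier_mat N N" "v \<in> carrier_vec N" "act A F v = 0\<^sub>v N"
    "act A (f ^ j) v \<noteq> 0\<^sub>v N" if "(A, v) \<in> S" for A v
    using that isometriesD(1)[of A N J] unfolding S_def torsion_pairs_def torsion_def F_def by blast+
  have iso: "gram J (krylov A v ?D) = 0\<^sub>m ?D ?D" if "(A, v) \<in> S" for A v
    using krylov_isotropic[OF J S(1,3,4)[OF that] ab] .
  show ?thesis
  proof (cases "2 * degree f \<le> N")
    case True
    have "?G \<subseteq> {0\<^sub>m ?D ?D}" using iso by blast
    then have "card ?G \<le> card {0\<^sub>m ?D ?D :: 'a mat}" by (intro card_mono) simp_all
    then have "card ?G \<le> 1" by simp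
    moreover have "card S \<le> card ?G * card (isometries N J)"
      unfolding S_def F_def by (rule card_torsion_pairs_le[OF J f])
    ultimately have "card S \<le> 1 * card (isometries N J)"
      by (meson le_trans mult_le_mono1)
    with True show ?thesis by simp
  next
    case False
    have "(A, v) \<notin> S" for A v
    proof
      assume "(A, v) \<in> S"
      note Av = S[OF this]
      have "2 * ?D \<le> N"
        using isotropic_frame_le[OF frame_krylov[OF Av(2,3) f(1) Av(4)[unfolded F_def] Av(5)]
            symplectic_gramD(1,2)[OF J] iso[OF \<open>(A, v) \<in> S\<close>, unfolded F_def]] unfolding F_def .
      with False dF show False by simp
    qed
    then have "S = {}" by auto
    then show ?thesis by simp
  qed
qed

section \<open>Characteristic polynomials and cyclic submodules\<close>

lemma char_poly_four_block_lower_left_zero: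
  fixes A1 :: "'a::idom mat"
  assumes A1: "A1 \<in> carrier_mat n n" and A2: "A2 \<in> carrier_mat n m" and A4: "A4 \<in> carrier_mat m m"
  shows "char_poly (four_block_mat A1 A2 (0\<^sub>m m n) A4) = char_poly A1 * char_poly A4"
proof -
  have "char_poly_matrix (four_block_mat A1 A2 (0\<^sub>m m n) A4) =
      four_block_mat (char_poly_matrix A1) (map_mat (\<lambda>a. [:- a:]) A2) (0\<^sub>m m n) (char_poly_matrix A4)"
    unfolding char_poly_matrix_def by (rule eq_matI) (use A1 A2 A4 in \<open>auto simp: one_poly_def\<close>)
  then show ?thesis
    unfolding char_poly_def
    using det_four_block_mat_lower_left_zero[of "char_poly_matrix A1" n
        "map_mat (\<lambda>a. [:- a:]) A2" m "0\<^sub>m m n" "char_poly_matrix A4"] A1 A2 A4 by simp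
qed

text \<open>The row \<open>(1, X, \<dots>, X\<^sup>d\<^sup>-\<^sup>1)\<close> times the characteristic matrix is \<open>(0, \<dots>, 0, f)\<close>;
  multiplying by the adjugate shows that \<open>f\<close> divides the determinant.\<close>

lemma char_poly_companion:
  fixes f :: "'a::field poly"
  assumes f: "lead_coeff f = 1" and d: "0 < degree f"
  shows "char_poly (companion f) = f"
proof -
  let ?d = "degree f"
  define M where "M = char_poly_matrix (companion f)"
  have M: "M \<in> carrier_mat ?d ?d" by (simp add: M_def)
  have Mi: "M $$ (i, k) = (if i = k then [:0, 1:] else 0) + [: - companion f $$ (i, k) :]" if "i < ?d" "k < ?d" for i k
    using that by (simp add: M_def char_poly_matrix_def companion_def)
  note adj = adj_mat[OF M]
  have row: "(\<Sum>i<?d. monom 1 i * M $$ (i, k)) = (if Suc k = ?d then f else 0)" if k: "k < ?d" for k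
  proof -
    have "(\<Sum>i<?d. monom 1 i * M $$ (i, k)) =
        (\<Sum>i<?d. if i = k then monom 1 (Suc k) else 0) + (\<Sum>i<?d. monom 1 i * [: - companion f $$ (i, k) :])"
      unfolding sum.distrib[symmetric]
      by (rule sum.cong) (use k in \<open>auto simp: Mi algebra_simps monom_Suc\<close>)
    also have "(\<Sum>i<?d. if i = k then monom 1 (Suc k) else (0 :: 'a poly)) = monom 1 (Suc k)" using k by simp
    also have "(\<Sum>i<?d. monom 1 i * [: - companion f $$ (i, k) :]) =
        (if Suc k = ?d then \<Sum>i<?d. monom (coeff f i) i else - monom 1 (Suc k))"
    proof (cases "Suc k = ?d")
      case True
      then show ?thesis
        using k by (auto simp: companion_def mult.commute smult_monom intro!: sum.cong)
    next
      case False
      have "(\<Sum>i<?d. monom 1 i * [: - companion f $$ (i, k) :]) = (\<Sum>i<?d. if i = Suc k then - monom 1 (Suc k) else 0)"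
        by (rule sum.cong) (use k False in \<open>auto simp: companion_def mult.commute smult_monom minus_monom\<close>)
      also have "\<dots> = - monom 1 (Suc k)" using k False by simp
      finally show ?thesis using False by simp
    qed
    also have "monom 1 (Suc k) + (if Suc k = ?d then \<Sum>i<?d. monom (coeff f i) i else - monom 1 (Suc k))
        = (if Suc k = ?d then f else 0)"
    proof (cases "Suc k = ?d")
      case True
      have "f = (\<Sum>i\<le>?d. monom (coeff f i) i)" by (simp add: poly_as_sum_of_monoms)
      also have "\<dots> = (\<Sum>i<Suc ?d. monom (coeff f i) i)" by (simp only: lessThan_Suc_atMost)
      also have "\<dots> = monom 1 ?d + (\<Sum>i<?d. monom (coeff f i) i)" using f by (simp add: add.commute)
      finally show ?thesis using True by simp
    qed simp
    finally show ?thesis .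
  qed
  have "det M = (\<Sum>i<?d. monom 1 i * (M * adj_mat M) $$ (i, 0))"
  proof -
    have "(\<Sum>i<?d. monom 1 i * (M * adj_mat M) $$ (i, 0)) = (\<Sum>i<?d. if i = 0 then det M else 0)"
      unfolding adj(2) using d by (intro sum.cong) (auto simp: monom_0 simp flip: one_pCons)
    then show ?thesis using d by simp
  qed
  also have "\<dots> = (\<Sum>i<?d. monom 1 i * (\<Sum>k<?d. M $$ (i, k) * adj_mat M $$ (k, 0)))"
    using M adj(1) d by (intro sum.cong) (auto simp: scalar_prod_def lessThan_atLeast0)
  also have "\<dots> = (\<Sum>k<?d. (\<Sum>i<?d. monom 1 i * M $$ (i, k)) * adj_mat M $$ (k, 0))"
    unfolding sum_distrib_left sum_distrib_right by (subst sum.swap) (simp add: mult.assoc)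
  also have "\<dots> = (\<Sum>k<?d. if Suc k = ?d then f * adj_mat M $$ (k, 0) else 0)"
    by (rule sum.cong) (auto simp: row)
  also have "\<dots> = (\<Sum>k<?d. if k = ?d - 1 then f * adj_mat M $$ (k, 0) else 0)"
    by (rule sum.cong) (use d in auto)
  also have "\<dots> = f * adj_mat M $$ (?d - 1, 0)" using d by simp
  finally have "f dvd char_poly (companion f)"
    by (metis M_def char_poly_def dvd_triv_left)
  then obtain h where h: "char_poly (companion f) = f * h" by (elim dvdE)
  have c: "degree (char_poly (companion f)) = ?d" "lead_coeff (char_poly (companion f)) = 1"
    using degree_monic_char_poly[OF companion_carrier[of f]] by auto
  have "h \<noteq> 0" "f \<noteq> 0" using h c(2) f by auto
  then have "degree h = 0" using c(1) h by (simp add: degree_mult_eq)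
  moreover have "lead_coeff h = 1" using c(2) f h by (simp add: lead_coeff_mult)
  ultimately have "h = 1" by (metis degree_eq_zeroE lead_coeff_pCons(2) one_pCons)
  then show ?thesis using h by simp
qed

section \<open>Cyclic submodules and their quotients\<close>

lemma nonzero_annihilator:
  fixes A :: "'a::{finite,field} mat"
  assumes A: "A \<in> carrier_mat N N" and v: "v \<in> carrier_vec N"
  shows "\<exists>p. p \<noteq> 0 \<and> act A p v = 0\<^sub>v N"
proof -
  have "\<not> frame N (Suc N) (krylov A v (Suc N))"
    using frame_le by fastforce
  then obtain u where u: "u \<in> carrier_vec (Suc N)" "krylov A v (Suc N) *\<^sub>v u = 0\<^sub>v N" "u \<noteq> 0\<^sub>v (Suc N)"
    using v unfolding frame_def by auto
  have "vpoly u \<noteq> 0"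
  proof
    assume "vpoly u = 0"
    then have "u $ i = 0" if "i < Suc N" for i using coeff_vpoly[of u i] that u(1) by simp
    then have "u = 0\<^sub>v (Suc N)" using u(1) by (intro eq_vecI) simp_all
    with u(3) show False by contradiction
  qed
  moreover have "act A (vpoly u) v = 0\<^sub>v N" using krylov_mult_vec[OF A v u(1)] u(2) by simp
  ultimately show ?thesis by blast
qed

lemma monic_irreducible_divisor:
  fixes p :: "'a::field poly"
  assumes "0 < degree p"
  shows "\<exists>f. irreducible f \<and> lead_coeff f = 1 \<and> f dvd p"
proof -
  let ?P = "\<lambda>g. 0 < degree g \<and> g dvd p"
  have "?P p" using assms by simp
  from arg_min_nat_lemma[of ?P, OF this, of degree]
  obtain g where g: "?P g" and min: "\<And>h. ?P h \<Longrightarrow> degree g \<le> degree h" by blast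
  have g0: "g \<noteq> 0" using g by auto
  define f where "f = Polynomial.smult (inverse (lead_coeff g)) g"
  have f: "f \<noteq> 0" "degree f = degree g" "lead_coeff f = 1"
    using g0 by (simp_all add: f_def)
  have fp: "f dvd p"
    unfolding f_def using g g0 by (intro smult_dvd) simp_all
  have "irreducible f"
  proof (rule irreducibleI[OF f(1)])
    show "\<not> is_unit f" using f g is_unit_iff_degree by auto
    fix a b assume ab: "f = a * b"
    have nz: "a \<noteq> 0" "b \<noteq> 0" using ab f by auto
    show "is_unit a \<or> is_unit b"
    proof (rule ccontr)
      assume "\<not> (is_unit a \<or> is_unit b)"
      then have deg: "0 < degree a" "0 < degree b" using nz is_unit_iff_degree by auto
      moreover have "a dvd p" using ab fp by (metis dvd_mult_left)
      ultimately have "degree g \<le> degree a" using min by blast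
      moreover have "degree f = degree a + degree b" using ab nz by (simp add: degree_mult_eq)
      ultimately show False using deg f(2) by linarith
    qed
  qed
  then show ?thesis using f(3) fp by blast
qed

lemma monic_factorization:
  fixes p :: "'a::field poly"
  assumes "lead_coeff p = 1"
  shows "\<exists>M. (\<forall>f\<in>#M. lead_coeff f = 1 \<and> irreducible f) \<and> p = prod_mset M"
  using assms
proof (induction "degree p" arbitrary: p rule: less_induct)
  case less
  show ?case
  proof (cases "degree p = 0")
    case True
    then have "p = 1" using less.prems by (metis degree_eq_zeroE lead_coeff_pCons(2) one_pCons)
    then show ?thesis by (intro exI[of _ "{#}"]) simp
  next
    case False
    then obtain f where f: "irreducible f" "lead_coeff f = 1" "f dvd p"
      using monic_irreducible_divisor[of p] by auto
    then obtain g where g: "p = f * g" by (elim dvdE)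
    have p0: "p \<noteq> 0" using less.prems by auto
    have "f \<noteq> 0" "g \<noteq> 0" using g p0 by auto
    moreover have "0 < degree f" using f(1) by (rule irreducible_degree_pos)
    ultimately have "degree g < degree p" using g by (simp add: degree_mult_eq)
    moreover have "lead_coeff g = 1" using less.prems g f(2) by (simp add: lead_coeff_mult)
    ultimately obtain M where "\<forall>f\<in>#M. lead_coeff f = 1 \<and> irreducible f" "g = prod_mset M"
      using less.hyps by blast
    then show ?thesis using f g by (intro exI[of _ "add_mset f M"]) auto
  qed
qed

text \<open>The monic irreducible factors of an annihilator of the first unit vector are applied one
  after the other; the factor at which the result first becomes zero kills a nonzero vector.\<close>

lemma irreducible_annihilator:
  fixes A :: "'a::{finite,field} mat"
  assumes A: "A \<in> carrier_mat N N" and N: "0 < N"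
  shows "\<exists>f v. irreducible f \<and> lead_coeff f = 1 \<and> v \<in> carrier_vec N \<and> v \<noteq> 0\<^sub>v N \<and> act A f v = 0\<^sub>v N"
proof -
  have u: "unit_vec N 0 \<in> carrier_vec N" "unit_vec N 0 \<noteq> (0\<^sub>v N :: 'a vec)"
    using N by (auto simp: vec_eq_iff unit_vec_def)
  then obtain p where p: "p \<noteq> 0" "act A p (unit_vec N 0) = 0\<^sub>v N" using nonzero_annihilator[OF A] by blast
  define P where "P = Polynomial.smult (inverse (lead_coeff p)) p"
  have "lead_coeff P = 1" using p(1) by (simp add: P_def)
  then obtain M where M: "\<forall>f\<in>#M. lead_coeff f = 1 \<and> irreducible f" "P = prod_mset M"
    using monic_factorization by blast
  have "act A (prod_mset M) (unit_vec N 0) = 0\<^sub>v N"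
    using p(2) unfolding M(2)[symmetric] by (auto simp: P_def act_smult[OF A u(1)])
  then have "\<exists>f\<in>#M. \<exists>v\<in>carrier_vec N. v \<noteq> 0\<^sub>v N \<and> act A f v = 0\<^sub>v N"
  proof (induction M)
    case empty
    then show ?case using A u by simp
  next
    case (add f M)
    then have "act A f (act A (prod_mset M) (unit_vec N 0)) = 0\<^sub>v N" using act_mult[OF A u(1)] by simp
    then show ?case using add.IH act_carrier[OF A u(1)] by (metis union_single_eq_member add_mset_add_single insert_iff set_mset_add_mset_insert)
  qed
  then show ?thesis using M(1) by blast
qed

text \<open>In a basis \<open>R\<close> that begins with the Krylov frame of \<open>v\<close>, the
  matrix is block triangular: the companion matrix of \<open>f\<close> acts on the cyclic submodule
  and \<open>D\<close> on the quotient. The last two conclusions keep just what lifting needs: the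
  quotient coordinate evolves under \<open>D\<close>, whatever happens above it, and
  \<open>f\<close> kills the submodule.\<close>

lemma cyclic_quotient:
  fixes A :: "'a::{finite,field} mat"
  assumes A: "A \<in> carrier_mat N N" and f: "irreducible f" "lead_coeff f = 1"
    and v: "v \<in> carrier_vec N" "v \<noteq> 0\<^sub>v N" "act A f v = 0\<^sub>v N"
  obtains R D where "degree f \<le> N" "frame N N R" "D \<in> carrier_mat (N - degree f) (N - degree f)"
    "char_poly A = f * char_poly D"
    "\<And>p u y. u \<in> carrier_vec (degree f) \<Longrightarrow> y \<in> carrier_vec (N - degree f) \<Longrightarrow>
      \<exists>u'\<in>carrier_vec (degree f). act A p (R *\<^sub>v (u @\<^sub>v y)) = R *\<^sub>v (u' @\<^sub>v act D p y)"
    "\<And>u. u \<in> carrier_vec (degree f) \<Longrightarrow> act A f (R *\<^sub>v (u @\<^sub>v 0\<^sub>v (N - degree f))) = 0\<^sub>v N"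
proof -
  let ?d = "degree f"
  let ?m = "N - ?d"
  define P where "P = krylov A v ?d"
  have P: "frame N ?d P"
    using frame_krylov[OF A v(1) f(1), of 0] v A by (simp add: P_def)
  obtain R where R: "frame N N R" "take_cols ?d R = P" using frame_extend[OF P] by blast
  have dN: "?d \<le> N" using P by (rule frame_le)
  then have Nd: "?d + ?m = N" by simp
  obtain S where S: "S \<in> carrier_mat N N" "R * S = 1\<^sub>m N" "S * R = 1\<^sub>m N"
    using square_frame_inverse[OF R(1)] by metis
  note Rc = frame_carrier[OF R(1)] and Pc = frame_carrier[OF P]
  define M where "M = S * (A * R)"
  have Mc: "M \<in> carrier_mat N N" using S A Rc by (simp add: M_def)
  have AR: "A * R = R * M"
    using S A Rc assoc_mult_mat[of R N N S N "A * R" N] by (simp add: M_def)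
  define C where "C = companion f"
  have C: "C \<in> carrier_mat ?d ?d" by (simp add: C_def)
  define X where "X = mat ?d ?m (\<lambda>(i, j). M $$ (i, j + ?d))"
  define D where "D = mat ?m ?m (\<lambda>(i, j). M $$ (i + ?d, j + ?d))"
  have X: "X \<in> carrier_mat ?d ?m" and D: "D \<in> carrier_mat ?m ?m" by (simp_all add: X_def D_def)
  have AP: "A * P = P * C"
    unfolding P_def C_def by (rule krylov_companion[OF A v(1) f(2) v(3)])
  \<comment> \<open>\<open>S * P\<close> consists of the first columns of the identity and
    \<open>A * P = P * C\<close>, so the first columns of \<open>M\<close> are \<open>C\<close> on
    top of a zero block.\<close>
  have "take_cols ?d M = S * (A * P)"
    using S A Rc dN R(2) take_cols_mult[of S N N "A * R" N ?d] take_cols_mult[of A N N R N ?d]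
    by (simp add: M_def)
  also have "\<dots> = (S * P) * C"
    using AP S C Pc by (simp add: assoc_mult_mat[of S N N P ?d C ?d])
  also have "S * P = take_cols ?d (1\<^sub>m N)"
    using take_cols_mult[of S N N R N ?d] S Rc R(2) dN by simp
  finally have tM: "take_cols ?d M = take_cols ?d (1\<^sub>m N) * C" .
  have Mi: "M $$ (i, j) = (if i < ?d then C $$ (i, j) else 0)" if "i < N" "j < ?d" for i j
  proof -
    have "M $$ (i, j) = take_cols ?d M $$ (i, j)" using that Mc by (simp add: take_cols_def)
    also have "\<dots> = (\<Sum>k<?d. (if i = k then 1 else 0) * C $$ (k, j))"
      unfolding tM using that dN C by (simp add: take_cols_def scalar_prod_def lessThan_atLeast0)
    also have "\<dots> = (\<Sum>k<?d. if k = i then C $$ (k, j) else 0)"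
      by (rule sum.cong) auto
    finally show ?thesis by simp
  qed
  have M: "M = four_block_mat C X (0\<^sub>m ?m ?d) D"
    by (rule eq_matI) (use Mc C X D Nd Mi in \<open>auto simp: X_def D_def\<close>)
  have "similar_mat A M"
  proof (rule similar_matI)
    show "A = R * M * S"
      using AR S A Rc by (metis assoc_mult_mat right_mult_one_mat)
  qed (use S A Rc Mc in auto)
  then have cp: "char_poly A = f * char_poly D"
    using char_poly_similar char_poly_four_block_lower_left_zero[OF C X D] M
      char_poly_companion[OF f(2)] f(1) is_unit_iff_degree[of f]
    by (metis C_def gr0I irreducible_def not_gr_zero)
  have step: "A *\<^sub>v (R *\<^sub>v (u @\<^sub>v y)) = R *\<^sub>v ((C *\<^sub>v u + X *\<^sub>v y) @\<^sub>v (D *\<^sub>v y))"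
    if u: "u \<in> carrier_vec ?d" and y: "y \<in> carrier_vec ?m" for u y
  proof -
    have uy: "u @\<^sub>v y \<in> carrier_vec N" using append_carrier_vec[OF u y] Nd by simp
    have "A *\<^sub>v (R *\<^sub>v (u @\<^sub>v y)) = R *\<^sub>v (M *\<^sub>v (u @\<^sub>v y))"
      using AR uy A Rc Mc by (metis assoc_mult_mat_vec)
    also have "M *\<^sub>v (u @\<^sub>v y) = (C *\<^sub>v u + X *\<^sub>v y) @\<^sub>v (0\<^sub>m ?m ?d *\<^sub>v u + D *\<^sub>v y)"
      unfolding M by (rule four_block_mat_mult_vec[OF C X _ D u y]) simp
    also have "0\<^sub>m ?m ?d *\<^sub>v u + D *\<^sub>v y = D *\<^sub>v y" using u y D by auto
    finally show ?thesis .
  qed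
  have 2: "\<exists>u'\<in>carrier_vec ?d. act A p (R *\<^sub>v (u @\<^sub>v y)) = R *\<^sub>v (u' @\<^sub>v act D p y)"
    if u: "u \<in> carrier_vec ?d" and y: "y \<in> carrier_vec ?m" for p u y
  proof (induction p)
    case 0
    have "R *\<^sub>v (u @\<^sub>v y) \<in> carrier_vec N"
      using append_carrier_vec[OF u y] Nd Rc by simp
    moreover have "0\<^sub>v ?d @\<^sub>v 0\<^sub>v ?m = (0\<^sub>v N :: 'a vec)" using Nd by (intro eq_vecI) auto
    ultimately show ?case using A D y mult_mat_zero_vec[OF Rc] by (intro bexI[of _ "0\<^sub>v ?d"]) auto
  next
    case (pCons c p)
    then obtain u' where u': "u' \<in> carrier_vec ?d" "act A p (R *\<^sub>v (u @\<^sub>v y)) = R *\<^sub>v (u' @\<^sub>v act D p y)" by blast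
    have Dy: "act D p y \<in> carrier_vec ?m" by (rule act_carrier[OF D y])
    define w where "w = C *\<^sub>v u' + X *\<^sub>v act D p y"
    have w: "w \<in> carrier_vec ?d" using C X u' Dy by (simp add: w_def)
    have z: "u @\<^sub>v y \<in> carrier_vec N" "w @\<^sub>v (D *\<^sub>v act D p y) \<in> carrier_vec N"
      using append_carrier_vec[OF u y] append_carrier_vec[OF w, of "D *\<^sub>v act D p y" ?m] D Dy Nd by simp_all
    have "act A (pCons c p) (R *\<^sub>v (u @\<^sub>v y)) = c \<cdot>\<^sub>v (R *\<^sub>v (u @\<^sub>v y)) + R *\<^sub>v (w @\<^sub>v (D *\<^sub>v act D p y))"
      using z Rc by (simp add: act_pCons[OF A] u'(2) step[OF u'(1) Dy] w_def)
    also have "\<dots> = R *\<^sub>v (c \<cdot>\<^sub>v (u @\<^sub>v y) + (w @\<^sub>v (D *\<^sub>v act D p y)))"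
      using z by (simp add: mult_add_distrib_mat_vec[OF Rc] mult_mat_vec[OF Rc])
    also have "c \<cdot>\<^sub>v (u @\<^sub>v y) + (w @\<^sub>v (D *\<^sub>v act D p y)) = (c \<cdot>\<^sub>v u + w) @\<^sub>v act D (pCons c p) y"
      using u y w D Dy by (intro eq_vecI) (auto simp: act_pCons)
    finally show ?case using u w by (intro bexI[of _ "c \<cdot>\<^sub>v u + w"]) auto
  qed
  have 3: "act A f (R *\<^sub>v (u @\<^sub>v 0\<^sub>v ?m)) = 0\<^sub>v N" if u: "u \<in> carrier_vec ?d" for u
  proof -
    have "R *\<^sub>v (u @\<^sub>v 0\<^sub>v ?m) = take_cols ?d R *\<^sub>v u"
    proof (rule eq_vecI)
      fix i assume "i < dim_vec (take_cols ?d R *\<^sub>v u)"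
      then have i: "i < N" using Rc by (simp add: take_cols_def)
      have "(R *\<^sub>v (u @\<^sub>v 0\<^sub>v ?m)) $ i = (\<Sum>k<?d + ?m. R $$ (i, k) * (u @\<^sub>v 0\<^sub>v ?m) $ k)"
        using i u Rc Nd by (auto simp: scalar_prod_def lessThan_atLeast0 intro!: sum.cong)
      also have "\<dots> = (\<Sum>k<?d. R $$ (i, k) * u $ k)"
        by (rule sum.mono_neutral_cong_right) (use u in auto)
      also have "\<dots> = (take_cols ?d R *\<^sub>v u) $ i"
        using i u Rc by (auto simp: take_cols_def scalar_prod_def lessThan_atLeast0 intro!: sum.cong)
      finally show "(R *\<^sub>v (u @\<^sub>v 0\<^sub>v ?m)) $ i = (take_cols ?d R *\<^sub>v u) $ i" .
    qed (use Rc in \<open>auto simp: take_cols_def\<close>)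
    also have "\<dots> = act A (vpoly u) v"
      unfolding R(2) P_def by (rule krylov_mult_vec[OF A v(1) u])
    finally have "act A f (R *\<^sub>v (u @\<^sub>v 0\<^sub>v ?m)) = act A (vpoly u) (act A f v)"
      using act_mult[OF A v(1)] by (metis mult.commute)
    then show ?thesis using v(3) A by simp
  qed
  show ?thesis using that[OF dN R(1) D cp 2 3] .
qed

section \<open>Multiplicities and torsion\<close>

lemma torsion_subset: "torsion A N f \<subseteq> carrier_vec N"
  by (auto simp: torsion_def)

lemma finite_torsion [simp]: "finite (torsion (A :: 'a::{finite,field} mat) N f)"
  by (rule finite_subset[OF torsion_subset finite_carrier_vec])

lemma zero_in_torsion: "A \<in> carrier_mat N N \<Longrightarrow> 0\<^sub>v N \<in> torsion A N f"
  by (simp add: torsion_def)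

lemma square_frame_append_eq:
  assumes "frame N N R" "u @\<^sub>v y \<in> carrier_vec N" "u' @\<^sub>v y' \<in> carrier_vec N"
    and "u \<in> carrier_vec d" "u' \<in> carrier_vec d" and "R *\<^sub>v (u @\<^sub>v y) = R *\<^sub>v (u' @\<^sub>v y')"
  shows "u = u'" "y = y'"
  using inj_onD[OF frame_inj_on[OF assms(1)] assms(6) assms(2,3)] append_vec_eq[OF assms(4,5)] by auto

text \<open>The proof splits off one cyclic submodule at a time, belonging to an irreducible
  \<open>f\<close>. If \<open>f = g\<close>, any lift of a vector killed by
  \<open>g ^ (K - 1)\<close> in the quotient is killed by \<open>g ^ K\<close>, which gains a factor
  q^d. Otherwise every torsion vector of the quotient has at least one torsion lift. The assumption
  \<open>N \<le> K\<close> survives because the dimension drops by at least one whenever the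
  exponent does.\<close>

lemma card_torsion_ge:
  fixes A :: "'a::{finite,field} mat"
  assumes "A \<in> carrier_mat N N" and g: "irreducible g" "lead_coeff g = 1"
    and "char_poly A = prod_mset M" and "\<And>f. f \<in># M \<Longrightarrow> lead_coeff f = 1 \<and> irreducible f"
    and "N \<le> K"
  shows "CARD('a) ^ (degree g * count M g) \<le> card (torsion A N (g ^ K))"
  using assms(1,4,5,6)
proof (induction N arbitrary: A M K rule: less_induct)
  case (less N)
  note A = less.prems(1)
  show ?case
  proof (cases "count M g = 0")
    case True
    have "card {0\<^sub>v N :: 'a vec} \<le> card (torsion A N (g ^ K))"
      using zero_in_torsion[OF A] by (intro card_mono) auto
    then show ?thesis using True by simp
  next
    case False
    then have gM: "g \<in># M" by (simp add: count_eq_zero_iff)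
    have "0 < N"
    proof (rule ccontr)
      assume "\<not> 0 < N"
      then have "degree (char_poly A) = 0" using degree_monic_char_poly[OF A] by simp
      moreover have "char_poly A \<noteq> 0" using degree_monic_char_poly[OF A] by auto
      moreover have "g dvd char_poly A" using gM less.prems(2) by (simp add: dvd_prod_mset)
      ultimately have "degree g \<le> degree (char_poly A)" by (intro dvd_imp_degree_le)
      with \<open>degree (char_poly A) = 0\<close> have "degree g = 0" by simp
      then show False using g(1) is_unit_iff_degree[of g] by auto
    qed
    then obtain f v where f: "irreducible f" "lead_coeff f = 1"
      and v: "v \<in> carrier_vec N" "v \<noteq> 0\<^sub>v N" "act A f v = 0\<^sub>v N"
      using irreducible_annihilator[OF A] by blast
    define d where "d = degree f"
    define m where "m = N - d"
    obtain R D where dN: "d \<le> N" and R: "frame N N R" and D: "D \<in> carrier_mat m m"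
      and cp: "char_poly A = f * char_poly D"
      and act: "\<And>p u y. u \<in> carrier_vec d \<Longrightarrow> y \<in> carrier_vec m \<Longrightarrow>
        \<exists>u'\<in>carrier_vec d. act A p (R *\<^sub>v (u @\<^sub>v y)) = R *\<^sub>v (u' @\<^sub>v act D p y)"
      and kill: "\<And>u. u \<in> carrier_vec d \<Longrightarrow> act A f (R *\<^sub>v (u @\<^sub>v 0\<^sub>v m)) = 0\<^sub>v N"
      using cyclic_quotient[OF A f v] unfolding d_def m_def by metis
    note Rc = frame_carrier[OF R]
    have d0: "0 < d" using f(1) is_unit_iff_degree[of f] by (auto simp: d_def)
    have mN: "m < N" "d + m = N" using d0 dN by (auto simp: m_def)
    have app: "R *\<^sub>v (u @\<^sub>v y) \<in> carrier_vec N" "u @\<^sub>v y \<in> carrier_vec N"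
      if "u \<in> carrier_vec d" "y \<in> carrier_vec m" for u y
      using append_carrier_vec[OF that] mN Rc by simp_all
    have "lead_coeff (char_poly D) = 1" using degree_monic_char_poly[OF D] by simp
    then obtain M' where M': "\<forall>f\<in>#M'. lead_coeff f = 1 \<and> irreducible f" "char_poly D = prod_mset M'"
      using monic_factorization by blast
    \<comment> \<open>Both counts are identified with the same maximal exponent, so the two
      factorizations need not be matched factor by factor.\<close>
    have "count M g = Max {k. g ^ k dvd prod_mset M}"
      using Max_power_dvd_prod_mset[OF g(2,1) less.prems(3)] by simp
    also have "prod_mset M = prod_mset (add_mset f M')" using cp less.prems(2) M'(2) by simp
    also have "Max {k. g ^ k dvd prod_mset (add_mset f M')} = count (add_mset f M') g"
      using M'(1) f by (intro Max_power_dvd_prod_mset[OF g(2,1)]) auto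
    finally have cnt: "count M g = count (add_mset f M') g" .
    show ?thesis
    proof (cases "g = f")
      case True
      obtain K' where K': "K = Suc K'" using less.prems(4) mN by (cases K) auto
      let ?T = "torsion D m (f ^ K')"
      have IH: "CARD('a) ^ (d * count M' f) \<le> card ?T"
        using less.IH[OF mN(1) D M'(2), of K'] M'(1) less.prems(4) mN K' True by (simp add: d_def)
      have sub: "(\<lambda>(u, y). R *\<^sub>v (u @\<^sub>v y)) ` (carrier_vec d \<times> ?T) \<subseteq> torsion A N (g ^ K)"
      proof (intro image_subsetI)
        fix z :: "'a vec \<times> 'a vec" assume "z \<in> carrier_vec d \<times> ?T"
        then obtain u y where z: "z = (u, y)" and u: "u \<in> carrier_vec d" and y: "y \<in> ?T" by blast
        then have yc: "y \<in> carrier_vec m" "act D (f ^ K') y = 0\<^sub>v m" by (auto simp: torsion_def)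
        obtain u' where u': "u' \<in> carrier_vec d" "act A (f ^ K') (R *\<^sub>v (u @\<^sub>v y)) = R *\<^sub>v (u' @\<^sub>v 0\<^sub>v m)"
          using act[OF u yc(1), of "f ^ K'"] yc(2) by auto
        have "act A (g ^ K) (R *\<^sub>v (u @\<^sub>v y)) = 0\<^sub>v N"
          using act_mult[OF A app(1)[OF u yc(1)], of f "f ^ K'"] u'(2) kill[OF u'(1)] True K' by simp
        then show "(case z of (u, y) \<Rightarrow> R *\<^sub>v (u @\<^sub>v y)) \<in> torsion A N (g ^ K)"
          using z app[OF u yc(1)] by (simp add: torsion_def)
      qed
      have inj: "inj_on (\<lambda>(u, y). R *\<^sub>v (u @\<^sub>v y)) (carrier_vec d \<times> ?T)"
      proof (rule inj_onI, clarify)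
        fix u y u' y' assume uy: "u \<in> carrier_vec d" "y \<in> ?T" "u' \<in> carrier_vec d" "y' \<in> ?T"
          and eq: "R *\<^sub>v (u @\<^sub>v y) = R *\<^sub>v (u' @\<^sub>v y')"
        have y: "y \<in> carrier_vec m" "y' \<in> carrier_vec m" using uy by (auto simp: torsion_def)
        show "u = u' \<and> y = y'"
          using square_frame_append_eq[OF R app(2)[OF uy(1) y(1)] app(2)[OF uy(3) y(2)] uy(1,3) eq] by blast
      qed
      have "card ((carrier_vec d :: 'a vec set) \<times> ?T) \<le> card (torsion A N (g ^ K))"
        by (rule card_inj_on_le[OF inj sub finite_torsion])
      moreover have "card ((carrier_vec d :: 'a vec set) \<times> ?T) = CARD('a) ^ d * card ?T"
        by (simp add: card_cartesian_product card_carrier_vec)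
      moreover have "CARD('a) ^ (degree g * count M g) = CARD('a) ^ d * CARD('a) ^ (d * count M' f)"
        using cnt True by (simp add: d_def power_add)
      ultimately show ?thesis using IH mult_le_mono2[OF IH, of "CARD('a) ^ d"] by linarith
    next
      case False
      let ?T = "torsion D m (g ^ K)"
      have IH: "CARD('a) ^ (degree g * count M' g) \<le> card ?T"
        using less.IH[OF mN(1) D M'(2), of K] M'(1) less.prems(4) mN by simp
      have "\<not> g dvd f" using monic_irred_dvd_eq[OF f(2,1) g(2,1)] False by blast
      then obtain a b where ab: "a * g ^ K + b * f = 1" using irreducible_bezout[OF g(1)] by blast
      have "\<exists>u\<in>carrier_vec d. R *\<^sub>v (u @\<^sub>v y) \<in> torsion A N (g ^ K)" if y: "y \<in> ?T" for y
      proof -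
        have yc: "y \<in> carrier_vec m" "act D (g ^ K) y = 0\<^sub>v m" using y by (auto simp: torsion_def)
        \<comment> \<open>\<open>w\<close> is an arbitrary lift of \<open>y\<close>. Since
          \<open>b * f\<close> is 1 modulo \<open>g ^ K\<close>, applying it preserves the quotient
          coordinate \<open>y\<close>. Since \<open>g ^ K\<close> sends \<open>w\<close> into the
          cyclic submodule, which \<open>f\<close> kills, the new lift is torsion.\<close>
        define w where "w = R *\<^sub>v (0\<^sub>v d @\<^sub>v y)"
        have w: "w \<in> carrier_vec N" unfolding w_def by (rule app(1)) (use yc in auto)
        obtain u where u: "u \<in> carrier_vec d" "act A (b * f) w = R *\<^sub>v (u @\<^sub>v act D (b * f) y)"
          using act[OF zero_carrier_vec yc(1), of "b * f"] by (auto simp: w_def)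
        obtain u' where u': "u' \<in> carrier_vec d" "act A (g ^ K) w = R *\<^sub>v (u' @\<^sub>v 0\<^sub>v m)"
          using act[OF zero_carrier_vec yc(1), of "g ^ K"] yc(2) by (auto simp: w_def)
        have "act D (a * g ^ K + b * f) y = act D a (act D (g ^ K) y) + act D (b * f) y"
          using act_add[OF D yc(1)] act_mult[OF D yc(1)] by simp
        then have "act D (b * f) y = y" using ab yc D by simp
        moreover have "act A (g ^ K) (act A (b * f) w) = act A (b * f) (act A (g ^ K) w)"
          using act_mult[OF A w] by (metis mult.commute)
        then have "act A (g ^ K) (act A (b * f) w) = 0\<^sub>v N"
          using u' kill[OF u'(1)] act_mult[OF A app(1)[OF u'(1) zero_carrier_vec], of b f] A by simp
        ultimately show ?thesis
          using u w A app(1)[OF u(1) yc(1)] by (intro bexI[of _ u]) (auto simp: torsion_def)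
      qed
      then obtain h where h: "\<And>y. y \<in> ?T \<Longrightarrow> h y \<in> carrier_vec d \<and> R *\<^sub>v (h y @\<^sub>v y) \<in> torsion A N (g ^ K)"
        by metis
      have "inj_on (\<lambda>y. R *\<^sub>v (h y @\<^sub>v y)) ?T"
      proof (rule inj_onI)
        fix y y' assume y: "y \<in> ?T" "y' \<in> ?T" and eq: "R *\<^sub>v (h y @\<^sub>v y) = R *\<^sub>v (h y' @\<^sub>v y')"
        have c: "h y \<in> carrier_vec d" "h y' \<in> carrier_vec d" "y \<in> carrier_vec m" "y' \<in> carrier_vec m"
          using h y torsion_subset by blast+
        show "y = y'"
          using square_frame_append_eq(2)[OF R app(2)[OF c(1,3)] app(2)[OF c(2,4)] c(1,2) eq] .
      qed
      then have "card ?T \<le> card (torsion A N (g ^ K))"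
        by (rule card_inj_on_le) (use h in auto)
      then show ?thesis using IH cnt False by (simp add: eq_commute)
    qed
  qed
qed

text \<open>The right-hand side is the chord of the logarithm through (1, 0) and (Q, 1). By
  concavity the logarithm lies below this line once r is at least Q: the tangent at Q bounds it from
  above, and the chord is steeper than that tangent.\<close>

lemma log_le_chord:
  fixes r Q :: real
  assumes "1 < Q" "Q \<le> r"
  shows "log Q r \<le> (r - 1) / (Q - 1)"
proof -
  have "ln (r / Q) \<le> r / Q - 1" using assms by (intro ln_le_minus_one) auto
  then have 1: "ln r \<le> ln Q + (r - Q) / Q" using assms by (simp add: ln_div field_simps)
  have "ln (1 / Q) \<le> 1 / Q - 1" using assms by (intro ln_le_minus_one) auto
  then have "(Q - 1) / Q \<le> ln Q" using assms by (simp add: ln_div field_simps)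
  then have "(Q - 1) / Q * ((r - Q) / (Q - 1)) \<le> ln Q * ((r - Q) / (Q - 1))"
    using assms by (intro mult_right_mono) auto
  moreover have "(Q - 1) / Q * ((r - Q) / (Q - 1)) = (r - Q) / Q" using assms by simp
  ultimately have "ln r \<le> ln Q + ln Q * ((r - Q) / (Q - 1))" using 1 by linarith
  also have "\<dots> = ln Q * ((r - 1) / (Q - 1))" using assms by (simp add: field_simps)
  finally show ?thesis using assms by (simp add: log_def divide_le_eq mult.commute)
qed

lemma torsion_mono:
  assumes A: "A \<in> carrier_mat N N"
  shows "torsion A N (f ^ j) \<subseteq> torsion A N (f ^ Suc j)"
  using act_mult[OF A, of _ f "f ^ j"] A by (auto simp: torsion_def)

text \<open>The quotient of the two torsion modules is a vector space over the field K[X]/(f). If it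
  contains the class of \<open>v\<close>, it contains the whole line spanned by that class, whose Q
  elements are represented by the polynomials of degree below \<open>degree f\<close> applied to
  \<open>v\<close>.\<close>

lemma card_torsion_step:
  fixes A :: "'a::{finite,field} mat"
  assumes A: "A \<in> carrier_mat N N" and f: "irreducible f"
    and v: "v \<in> torsion A N (f ^ Suc j) - torsion A N (f ^ j)"
  shows "CARD('a) ^ degree f * card (torsion A N (f ^ j)) \<le> card (torsion A N (f ^ Suc j))"
proof -
  let ?d = "degree f"
  let ?T = "torsion A N (f ^ j)"
  have vc: "v \<in> carrier_vec N" "act A (f ^ Suc j) v = 0\<^sub>v N" "act A (f ^ j) v \<noteq> 0\<^sub>v N"
    using v by (auto simp: torsion_def)
  let ?h = "\<lambda>(u :: 'a vec, w). act A (vpoly u) v + w"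
  have sub: "?h ` (carrier_vec ?d \<times> ?T) \<subseteq> torsion A N (f ^ Suc j)"
  proof (intro image_subsetI)
    fix z :: "'a vec \<times> 'a vec" assume "z \<in> carrier_vec ?d \<times> ?T"
    then obtain u w where z: "z = (u, w)" and w: "w \<in> ?T" by blast
    have w': "w \<in> torsion A N (f ^ Suc j)" using w torsion_mono[OF A] by blast
    then have wc: "w \<in> carrier_vec N" "act A (f ^ Suc j) w = 0\<^sub>v N" by (auto simp: torsion_def)
    have "act A (f ^ Suc j) (act A (vpoly u) v) = act A (vpoly u) (act A (f ^ Suc j) v)"
      using act_mult[OF A vc(1)] by (metis mult.commute)
    then have "act A (f ^ Suc j) (act A (vpoly u) v) = 0\<^sub>v N" using vc(2) A by (simp only: act_zero_vec)
    then have "act A (f ^ Suc j) (act A (vpoly u) v + w) = 0\<^sub>v N"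
      using act_add_vec[OF A act_carrier[OF A vc(1)] wc(1)] wc(2) by simp
    then show "?h z \<in> torsion A N (f ^ Suc j)"
      using z wc(1) act_carrier[OF A vc(1)] by (simp add: torsion_def)
  qed
  have inj: "inj_on ?h (carrier_vec ?d \<times> ?T)"
  proof (rule inj_onI, clarify)
    fix u w u' w' assume u: "u \<in> carrier_vec ?d" "u' \<in> carrier_vec ?d" and w: "w \<in> ?T" "w' \<in> ?T"
      and eq: "act A (vpoly u) v + w = act A (vpoly u') v + w'"
    have wc: "w \<in> carrier_vec N" "w' \<in> carrier_vec N" "act A (f ^ j) w = 0\<^sub>v N" "act A (f ^ j) w' = 0\<^sub>v N"
      using w by (auto simp: torsion_def)
    define g where "g = vpoly u - vpoly u'"
    have c: "act A p v \<in> carrier_vec N" for p by (rule act_carrier[OF A vc(1)])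
    have fj: "act A (f ^ j * vpoly u) v = act A (f ^ j * vpoly u') v"
    proof -
      have "act A (f ^ j) (act A (vpoly u) v + w) = act A (f ^ j * vpoly u) v"
        using act_add_vec[OF A c wc(1)] act_mult[OF A vc(1)] wc(3) c act_carrier[OF A c] by simp
      moreover have "act A (f ^ j) (act A (vpoly u') v + w') = act A (f ^ j * vpoly u') v"
        using act_add_vec[OF A c wc(2)] act_mult[OF A vc(1)] wc(4) c act_carrier[OF A c] by simp
      ultimately show ?thesis using eq by simp
    qed
    have "f ^ j * vpoly u = f ^ j * g + f ^ j * vpoly u'" by (simp add: g_def algebra_simps)
    then have "act A (f ^ j * vpoly u) v = act A (f ^ j * g) v + act A (f ^ j * vpoly u') v"
      using act_add[OF A vc(1)] by metis
    then have e: "act A (f ^ j * vpoly u') v = act A (f ^ j * g) v + act A (f ^ j * vpoly u') v"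
      using fj by simp
    have z: "act A (f ^ j * g) v = 0\<^sub>v N"
    proof (rule eq_vecI)
      fix i assume "i < dim_vec (0\<^sub>v N :: 'a vec)"
      then have i: "i < N" by simp
      have "act A (f ^ j * vpoly u') v $ i = act A (f ^ j * g) v $ i + act A (f ^ j * vpoly u') v $ i"
        using arg_cong[OF e, of "\<lambda>w. w $ i"] i carrier_vecD[OF c] by (metis index_add_vec(1))
      then show "act A (f ^ j * g) v $ i = 0\<^sub>v N $ i" using i by simp
    qed (use carrier_vecD[OF c] in simp)
    have "g = 0"
    proof (rule ccontr)
      assume g0: "g \<noteq> 0"
      have "0 < degree f" using f by (rule irreducible_degree_pos)
      have "coeff g i = 0" if "i \<ge> ?d" for i using that u by (simp add: g_def coeff_vpoly)
      then have "degree g < ?d" using g0 by (meson leading_coeff_0_iff not_le)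
      then have "\<not> f dvd g" using g0 by (auto dest: dvd_imp_degree_le)
      then obtain a b where ab: "a * f ^ Suc j + b * g = 1" using irreducible_bezout[OF f] by blast
      have "f ^ j = (a * f ^ Suc j + b * g) * f ^ j" by (simp only: ab mult_1_left)
      also have "\<dots> = (a * f ^ j) * f ^ Suc j + b * (f ^ j * g)" by (simp add: algebra_simps)
      finally have "act A (f ^ j) v = act A (a * f ^ j) (act A (f ^ Suc j) v) + act A b (act A (f ^ j * g) v)"
        using act_add[OF A vc(1)] act_mult[OF A vc(1)] by metis
      then show False using vc(2,3) z A by (simp del: power_Suc)
    qed
    then have "vpoly u = vpoly u'" by (simp add: g_def)
    then have "u $ i = u' $ i" if "i < ?d" for i
      using coeff_vpoly[of u i] coeff_vpoly[of u' i] that u by simp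
    then have uu: "u = u'" using u by (intro eq_vecI) auto
    have "w = w'"
    proof (rule eq_vecI)
      fix i assume "i < dim_vec w'"
      then have i: "i < N" using wc by simp
      have "(act A (vpoly u) v + w) $ i = (act A (vpoly u) v + w') $ i" using eq uu by simp
      then show "w $ i = w' $ i" using i wc by simp
    qed (use wc in auto)
    with uu show "u = u' \<and> w = w'" by blast
  qed
  have "card ((carrier_vec ?d :: 'a vec set) \<times> ?T) \<le> card (torsion A N (f ^ Suc j))"
    by (rule card_inj_on_le[OF inj sub finite_torsion])
  then show ?thesis by (simp only: card_cartesian_product card_carrier_vec)
qed

text \<open>Applying \<open>f ^ (j - i)\<close> to \<open>v\<close> gives a vector that is new at
  layer \<open>i\<close>, so every layer below \<open>j\<close> contributes a factor of at least
  Q.\<close>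

lemma card_torsion_ge_power:
  fixes A :: "'a::{finite,field} mat"
  assumes A: "A \<in> carrier_mat N N" and f: "irreducible f"
    and v: "v \<in> torsion A N (f ^ Suc j) - torsion A N (f ^ j)" and "i \<le> j"
  shows "(CARD('a) ^ degree f) ^ i \<le> card (torsion A N (f ^ i))"
  using \<open>i \<le> j\<close>
proof (induction i)
  case 0
  have "card {0\<^sub>v N :: 'a vec} \<le> card (torsion A N (f ^ 0))"
    using zero_in_torsion[OF A] by (intro card_mono) auto
  then show ?case by simp
next
  case (Suc i)
  have vc: "v \<in> carrier_vec N" "act A (f ^ Suc j) v = 0\<^sub>v N" "act A (f ^ j) v \<noteq> 0\<^sub>v N"
    using v by (auto simp: torsion_def)
  have e: "f ^ j = f ^ i * f ^ (j - i)" "f ^ Suc j = f ^ Suc i * f ^ (j - i)"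
    using Suc.prems by (simp_all flip: power_add)
  have "act A (f ^ (j - i)) v \<in> torsion A N (f ^ Suc i) - torsion A N (f ^ i)"
    using vc act_mult[OF A vc(1)] act_carrier[OF A vc(1)] e
    unfolding torsion_def by (metis (mono_tags, lifting) DiffI mem_Collect_eq)
  note step = card_torsion_step[OF A f this]
  have "(CARD('a) ^ degree f) ^ Suc i \<le> CARD('a) ^ degree f * card (torsion A N (f ^ i))"
    using Suc.IH Suc.prems by simp
  also note step
  finally show ?case .
qed

text \<open>The size \<open>t j\<close> of the torsion of \<open>f ^ j\<close> satisfies
  \<open>Q ^ m \<le> t N\<close> for the multiplicity \<open>m\<close>, so \<open>m\<close> is at
  most the telescoping sum of log_Q of the ratios of consecutive sizes. Each ratio is 1 or at least
  Q, hence \<open>log_le_chord\<close> makes every term linear in the ratio, and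
  \<open>Q ^ j \<le> t j\<close> removes the remaining denominator. The result is linear in the
  numbers of vectors with exact annihilator, so it can be averaged over the group.\<close>

lemma multiplicity_le_torsion_sum:
  fixes A :: "'a::{finite,field} mat"
  assumes A: "A \<in> carrier_mat N N" and f: "irreducible f" "lead_coeff f = 1"
    and Q: "Q = real (CARD('a) ^ degree f)"
  shows "real (Max {k. f ^ k dvd char_poly A}) \<le>
    (\<Sum>j<N. real (card (torsion A N (f ^ Suc j) - torsion A N (f ^ j))) / (Q ^ j * (Q - 1)))"
proof -
  let ?T = "\<lambda>j. torsion A N (f ^ j)"
  define t where "t j = real (card (?T j))" for j
  have d0: "0 < degree f" using f(1) by (rule irreducible_degree_pos)
  have "1 < CARD('a) ^ degree f"
    using one_less_CARD_field[where 'a = 'a] d0 by (rule one_less_power)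
  then have Q1: "1 < Q" unfolding Q by (metis of_nat_1 of_nat_less_iff)
  have t1: "1 \<le> t j" for j
  proof -
    have "card {0\<^sub>v N :: 'a vec} \<le> card (?T j)"
      using zero_in_torsion[OF A] by (intro card_mono) auto
    then show ?thesis by (simp add: t_def)
  qed
  have diff: "real (card (?T (Suc j) - ?T j)) = t (Suc j) - t j" for j
  proof -
    have "card (?T (Suc j) - ?T j)
        = card (?T (Suc j)) - card (?T j)"
      by (rule card_Diff_subset[OF finite_torsion torsion_mono[OF A]])
    moreover have "card (?T j) \<le> card (?T (Suc j))"
      by (rule card_mono[OF finite_torsion torsion_mono[OF A]])
    ultimately show ?thesis unfolding t_def by (simp only: of_nat_diff)
  qed
  have step: "log Q (t (Suc j)) - log Q (t j) \<le> (t (Suc j) - t j) / (Q ^ j * (Q - 1))" for j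
  proof (cases "?T (Suc j) - ?T j = {}")
    case True
    then have "?T (Suc j) = ?T j" using torsion_mono[OF A, of f j] by blast
    then have "t (Suc j) = t j" unfolding t_def by (rule arg_cong)
    then show ?thesis by simp
  next
    case False
    then obtain v where v: "v \<in> ?T (Suc j) - ?T j" by blast
    have Qt: "Q * t j \<le> t (Suc j)"
      using card_torsion_step[OF A f(1) v] unfolding t_def Q by (metis of_nat_le_iff of_nat_mult)
    have Qj: "Q ^ j \<le> t j"
      using card_torsion_ge_power[OF A f(1) v order_refl] unfolding t_def Q by (metis of_nat_le_iff of_nat_power)
    have tp: "0 < t j" "0 < t (Suc j)" using t1[of j] t1[of "Suc j"] by auto
    have "log Q (t (Suc j)) - log Q (t j) = log Q (t (Suc j) / t j)"
      using tp Q1 by (simp add: log_divide)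
    also have "\<dots> \<le> (t (Suc j) / t j - 1) / (Q - 1)"
      using Qt tp by (intro log_le_chord[OF Q1]) (simp add: pos_le_divide_eq)
    also have "\<dots> = (t (Suc j) - t j) / (t j * (Q - 1))"
      using tp by (simp add: field_simps)
    also have "\<dots> \<le> (t (Suc j) - t j) / (Q ^ j * (Q - 1))"
    proof (intro divide_left_mono mult_right_mono)
      have "1 * t j \<le> Q * t j" using Q1 tp by (intro mult_right_mono) auto
      then show "0 \<le> t (Suc j) - t j" using Qt by simp
    qed (use Qj Q1 tp in auto)
    finally show ?thesis .
  qed
  obtain M where M: "\<forall>f\<in>#M. lead_coeff f = 1 \<and> irreducible f" "char_poly A = prod_mset M"
    using monic_factorization[of "char_poly A"] degree_monic_char_poly[OF A] by auto
  define m where "m = Max {k. f ^ k dvd char_poly A}"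
  have mc: "m = count M f"
    unfolding m_def M(2) using M(1) by (intro Max_power_dvd_prod_mset[OF f(2,1)]) auto
  have "CARD('a) ^ (degree f * m) \<le> card (?T N)"
    unfolding mc using M by (intro card_torsion_ge[OF A f]) auto
  then have "(CARD('a) ^ degree f) ^ m \<le> card (?T N)" by (simp only: power_mult)
  then have "Q ^ m \<le> t N" unfolding t_def Q by (metis of_nat_le_iff of_nat_power)
  then have "log Q (Q ^ m) \<le> log Q (t N)"
    using Q1 t1[of N] by (subst log_le_cancel_iff) simp_all
  then have "real m \<le> log Q (t N)" using Q1 by (simp add: log_nat_power)
  also have "t 0 = 1"
  proof -
    have "?T 0 = {0\<^sub>v N}" using A by (auto simp: torsion_def)
    then show ?thesis by (simp add: t_def)
  qed
  then have "log Q (t N) = (\<Sum>j<N. log Q (t (Suc j)) - log Q (t j))"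
    using sum_lessThan_telescope[of "\<lambda>j. log Q (t j)" N] by simp
  also have "\<dots> \<le> (\<Sum>j<N. (t (Suc j) - t j) / (Q ^ j * (Q - 1)))"
    by (intro sum_mono step)
  finally show ?thesis unfolding m_def diff .
qed

section \<open>Mean multiplicities over the symplectic group\<close>

lemma bilinear_form_smult_left:
  assumes "bilinear_form N B" "u \<in> carrier_vec N" "v \<in> carrier_vec N"
  shows "B (c \<cdot>\<^sub>v u) v = c * B u v"
  using assms unfolding bilinear_form_def by blast

lemma bilinear_form_add_left:
  assumes "bilinear_form N B" "u \<in> carrier_vec N" "v \<in> carrier_vec N" "w \<in> carrier_vec N"
  shows "B (u + v) w = B u w + B v w"
  using assms unfolding bilinear_form_def by blast

lemma bilinear_form_left_expand:
  assumes B: "bilinear_form N B" and u: "u \<in> carrier_vec N" and v: "v \<in> carrier_vec N"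
  shows "B u v = (\<Sum>i<N. u $ i * B (unit_vec N i) v)"
proof -
  define t where "t k = vec N (\<lambda>i. if i < k then u $ i else 0)" for k
  have B0: "B (0\<^sub>v N) v = 0"
  proof -
    have "B (0 \<cdot>\<^sub>v 0\<^sub>v N) v = 0 * B (0\<^sub>v N) v"
      by (rule bilinear_form_smult_left[OF B zero_carrier_vec v])
    moreover have "0 \<cdot>\<^sub>v 0\<^sub>v N = (0\<^sub>v N :: 'a vec)" by auto
    ultimately show ?thesis by simp
  qed
  have "B (t k) v = (\<Sum>i<k. u $ i * B (unit_vec N i) v)" if "k \<le> N" for k
    using that
  proof (induction k)
    case 0
    have "t 0 = 0\<^sub>v N" by (auto simp: t_def)
    then show ?case using B0 by simp
  next
    case (Suc k)
    have "t (Suc k) = t k + u $ k \<cdot>\<^sub>v unit_vec N k"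
      using Suc.prems by (intro eq_vecI) (auto simp: t_def unit_vec_def less_Suc_eq)
    moreover have "B (t k + u $ k \<cdot>\<^sub>v unit_vec N k) v = B (t k) v + B (u $ k \<cdot>\<^sub>v unit_vec N k) v"
      by (rule bilinear_form_add_left[OF B _ _ v]) (simp_all add: t_def)
    moreover have "B (u $ k \<cdot>\<^sub>v unit_vec N k) v = u $ k * B (unit_vec N k) v"
      by (rule bilinear_form_smult_left[OF B unit_vec_carrier v])
    ultimately show ?case using Suc by simp
  qed
  moreover have "t N = u" using u by (intro eq_vecI) (auto simp: t_def)
  ultimately show ?thesis by (metis order_refl)
qed

lemma bilinear_form_flip: "bilinear_form N B \<Longrightarrow> bilinear_form N (\<lambda>u v. B v u)"
  by (simp add: bilinear_form_def)

lemma bilinear_form_gram: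
  assumes B: "bilinear_form N B" and u: "u \<in> carrier_vec N" and v: "v \<in> carrier_vec N"
  shows "B u v = u \<bullet> (mat N N (\<lambda>(i, j). B (unit_vec N i) (unit_vec N j)) *\<^sub>v v)"
proof -
  have "B u v = (\<Sum>i<N. u $ i * (\<Sum>j<N. v $ j * B (unit_vec N i) (unit_vec N j)))"
    using bilinear_form_left_expand[OF B u v]
      bilinear_form_left_expand[OF bilinear_form_flip[OF B] v unit_vec_carrier] by simp
  also have "\<dots> = u \<bullet> (mat N N (\<lambda>(i, j). B (unit_vec N i) (unit_vec N j)) *\<^sub>v v)"
    using v by (auto simp: scalar_prod_def lessThan_atLeast0 mult.commute intro!: sum.cong)
  finally show ?thesis .
qed

lemma symplectic_eq_isometries:
  fixes B :: "'a::field vec \<Rightarrow> 'a vec \<Rightarrow> 'a"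
  assumes "nondegenerate_alternating_form N B"
  obtains J where "symplectic_gram N J" "symplectic N B = isometries N J"
proof -
  have B: "bilinear_form N B" and alt: "\<And>u. u \<in> carrier_vec N \<Longrightarrow> B u u = 0"
    and nd: "\<And>u. u \<in> carrier_vec N \<Longrightarrow> (\<forall>v\<in>carrier_vec N. B u v = 0) \<Longrightarrow> u = 0\<^sub>v N"
    using assms by (auto simp: nondegenerate_alternating_form_def alternating_form_def)
  define J where "J = mat N N (\<lambda>(i, j). B (unit_vec N i) (unit_vec N j))"
  have Jc: "J \<in> carrier_mat N N" by (simp add: J_def)
  have BJ: "B u v = u \<bullet> (J *\<^sub>v v)" if "u \<in> carrier_vec N" "v \<in> carrier_vec N" for u v
    unfolding J_def by (rule bilinear_form_gram[OF B that])
  have "det (J\<^sup>T) \<noteq> 0"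
  proof
    assume "det (J\<^sup>T) = 0"
    then obtain u where u: "u \<in> carrier_vec N" "u \<noteq> 0\<^sub>v N" "J\<^sup>T *\<^sub>v u = 0\<^sub>v N"
      using det_0_iff_vec_prod_zero[of "J\<^sup>T" N] Jc by auto
    have "B u v = 0" if v: "v \<in> carrier_vec N" for v
      using BJ[OF u(1) v] transpose_vec_mult_scalar[OF Jc v u(1)] u(3) v by simp
    with nd[OF u(1)] u(2) show False by blast
  qed
  then have J: "symplectic_gram N J"
    using Jc BJ alt by (auto simp: symplectic_gram_def det_transpose)
  have "symplectic N B = isometries N J"
  proof (intro Set.set_eqI iffI)
    fix A assume "A \<in> symplectic N B"
    then have A: "A \<in> carrier_mat N N"
      and inv: "\<And>u v. u \<in> carrier_vec N \<Longrightarrow> v \<in> carrier_vec N \<Longrightarrow> B (A *\<^sub>v u) (A *\<^sub>v v) = B u v"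
      by (auto simp: symplectic_def general_linear_def)
    have "gram J A = J"
    proof (rule eq_matI)
      fix i j assume "i < dim_row J" "j < dim_col J"
      then have ij: "i < N" "j < N" using Jc by auto
      have col: "col A k = A *\<^sub>v unit_vec N k" if "k < N" for k
        using that A by (intro eq_vecI) auto
      have "gram J A $$ (i, j) = B (A *\<^sub>v unit_vec N i) (A *\<^sub>v unit_vec N j)"
        using gram_index[OF Jc A ij] BJ[of "col A i" "col A j"] A ij by (simp add: col)
      also have "\<dots> = J $$ (i, j)" using inv ij by (simp add: J_def)
      finally show "gram J A $$ (i, j) = J $$ (i, j)" .
    qed (use A Jc in \<open>auto simp: gram_def\<close>)
    with A show "A \<in> isometries N J" by (simp add: isometries_def)
  next
    fix A assume A: "A \<in> isometries N J"
    note Ac = isometriesD(1)[OF A]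
    obtain S where "S \<in> carrier_mat N N" "A * S = 1\<^sub>m N" "S * A = 1\<^sub>m N"
      using square_frame_inverse[OF frame_isometry[OF J A]] by metis
    then have "invertible_mat A"
      using Ac by (auto simp: invertible_mat_def inverts_mat_def intro!: exI[of _ S])
    moreover have "B (A *\<^sub>v u) (A *\<^sub>v v) = B u v" if "u \<in> carrier_vec N" "v \<in> carrier_vec N" for u v
      using isometry_form[OF Jc A that] BJ[of "A *\<^sub>v u" "A *\<^sub>v v"] BJ[OF that] that Ac by simp
    ultimately show "A \<in> symplectic N B" using Ac by (simp add: symplectic_def general_linear_def)
  qed
  with J show ?thesis by (rule that)
qed

section \<open>Mean multiplicities and their upper bounds\<close>

definition multiplicity_in :: "'a::field poly \<Rightarrow> 'a poly \<Rightarrow> nat" where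
  "multiplicity_in f p = Max {k. f ^ k dvd p}"

definition mean_multiplicity :: "nat \<Rightarrow> 'a::field mat \<Rightarrow> 'a poly \<Rightarrow> real" where
  "mean_multiplicity N J f =
    (\<Sum>A\<in>isometries N J. real (multiplicity_in f (char_poly A))) / real (card (isometries N J))"

lemma card_isometries_pos:
  fixes J :: "'a::{finite,field} mat"
  assumes "J \<in> carrier_mat N N"
  shows "0 < card (isometries N J)"
proof -
  have "1\<^sub>m N \<in> isometries N J" using assms by (simp add: isometries_def gram_def)
  then show ?thesis using finite_isometries card_gt_0_iff by blast
qed

lemma mean_multiplicity_nonneg: "0 \<le> mean_multiplicity N J f"
  by (simp add: mean_multiplicity_def sum_nonneg)

lemma mean_multiplicity_le_sum:
  fixes J :: "'a::{finite,field} mat"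
  assumes J: "symplectic_gram N J" and f: "irreducible f" "lead_coeff f = 1"
    and Q: "Q = real (CARD('a) ^ degree f)"
    and b: "\<And>j. real (card (torsion_pairs N J f j))
      \<le> b j * real (card (isometries N J))"
  shows "mean_multiplicity N J f \<le> (\<Sum>j<N. b j / (Q ^ j * (Q - 1)))"
proof -
  let ?G = "isometries N J"
  let ?X = "\<lambda>j A. torsion A N (f ^ Suc j) - torsion A N (f ^ j)"
  have Q1: "1 \<le> Q" unfolding Q using one_less_CARD_field[where 'a = 'a] by (simp add: Suc_leI)
  have pairs: "(\<Sum>A\<in>?G. real (card (?X j A))) = real (card (torsion_pairs N J f j))" for j
  proof -
    have eq: "torsion_pairs N J f j = (SIGMA A:?G. ?X j A)" by (auto simp: torsion_pairs_def)
    have "card (SIGMA A:?G. ?X j A) = (\<Sum>A\<in>?G. card (?X j A))"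
      by (rule card_SigmaI) (auto simp: finite_isometries)
    then show ?thesis unfolding eq by (simp only: of_nat_sum)
  qed
  have "(\<Sum>A\<in>?G. real (multiplicity_in f (char_poly A)))
      \<le> (\<Sum>A\<in>?G. \<Sum>j<N. real (card (?X j A)) / (Q ^ j * (Q - 1)))"
    unfolding multiplicity_in_def
    by (intro sum_mono multiplicity_le_torsion_sum[OF _ f Q]) (rule isometriesD)
  also have "\<dots> = (\<Sum>j<N. real (card (torsion_pairs N J f j)) / (Q ^ j * (Q - 1)))"
    by (subst sum.swap) (simp only: pairs flip: sum_divide_distrib)
  also have "\<dots> \<le> (\<Sum>j<N. b j * real (card ?G) / (Q ^ j * (Q - 1)))"
    using Q1 by (intro sum_mono divide_right_mono b) simp
  also have "\<dots> = (\<Sum>j<N. b j / (Q ^ j * (Q - 1))) * real (card ?G)"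
    by (simp add: sum_distrib_right)
  finally show ?thesis
    unfolding mean_multiplicity_def
    using card_isometries_pos[OF symplectic_gramD(1)[OF J]] by (simp add: pos_divide_le_eq)
qed

lemma sum_geometric_le:
  fixes y :: real
  assumes "1 < y"
  shows "(\<Sum>j<N. 1 / y ^ j) \<le> y / (y - 1)"
proof -
  have "(\<Sum>j<N. (1 / y) ^ j) \<le> (\<Sum>j. (1 / y) ^ j)"
    using assms by (intro sum_le_suminf summable_geometric) auto
  also have "\<dots> = y / (y - 1)" using assms by (subst suminf_geometric) (auto simp: field_simps)
  finally show ?thesis by (simp add: power_one_over)
qed

text \<open>Here \<open>y\<close> is the square root of Q = q^d, so odd degrees need no half-integer
  exponents. The number of Gram matrices is at most \<open>y ^ Suc j\<close>, and the terms
  \<open>y ^ Suc j / ((y ^ 2) ^ j * (y ^ 2 - 1))\<close> form a geometric series of ratio 1/y. The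
  bound is applied to linear and to self-dual factors.\<close>

lemma mean_multiplicity_half:
  fixes J :: "'a::{finite,field} mat"
  assumes J: "symplectic_gram N J" and f: "irreducible f" "lead_coeff f = 1"
    and y: "0 < y" "y ^ 2 = real (CARD('a) ^ degree f)"
  shows "mean_multiplicity N J f \<le> y ^ 2 / ((y ^ 2 - 1) * (y - 1))"
proof -
  let ?h = "\<lambda>j. CARD('a) ^ (Suc j * degree f div 2)" and ?c = "real (card (isometries N J))"
  have "0 < degree f" using f(1) by (rule irreducible_degree_pos)
  then have "1 < CARD('a) ^ degree f"
    using one_less_CARD_field[where 'a = 'a] by (intro one_less_power)
  then have y2: "1 < y ^ 2" unfolding y(2) by (metis of_nat_1 of_nat_less_iff)
  have y1: "1 < y"
  proof (rule ccontr)
    assume "\<not> 1 < y"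
    then have "y ^ 2 \<le> 1" using y(1) by (intro power_le_one) auto
    with y2 show False by simp
  qed
  have "mean_multiplicity N J f \<le> (\<Sum>j<N. y ^ Suc j / ((y ^ 2) ^ j * (y ^ 2 - 1)))"
  proof (rule mean_multiplicity_le_sum[OF J f y(2)])
    fix j
    \<comment> \<open>The exponent in \<open>?h\<close> is rounded down, so doubling it gives at
      most \<open>Suc j * degree f\<close>; the comparison is therefore made between
      squares.\<close>
    have "(real (?h j))\<^sup>2 = real (CARD('a) ^ (2 * (Suc j * degree f div 2)))"
      by (simp add: power_mult[symmetric] mult.commute)
    also have "\<dots> \<le> real (CARD('a) ^ (Suc j * degree f))"
      unfolding of_nat_le_iff by (intro power_increasing) auto
    also have "\<dots> = (y ^ Suc j)\<^sup>2"
    proof -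
      have "(y ^ Suc j)\<^sup>2 = (y ^ 2) ^ Suc j" by (simp only: power_mult[symmetric] mult.commute)
      then show ?thesis unfolding y(2) by (simp add: power_mult[symmetric] mult.commute power_add)
    qed
    finally have "(real (?h j))\<^sup>2 \<le> (y ^ Suc j)\<^sup>2" .
    moreover have "0 \<le> y ^ Suc j" using y(1) by simp
    ultimately have "real (?h j) \<le> y ^ Suc j"
      by (rule power2_le_imp_le)
    then have "real (?h j) * ?c
        \<le> y ^ Suc j * ?c"
      by (intro mult_right_mono) auto
    moreover have "real (card (torsion_pairs N J f j))
        \<le> real (?h j) * ?c"
      using card_torsion_pairs_half[OF J f, of j] by (simp only: of_nat_le_iff flip: of_nat_mult)
    ultimately show "real (card (torsion_pairs N J f j))
        \<le> y ^ Suc j * ?c" by linarith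
  qed
  also have "\<dots> = (\<Sum>j<N. (y / (y ^ 2 - 1)) * (1 / y ^ j))"
  proof (rule sum.cong)
    fix j
    have "(y ^ 2) ^ j = y ^ j * y ^ j" by (simp add: power2_eq_square power_mult_distrib)
    moreover have "y ^ j \<noteq> 0" using y1 by simp
    ultimately show "y ^ Suc j / ((y ^ 2) ^ j * (y ^ 2 - 1)) = y / (y ^ 2 - 1) * (1 / y ^ j)"
      by (simp add: mult.assoc)
  qed simp
  also have "\<dots> = (y / (y ^ 2 - 1)) * (\<Sum>j<N. 1 / y ^ j)"
    by (simp only: sum_distrib_left)
  also have "\<dots> \<le> (y / (y ^ 2 - 1)) * (y / (y - 1))"
    using y1 y2 by (intro mult_left_mono sum_geometric_le) auto
  finally show ?thesis by (simp add: power2_eq_square)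
qed

lemma mean_multiplicity_even_degree:
  fixes J :: "'a::{finite,field} mat"
  assumes J: "symplectic_gram N J" and f: "irreducible f" "lead_coeff f = 1" and d: "degree f = 2 * k"
  shows "mean_multiplicity N J f \<le> 1 / CARD('a) ^ k + 6 / CARD('a) ^ (2 * k)"
proof -
  define y where "y = real CARD('a) ^ k"
  have "0 < k" using f(1) is_unit_iff_degree[of f] d by auto
  then have "real CARD('a) ^ 1 \<le> y"
    unfolding y_def using one_less_CARD_field[where 'a = 'a] by (intro power_increasing) auto
  then have y2: "2 \<le> y" using one_less_CARD_field[where 'a = 'a] by simp
  have yy: "y ^ 2 = real (CARD('a) ^ degree f)" by (simp add: y_def d power_mult[symmetric] mult.commute)
  have "mean_multiplicity N J f \<le> y ^ 2 / ((y ^ 2 - 1) * (y - 1))"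
    using y2 by (intro mean_multiplicity_half[OF J f _ yy]) simp
  also have "\<dots> \<le> 1 / y + 6 / y ^ 2"
  proof -
    \<comment> \<open>This is (y + 6)(y^2 - 1)(y - 1) - y^4, rewritten so that its sign is visible
      for y at least 2. Any sufficiently large constant would do in place of 6.\<close>
    have "0 \<le> (y - 2) * (5 * y ^ 2 + 3 * y + 1) + 8"
      using y2 by (intro add_nonneg_nonneg mult_nonneg_nonneg) auto
    then have "y ^ 4 \<le> (y + 6) * ((y ^ 2 - 1) * (y - 1))"
      by (simp add: algebra_simps power2_eq_square power4_eq_xxxx)
    moreover have p: "0 < (y ^ 2 - 1) * (y - 1)"
      using y2 by (intro mult_pos_pos) (auto intro: less_le_trans[of _ "2 ^ 2"] power_mono)
    ultimately have "y ^ 4 / ((y ^ 2 - 1) * (y - 1)) \<le> y + 6" by (simp add: pos_divide_le_eq)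
    then have "y ^ 4 / ((y ^ 2 - 1) * (y - 1)) / y ^ 2 \<le> (y + 6) / y ^ 2"
      by (intro divide_right_mono) auto
    moreover have "y ^ 4 / ((y ^ 2 - 1) * (y - 1)) / y ^ 2 = y ^ 2 / ((y ^ 2 - 1) * (y - 1))"
      using y2 by (simp add: power2_eq_square power4_eq_xxxx)
    moreover have "(y + 6) / y ^ 2 = 1 / y + 6 / y ^ 2"
      using y2 by (simp add: add_divide_distrib power2_eq_square)
    ultimately show ?thesis by simp
  qed
  also have "\<dots> = 1 / CARD('a) ^ k + 6 / CARD('a) ^ (2 * k)"
    by (simp add: y_def power_mult[symmetric] mult.commute)
  finally show ?thesis .
qed

lemma mean_multiplicity_not_self_dual:
  fixes J :: "'a::{finite,field} mat"
  assumes J: "symplectic_gram N J" and f: "irreducible f" "lead_coeff f = 1"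
    and nd: "\<not> f dvd reflect_poly f"
  shows "mean_multiplicity N J f \<le>
    (if 2 * degree f \<le> N then 1 / CARD('a) ^ degree f + 8 / CARD('a) ^ (2 * degree f) else 0)"
proof -
  define Q where "Q = real (CARD('a) ^ degree f)"
  define b where "b = (if 2 * degree f \<le> N then 1 else 0 :: real)"
  have "0 < degree f" using f(1) by (rule irreducible_degree_pos)
  then have "CARD('a) ^ 1 \<le> CARD('a) ^ degree f"
    by (intro power_increasing) auto
  then have "2 \<le> CARD('a) ^ degree f" using one_less_CARD_field[where 'a = 'a] by simp
  then have Q2: "2 \<le> Q" unfolding Q_def by (metis of_nat_le_iff of_nat_numeral)
  have "mean_multiplicity N J f \<le> (\<Sum>j<N. b / (Q ^ j * (Q - 1)))"
  proof (rule mean_multiplicity_le_sum[OF J f Q_def])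
    fix j
    show "real (card (torsion_pairs N J f j))
      \<le> b * real (card (isometries N J))"
      using card_torsion_pairs_not_self_dual[OF J f nd, of j] by (simp add: b_def split: if_splits)
  qed
  also have "\<dots> = b / (Q - 1) * (\<Sum>j<N. 1 / Q ^ j)"
    by (simp add: sum_distrib_left mult.commute)
  also have "\<dots> \<le> b / (Q - 1) * (Q / (Q - 1))"
    using Q2 by (intro mult_left_mono sum_geometric_le) (auto simp: b_def)
  also have "\<dots> \<le> b * (1 / Q + 8 / Q ^ 2)"
  proof -
    \<comment> \<open>This is (Q + 8)(Q - 1)^2 - Q^3, again arranged around the least possible value
      2.\<close>
    have "0 \<le> (Q - 2) * (6 * Q - 3) + 2"
      using Q2 by (intro add_nonneg_nonneg mult_nonneg_nonneg) auto
    then have "Q ^ 3 \<le> (Q + 8) * (Q - 1) ^ 2"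
      using Q2 by (simp add: algebra_simps power2_eq_square power3_eq_cube)
    then have "Q ^ 3 / (Q - 1) ^ 2 / Q ^ 2 \<le> (Q + 8) / Q ^ 2"
      using Q2 by (intro divide_right_mono) (simp_all add: pos_divide_le_eq)
    moreover have "Q ^ 3 / (Q - 1) ^ 2 / Q ^ 2 = 1 / (Q - 1) * (Q / (Q - 1))"
      using Q2 by (simp add: power2_eq_square power3_eq_cube)
    moreover have "(Q + 8) / Q ^ 2 = 1 / Q + 8 / Q ^ 2"
      using Q2 by (simp add: add_divide_distrib power2_eq_square)
    ultimately show ?thesis by (simp add: b_def)
  qed
  finally have le: "mean_multiplicity N J f \<le> b * (1 / Q + 8 / Q ^ 2)" .
  have "Q ^ 2 = CARD('a) ^ (2 * degree f)"
    unfolding Q_def by (simp add: power_mult[symmetric] mult.commute)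
  with le show ?thesis by (cases "2 * degree f \<le> N") (simp_all add: b_def Q_def)
qed

section \<open>Counting irreducible polynomials\<close>

definition monics :: "nat \<Rightarrow> 'a::field poly set" where
  "monics n = {F. lead_coeff F = 1 \<and> degree F = n}"

definition irreds :: "nat \<Rightarrow> 'a::field poly set" where
  "irreds n = {f. irreducible f \<and> lead_coeff f = 1 \<and> degree f \<le> n}"

text \<open>The index is half the degree, which is also the number of free coefficients.
  Characteristic polynomials of symplectic matrices have this shape; here the set serves as a model
  in which divisibility by a given \<open>f\<close> is easy to count.\<close>

definition palindromics :: "nat \<Rightarrow> 'a::field poly set" where
  "palindromics e = {F \<in> monics (2 * e). reflect_poly F = F}"

lemma card_monics: "card (monics n :: 'a::{finite,field} poly set) = CARD('a) ^ n"
proof -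
  have "bij_betw (\<lambda>F. vec n (coeff F)) (monics n) (carrier_vec n :: 'a vec set)"
  proof (rule bij_betwI[where g = "\<lambda>u. monom 1 n + vpoly u"])
    show "(\<lambda>u :: 'a vec. monom 1 n + vpoly u) \<in> carrier_vec n \<rightarrow> monics n"
    proof
      fix u :: "'a vec" assume u: "u \<in> carrier_vec n"
      have "coeff (monom 1 n + vpoly u) n = 1" using u by (simp add: coeff_vpoly)
      moreover have "degree (monom 1 n + vpoly u) \<le> n"
        using u by (intro degree_le) (auto simp: coeff_vpoly)
      moreover have "n \<le> degree (monom 1 n + vpoly u)"
        using u by (intro le_degree) (simp add: coeff_vpoly)
      ultimately show "monom 1 n + vpoly u \<in> monics n"
        unfolding monics_def by (metis (mono_tags, lifting) antisym mem_Collect_eq)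
    qed
    show "vec n (coeff (monom 1 n + vpoly u)) = u" if "u \<in> carrier_vec n" for u :: "'a vec"
      using that by (intro eq_vecI) (auto simp: coeff_vpoly)
    show "monom 1 n + vpoly (vec n (coeff F)) = F" if "F \<in> monics n" for F :: "'a poly"
      using that by (auto simp: poly_eq_iff coeff_vpoly monics_def coeff_eq_0)
  qed simp
  then show ?thesis by (simp add: bij_betw_same_card card_carrier_vec)
qed

lemma finite_monics [simp]: "finite (monics n :: 'a::{finite,field} poly set)"
  by (rule card_ge_0_finite) (simp only: card_monics zero_less_power zero_less_card_finite)

lemma finite_irreds [simp]: "finite (irreds n :: 'a::{finite,field} poly set)"
proof (rule finite_subset)
  show "irreds n \<subseteq> (\<Union>d\<in>{..n}. monics d)" by (auto simp: irreds_def monics_def)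
qed simp

lemma monics_nonzero: "F \<in> monics n \<Longrightarrow> F \<noteq> 0"
  by (auto simp: monics_def)

lemma monics_mult:
  assumes "G \<in> monics m" "H \<in> monics n"
  shows "G * H \<in> monics (m + n)"
proof -
  have "lead_coeff (G * H) = 1" using assms unfolding lead_coeff_mult by (auto simp: monics_def)
  moreover have "degree (G * H) = m + n"
    using assms monics_nonzero[OF assms(1)] monics_nonzero[OF assms(2)] by (simp add: degree_mult_eq monics_def)
  ultimately show ?thesis by (simp add: monics_def)
qed

lemma irreds_degree_pos: "f \<in> irreds n \<Longrightarrow> 0 < degree f"
  using is_unit_iff_degree[of f] by (auto simp: irreds_def)

lemma monic_factorization_irreds:
  fixes F :: "'a::{finite,field} poly"
  assumes F: "lead_coeff F = 1" and n: "degree F \<le> n"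
  obtains M where "F = prod_mset M" "set_mset M \<subseteq> irreds n"
    "\<And>f. f \<in> irreds n \<Longrightarrow> multiplicity_in f F = count M f" "num_irred_factors F = size M"
proof -
  obtain M where M: "\<forall>f\<in>#M. lead_coeff f = 1 \<and> irreducible f" "F = prod_mset M"
    using monic_factorization[OF F] by blast
  have F0: "F \<noteq> 0" using F by auto
  have "set_mset M \<subseteq> irreds n"
  proof
    fix f assume "f \<in># M"
    then have "f dvd F" using M(2) by (simp add: dvd_prod_mset)
    then have "degree f \<le> n" using dvd_imp_degree_le[OF _ F0] n le_trans by blast
    then show "f \<in> irreds n" using M(1) \<open>f \<in># M\<close> by (simp add: irreds_def)
  qed
  moreover have "multiplicity_in f F = count M f" if "f \<in> irreds n" for f
    unfolding multiplicity_in_def M(2) using M(1) that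
    by (intro Max_power_dvd_prod_mset) (auto simp: irreds_def)
  moreover have "num_irred_factors F = size M"
    unfolding M(2) using M(1) by (intro num_irred_factors_prod_mset) auto
  ultimately show ?thesis using that M(2) by blast
qed

lemma sum_mult_count:
  assumes "finite S" "set_mset M \<subseteq> S"
  shows "(\<Sum>f\<in>S. c f * count M f) = (\<Sum>f\<in>#M. c f :: nat)"
  using assms(2)
proof (induction M)
  case (add x M)
  have "(\<Sum>f\<in>S. c f * count (add_mset x M) f) = (\<Sum>f\<in>S. c f * count M f + (if f = x then c f else 0))"
    by (rule sum.cong) auto
  also have "\<dots> = (\<Sum>f\<in>S. c f * count M f) + c x"
    using add.prems assms(1) by (simp add: sum.distrib)
  finally show ?case using add by simp
qed simp

lemma num_irred_factors_eq_sum: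
  fixes F :: "'a::{finite,field} poly"
  assumes "lead_coeff F = 1" "degree F \<le> n"
  shows "num_irred_factors F = (\<Sum>f\<in>irreds n. multiplicity_in f F)"
proof -
  obtain M where M: "set_mset M \<subseteq> irreds n"
    "\<And>f. f \<in> irreds n \<Longrightarrow> multiplicity_in f F = count M f" "num_irred_factors F = size M"
    using monic_factorization_irreds[OF assms] by metis
  have "(\<Sum>f\<in>irreds n. multiplicity_in f F) = (\<Sum>f\<in>irreds n. 1 * count M f)"
    using M(2) by (intro sum.cong) auto
  also have "\<dots> = size M" unfolding sum_mult_count[OF finite_irreds M(1)] by simp
  finally show ?thesis using M(3) by simp
qed

lemma degree_eq_sum_multiplicity:
  fixes F :: "'a::{finite,field} poly"
  assumes "lead_coeff F = 1" "degree F \<le> n"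
  shows "(\<Sum>f\<in>irreds n. degree f * multiplicity_in f F) = degree F"
proof -
  obtain M where M: "F = prod_mset M" "set_mset M \<subseteq> irreds n"
    "\<And>f. f \<in> irreds n \<Longrightarrow> multiplicity_in f F = count M f"
    using monic_factorization_irreds[OF assms] by metis
  have "degree (prod_mset M) = (\<Sum>f\<in>#M. degree f)" if "0 \<notin># M" for M :: "'a poly multiset"
    using that by (induction M) (auto simp: degree_mult_eq prod_mset_zero_iff)
  moreover have "0 \<notin># M" using M(2) by (auto simp: irreds_def)
  ultimately have "degree F = (\<Sum>f\<in>irreds n. degree f * count M f)"
    unfolding sum_mult_count[OF finite_irreds M(2)] using M(1) by simp
  then show ?thesis using M(3) by simp
qed

lemma multiplicity_in_pos:
  fixes F :: "'a::{finite,field} poly"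
  assumes F: "lead_coeff F = 1" "degree F \<le> n" and f: "f \<in> irreds n" "f dvd F"
  shows "1 \<le> multiplicity_in f F"
proof -
  obtain M where M: "F = prod_mset M" "set_mset M \<subseteq> irreds n"
    "\<And>f. f \<in> irreds n \<Longrightarrow> multiplicity_in f F = count M f"
    using monic_factorization_irreds[OF F] by metis
  have "f \<in># M"
    using irred_dvd_prod_mset[of f M] f M by (auto simp: irreds_def)
  then show ?thesis using M(3)[OF f(1)] by simp
qed

lemma multiplicity_in_le_sum:
  fixes F :: "'a::{finite,field} poly"
  assumes F: "lead_coeff F = 1" "degree F \<le> n" and f: "f \<in> irreds n"
  shows "multiplicity_in f F \<le> (\<Sum>j<n. if f ^ Suc j dvd F then 1 else 0)"
proof -
  obtain M where M: "F = prod_mset M" "set_mset M \<subseteq> irreds n"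
    "\<And>f. f \<in> irreds n \<Longrightarrow> multiplicity_in f F = count M f"
    using monic_factorization_irreds[OF F] by metis
  define m where "m = count M f"
  have "M = replicate_mset m f + filter_mset (\<lambda>g. g \<noteq> f) M"
    unfolding m_def by (metis filter_eq_replicate_mset multiset_partition)
  then have "F = f ^ m * prod_mset (filter_mset (\<lambda>g. g \<noteq> f) M)"
    using M(1) by (metis prod_mset_Un prod_mset_replicate_mset)
  then have dvd: "f ^ m dvd F" by (metis dvd_triv_left)
  have f0: "f \<noteq> 0" and F0: "F \<noteq> 0" using F f by (auto simp: irreds_def)
  have "degree (f ^ m) \<le> n" using dvd_imp_degree_le[OF dvd F0] F(2) by simp
  then have "degree f * m \<le> n" using degree_power_eq[OF f0, of m] by (simp add: mult.commute)
  moreover have "1 * m \<le> degree f * m" using irreds_degree_pos[OF f] by (intro mult_le_mono1) simp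
  ultimately have mn: "m \<le> n" by linarith
  have "f ^ Suc j dvd F" if "j < m" for j
    by (rule dvd_trans[OF le_imp_power_dvd dvd]) (use that in simp)
  then have "m = (\<Sum>j<m. if f ^ Suc j dvd F then 1 else 0)"
    by (simp del: power_Suc)
  also have "\<dots> \<le> (\<Sum>j<n. if f ^ Suc j dvd F then 1 else 0)"
    using mn by (intro sum_mono2) auto
  finally show ?thesis using M(3)[OF f] by (simp add: m_def)
qed

section \<open>Irreducible divisors of random monic polynomials\<close>

lemma card_monic_multiples_le:
  fixes g :: "'a::{finite,field} poly"
  assumes "lead_coeff g = 1"
  shows "real (card {F \<in> monics n. g dvd F}) \<le> real CARD('a) ^ n / real CARD('a) ^ degree g"
proof (cases "{F \<in> monics n. g dvd F} = {}")
  case False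
  then obtain F where "F \<in> monics n" "g dvd F" by blast
  then have dn: "degree g \<le> n"
    using dvd_imp_degree_le[of g F] monics_nonzero[of F n] by (auto simp: monics_def)
  have "{F \<in> monics n. g dvd F} \<subseteq> (*) g ` monics (n - degree g)"
  proof
    fix F assume "F \<in> {F \<in> monics n. g dvd F}"
    then have gF: "g dvd F" and F: "F \<in> monics n" by simp_all
    then obtain h where h: "F = g * h" "F \<in> monics n" by (elim dvdE)
    have "lead_coeff F = lead_coeff g * lead_coeff h" unfolding h(1) by (rule lead_coeff_mult)
    then have lh: "lead_coeff h = 1" using F assms by (auto simp: monics_def)
    have nz: "g \<noteq> 0" "h \<noteq> 0" using assms lh by auto
    have "degree F = degree g + degree h" unfolding h(1) by (rule degree_mult_eq[OF nz])
    then have "h \<in> monics (n - degree g)" using lh F by (auto simp: monics_def)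
    then show "F \<in> (*) g ` monics (n - degree g)" using h(1) by blast
  qed
  then have "card {F \<in> monics n. g dvd F} \<le> CARD('a) ^ (n - degree g)"
    using surj_card_le[OF finite_monics] card_monics by metis
  then have "real (card {F \<in> monics n. g dvd F}) \<le> real (CARD('a) ^ (n - degree g))"
    by (simp only: of_nat_le_iff)
  also have "\<dots> = real CARD('a) ^ n / real CARD('a) ^ degree g"
    using dn by (simp only: of_nat_power) (simp add: power_diff)
  finally show ?thesis .
next
  case True
  show ?thesis unfolding True by simp
qed

text \<open>Double counting, as the distinct irreducible factors of a polynomial of degree \<open>D\<close> have
  total degree at most \<open>D\<close>.\<close>

lemma divisor_average:
  fixes S :: "'a::{finite,field} poly set"
  assumes fin: "finite FF" "FF \<noteq> {}" and FF: "FF \<subseteq> monics D" and S: "S \<subseteq> irreds D"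
    and p: "\<And>f. f \<in> S \<Longrightarrow> real (card FF) * p f \<le> real (card {F \<in> FF. f dvd F})"
  shows "(\<Sum>f\<in>S. real (degree f) * p f) \<le> real D"
proof -
  have finS: "finite S" using S finite_irreds by (rule finite_subset)
  have c: "0 < real (card FF)" using fin by (simp add: card_gt_0_iff)
  have "real (card FF) * (\<Sum>f\<in>S. real (degree f) * p f)
      \<le> (\<Sum>f\<in>S. real (degree f) * real (card {F \<in> FF. f dvd F}))"
    unfolding sum_distrib_left
  proof (intro sum_mono)
    fix f assume "f \<in> S"
    then show "real (card FF) * (real (degree f) * p f) \<le> real (degree f) * real (card {F \<in> FF. f dvd F})"
      using mult_left_mono[OF p, of f "real (degree f)"] by (simp add: mult.left_commute)
  qed
  also have "\<dots> = (\<Sum>f\<in>S. \<Sum>F\<in>FF. if f dvd F then real (degree f) else 0)"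
    using fin(1) by (simp add: sum.inter_filter[symmetric] mult.commute)
  also have "\<dots> = (\<Sum>F\<in>FF. \<Sum>f\<in>S. if f dvd F then real (degree f) else 0)"
    by (rule sum.swap)
  also have "\<dots> \<le> (\<Sum>F\<in>FF. real D)"
  proof (intro sum_mono)
    fix F assume "F \<in> FF"
    then have F: "lead_coeff F = 1" "degree F \<le> D" "degree F = D" using FF by (auto simp: monics_def)
    have "(\<Sum>f\<in>S. if f dvd F then real (degree f) else 0)
        \<le> (\<Sum>f\<in>irreds D. if f dvd F then real (degree f) else 0)"
      using S by (intro sum_mono2) auto
    also have "\<dots> \<le> (\<Sum>f\<in>irreds D. real (degree f * multiplicity_in f F))"
    proof (intro sum_mono)
      fix f :: "'a poly" assume f: "f \<in> irreds D"
      show "(if f dvd F then real (degree f) else 0) \<le> real (degree f * multiplicity_in f F)"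
        using multiplicity_in_pos[OF F(1,2) f] mult_le_mono2[of 1 "multiplicity_in f F" "degree f"]
        by (auto simp del: of_nat_mult)
    qed
    also have "\<dots> = real D"
      using degree_eq_sum_multiplicity[OF F(1,2)] F(3) by (simp flip: of_nat_sum del: of_nat_mult)
    finally show "(\<Sum>f\<in>S. if f dvd F then real (degree f) else 0) \<le> real D" .
  qed
  also have "\<dots> = real (card FF) * real D" by simp
  finally show ?thesis using c by (simp only: mult_le_cancel_left_pos)
qed

text \<open>An irreducible \<open>f\<close> of degree d at most n divides the proportion q^(-d) of
  \<open>monics n\<close>; averaging the degrees of the distinct divisors gives the bound.\<close>

lemma sum_irreds_le:
  "(\<Sum>f\<in>(irreds n :: 'a::{finite,field} poly set). real (degree f) * (1 / real CARD('a) ^ degree f)) \<le> real n"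
proof (rule divisor_average[of "monics n"])
  show "(monics n :: 'a poly set) \<noteq> {}"
    using card_monics[of n, where 'a = 'a] by (metis card.empty power_eq_0_iff zero_less_card_finite less_irrefl)
  fix f :: "'a poly" assume f: "f \<in> irreds n"
  let ?d = "degree f"
  have f1: "lead_coeff f = 1" "?d \<le> n" "f \<noteq> 0" using f by (auto simp: irreds_def)
  have "(*) f ` monics (n - ?d) \<subseteq> {F \<in> monics n. f dvd F}"
  proof (intro image_subsetI)
    fix G :: "'a poly" assume G: "G \<in> monics (n - ?d)"
    have "f \<in> monics ?d" using f1 by (simp add: monics_def)
    from monics_mult[OF this G] show "f * G \<in> {F \<in> monics n. f dvd F}" using f1(2) by simp
  qed
  then have "card ((*) f ` monics (n - ?d)) \<le> card {F \<in> monics n. f dvd F}"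
    by (intro card_mono) auto
  moreover have "card ((*) f ` monics (n - ?d)) = CARD('a) ^ (n - ?d)"
    using f1(3) by (subst card_image) (auto simp: inj_on_def card_monics)
  ultimately have "real (CARD('a) ^ (n - ?d)) \<le> real (card {F \<in> monics n. f dvd F})"
    by (simp only: of_nat_le_iff)
  moreover have "real (card (monics n :: 'a poly set)) * (1 / real CARD('a) ^ ?d) = real (CARD('a) ^ (n - ?d))"
    using f1(2) by (simp only: card_monics of_nat_power) (simp add: power_diff)
  ultimately show "real (card (monics n :: 'a poly set)) * (1 / real CARD('a) ^ ?d)
      \<le> real (card {F \<in> monics n. f dvd F})" by linarith
qed auto

text \<open>Counted with multiplicity, the degrees of the factors add up to exactly
  \<open>n\<close>. The mean multiplicity of \<open>f\<close> over \<open>monics n\<close> is at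
  most the sum of q^(-d(j+1)) over all j, which is 1/(q^d - 1). Together with
  \<open>sum_irreds_le\<close> this is an averaged prime number theorem that needs no exact count of
  irreducible polynomials.\<close>

lemma sum_irreds_ge:
  "real n \<le> (\<Sum>f\<in>(irreds n :: 'a::{finite,field} poly set). real (degree f) * (1 / (real CARD('a) ^ degree f - 1)))"
proof -
  let ?q = "real CARD('a)"
  let ?I = "irreds n :: 'a poly set"
  let ?M = "monics n :: 'a poly set"
  have q: "1 < ?q" using one_less_CARD_field[where 'a = 'a] by simp
  have "?q ^ n * real n = (\<Sum>F\<in>?M. real n)" by (simp add: card_monics)
  also have "\<dots> = (\<Sum>F\<in>?M. \<Sum>f\<in>?I. real (degree f * multiplicity_in f F))"
  proof (rule sum.cong)
    fix F :: "'a poly" assume "F \<in> monics n"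
    then have "lead_coeff F = 1" "degree F \<le> n" "degree F = n" by (auto simp: monics_def)
    then show "real n = (\<Sum>f\<in>?I. real (degree f * multiplicity_in f F))"
      using degree_eq_sum_multiplicity[of F n] by (simp flip: of_nat_sum del: of_nat_mult)
  qed simp
  also have "\<dots> \<le> (\<Sum>F\<in>?M. \<Sum>f\<in>?I. \<Sum>j<n. real (degree f) * (if f ^ Suc j dvd F then 1 else 0))"
  proof (intro sum_mono)
    fix F f :: "'a poly" assume F: "F \<in> monics n" and f: "f \<in> irreds n"
    have "multiplicity_in f F \<le> (\<Sum>j<n. if f ^ Suc j dvd F then 1 else 0)"
      using F by (intro multiplicity_in_le_sum[OF _ _ f]) (auto simp: monics_def)
    then have "real (multiplicity_in f F) \<le> real (\<Sum>j<n. if f ^ Suc j dvd F then 1 else 0)"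
      by (simp only: of_nat_le_iff)
    also have "\<dots> = (\<Sum>j<n. if f ^ Suc j dvd F then 1 else 0)"
      unfolding of_nat_sum by (intro sum.cong) auto
    finally show "real (degree f * multiplicity_in f F)
        \<le> (\<Sum>j<n. real (degree f) * (if f ^ Suc j dvd F then 1 else 0))"
      by (simp only: of_nat_mult flip: sum_distrib_left) (intro mult_left_mono, auto)
  qed
  also have "\<dots> = (\<Sum>f\<in>?I. \<Sum>j<n. \<Sum>F\<in>?M. real (degree f) * (if f ^ Suc j dvd F then 1 else 0))"
    by (subst sum.swap) (intro sum.cong refl sum.swap)
  also have "\<dots> = (\<Sum>f\<in>?I. \<Sum>j<n. real (degree f) * real (card {F \<in> ?M. f ^ Suc j dvd F}))"
    by (simp add: sum_distrib_left[symmetric] sum.inter_filter[symmetric] del: power_Suc)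
  also have "\<dots> \<le> (\<Sum>f\<in>?I. real (degree f) * (?q ^ n * (1 / (?q ^ degree f - 1))))"
  proof (intro sum_mono)
    fix f :: "'a poly" assume f: "f \<in> irreds n"
    define Q where "Q = ?q ^ degree f"
    have Q1: "1 < Q" unfolding Q_def using q irreds_degree_pos[OF f] by (rule one_less_power)
    have f0: "f \<noteq> 0" using f by (auto simp: irreds_def)
    have "real (card {F \<in> ?M. f ^ Suc j dvd F}) \<le> ?q ^ n / Q * (1 / Q ^ j)" for j
    proof -
      have "lead_coeff (f ^ Suc j) = 1" using f by (simp add: irreds_def lead_coeff_mult lead_coeff_power)
      then have "real (card {F \<in> ?M. f ^ Suc j dvd F}) \<le> ?q ^ n / ?q ^ degree (f ^ Suc j)"
        by (rule card_monic_multiples_le)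
      also have "?q ^ degree (f ^ Suc j) = Q * Q ^ j"
        unfolding degree_power_eq[OF f0] Q_def by (simp add: power_mult[symmetric] power_add mult.commute)
      finally show ?thesis by simp
    qed
    then have "(\<Sum>j<n. real (degree f) * real (card {F \<in> ?M. f ^ Suc j dvd F}))
        \<le> (\<Sum>j<n. real (degree f) * (?q ^ n / Q * (1 / Q ^ j)))"
      by (intro sum_mono mult_left_mono) auto
    also have "\<dots> = real (degree f) * (?q ^ n / Q * (\<Sum>j<n. 1 / Q ^ j))"
      by (simp only: sum_distrib_left)
    also have "\<dots> \<le> real (degree f) * (?q ^ n / Q * (Q / (Q - 1)))"
      using Q1 q by (intro mult_left_mono sum_geometric_le) auto
    also have "\<dots> = real (degree f) * (?q ^ n * (1 / (?q ^ degree f - 1)))"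
      using Q1 by (simp add: Q_def)
    finally show "(\<Sum>j<n. real (degree f) * real (card {F \<in> ?M. f ^ Suc j dvd F}))
        \<le> real (degree f) * (?q ^ n * (1 / (?q ^ degree f - 1)))" .
  qed
  also have "\<dots> = ?q ^ n * (\<Sum>f\<in>?I. real (degree f) * (1 / (?q ^ degree f - 1)))"
    unfolding sum_distrib_left by (intro sum.cong refl) (simp add: mult.left_commute)
  finally show ?thesis using q by simp
qed

section \<open>Palindromic polynomials and duality\<close>

lemma palindromics_eq_iff:
  "F \<in> palindromics e \<longleftrightarrow> F \<in> monics (2 * e) \<and> (\<forall>i\<le>2 * e. coeff F (2 * e - i) = coeff F i)"
proof (cases "F \<in> monics (2 * e)")
  case True
  then have d: "degree F = 2 * e" by (simp add: monics_def)
  have "reflect_poly F = F \<longleftrightarrow> (\<forall>i\<le>2 * e. coeff F (2 * e - i) = coeff F i)"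
    by (auto simp: poly_eq_iff coeff_reflect_poly d coeff_eq_0)
  with True show ?thesis unfolding palindromics_def by blast
qed (simp add: palindromics_def)

lemma card_palindromics: "card (palindromics e :: 'a::{finite,field} poly set) = CARD('a) ^ e"
proof -
  \<comment> \<open>\<open>c\<close> lists the independent coefficients, starting with the constant
    one, which equals the leading coefficient 1. The index \<open>min i (2 * e - i)\<close> folds
    the upper half of the coefficients onto the lower half.\<close>
  define c where "c u i = (if i = 0 then 1 else u $ (i - 1))" for u :: "'a vec" and i
  define G where "G u = vpoly (vec (2 * e + 1) (\<lambda>i. c u (min i (2 * e - i))))" for u
  have Gi: "coeff (G u) i = (if i \<le> 2 * e then c u (min i (2 * e - i)) else 0)" for u i
    by (simp add: G_def coeff_vpoly)
  have "bij_betw (\<lambda>F. vec e (\<lambda>i. coeff F (Suc i))) (palindromics e) (carrier_vec e :: 'a vec set)"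
  proof (rule bij_betwI[where g = G])
    show "G \<in> carrier_vec e \<rightarrow> palindromics e"
    proof
      fix u :: "'a vec"
      have "degree (G u) \<le> 2 * e" by (rule degree_le) (simp add: Gi)
      moreover have top: "coeff (G u) (2 * e) = 1" by (simp add: Gi c_def)
      then have "2 * e \<le> degree (G u)" by (intro le_degree) simp
      ultimately have "degree (G u) = 2 * e" by simp
      then have "G u \<in> monics (2 * e)" using top by (simp add: monics_def)
      then show "G u \<in> palindromics e"
        unfolding palindromics_eq_iff by (auto simp: Gi min.commute)
    qed
    show "vec e (\<lambda>i. coeff (G u) (Suc i)) = u" if "u \<in> carrier_vec e" for u
      using that by (intro eq_vecI) (auto simp: Gi c_def min_def)
    show "G (vec e (\<lambda>i. coeff F (Suc i))) = F" if F: "F \<in> palindromics e" for F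
    proof -
      have m: "coeff F (2 * e) = 1" "degree F = 2 * e" using F by (auto simp: palindromics_def monics_def)
      have sym: "coeff F i = coeff F (2 * e - i)" if "i \<le> 2 * e" for i
        using F that unfolding palindromics_eq_iff by metis
      have cF: "c (vec e (\<lambda>i. coeff F (Suc i))) i = coeff F i" if "i \<le> e" for i
        using that sym[of 0] m(1) by (auto simp: c_def)
      have "coeff (G (vec e (\<lambda>i. coeff F (Suc i)))) i = coeff F i" for i
      proof (cases "i \<le> 2 * e")
        case True
        then have "min i (2 * e - i) \<le> e" by linarith
        then have "coeff (G (vec e (\<lambda>i. coeff F (Suc i)))) i = coeff F (min i (2 * e - i))"
          using True by (simp add: Gi cF)
        also have "\<dots> = coeff F i" by (cases "i \<le> 2 * e - i") (simp_all add: min_def flip: sym[OF True])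
        finally show ?thesis .
      qed (simp add: Gi m coeff_eq_0)
      then show ?thesis by (simp add: poly_eq_iff)
    qed
  qed simp
  then show ?thesis by (simp add: bij_betw_same_card card_carrier_vec)
qed

lemma finite_palindromics [simp]: "finite (palindromics n :: 'a::{finite,field} poly set)"
  by (rule finite_subset[of _ "monics (2 * n)"]) (auto simp: palindromics_def)

text \<open>Multiplying \<open>h\<close> by palindromic polynomials keeps the product palindromic.
  The witness \<open>h\<close> will be \<open>f\<close> itself if \<open>f\<close> is self-dual, and
  otherwise the product of \<open>f\<close> with its dual.\<close>

lemma card_palindromic_multiples_ge:
  fixes h :: "'a::{finite,field} poly"
  assumes h: "h \<in> palindromics k" and f: "f dvd h" and k: "k \<le> n"
  shows "real (card (palindromics n :: 'a poly set)) * (1 / real CARD('a) ^ k)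
    \<le> real (card {F \<in> palindromics n. f dvd F})"
proof -
  have h1: "lead_coeff h = 1" "degree h = 2 * k" "reflect_poly h = h" "h \<noteq> 0"
    using h by (auto simp: palindromics_def monics_def)
  have "(*) h ` palindromics (n - k) \<subseteq> {F \<in> palindromics n. f dvd F}"
  proof (intro image_subsetI)
    fix G :: "'a poly" assume G: "G \<in> palindromics (n - k)"
    then have "h * G \<in> monics (2 * k + 2 * (n - k))"
      using h by (intro monics_mult) (simp_all add: palindromics_def)
    moreover have "2 * k + 2 * (n - k) = 2 * n" using k by simp
    ultimately show "h * G \<in> {F \<in> palindromics n. f dvd F}"
      using h1(3) G f by (simp add: palindromics_def reflect_poly_mult)
  qed
  then have "card ((*) h ` palindromics (n - k)) \<le> card {F \<in> palindromics n. f dvd F}"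
    by (intro card_mono) auto
  moreover have "card ((*) h ` palindromics (n - k)) = CARD('a) ^ (n - k)"
    using h1(4) by (subst card_image) (auto simp: inj_on_def card_palindromics)
  ultimately have "real (CARD('a) ^ (n - k)) \<le> real (card {F \<in> palindromics n. f dvd F})"
    by (simp only: of_nat_le_iff)
  moreover have "real (card (palindromics n :: 'a poly set)) * (1 / real CARD('a) ^ k) = real (CARD('a) ^ (n - k))"
    using k by (simp only: card_palindromics of_nat_power) (simp add: power_diff)
  ultimately show ?thesis by linarith
qed

lemma irreducible_no_root:
  fixes f :: "'a::field poly"
  assumes f: "irreducible f" "2 \<le> degree f"
  shows "poly f a \<noteq> 0"
proof
  assume "poly f a = 0"
  then obtain h where h: "f = [:- a, 1:] * h" unfolding poly_eq_0_iff_dvd by (elim dvdE)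
  have "\<not> is_unit [:- a, 1:]" by (simp add: is_unit_iff_degree)
  then have "is_unit h" using irreducibleD[OF f(1) h] by blast
  then have "h \<noteq> 0" "degree h = 0" using is_unit_iff_degree[of h] by auto
  then have "degree f = 1" unfolding h by (subst degree_mult_eq) auto
  with f(2) show False by simp
qed

text \<open>By degrees the reflection is \<open>c\<close> times \<open>f\<close>, that is, x^d
  f(1/x) = c f(x). At x = 1 this gives c = 1, at x = -1 it gives (-1)^d = 1, since an irreducible
  polynomial of degree at least 2 has no roots. Odd characteristic separates -1 from 1, so d is
  even.\<close>

lemma self_dual_palindromic:
  fixes f :: "'a::field poly"
  assumes two: "(2 :: 'a) \<noteq> 0" and f: "irreducible f" "lead_coeff f = 1" "2 \<le> degree f"
    and sd: "f dvd reflect_poly f"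
  shows "f \<in> palindromics (degree f div 2)" "even (degree f)"
proof -
  have c0: "coeff f 0 \<noteq> 0" using irreducible_no_root[OF f(1,3), of 0] by (simp add: poly_0_coeff_0)
  obtain h where h: "reflect_poly f = f * h" using sd by (elim dvdE)
  have nz: "reflect_poly f \<noteq> 0" "f \<noteq> 0" "h \<noteq> 0" using f(2) h by auto
  have "degree (reflect_poly f) = degree f" using c0 by simp
  then have "degree h = 0" using h nz by (simp add: degree_mult_eq)
  then obtain c where c: "h = [:c:]" by (rule degree_eq_zeroE)
  have val: "x ^ degree f * poly f (inverse x) = poly f x * c" if "x \<noteq> 0" for x
    using arg_cong[OF h, of "\<lambda>p. poly p x"] poly_reflect_poly_nz[OF that, of f] c by simp
  have "poly f 1 = poly f 1 * c" using val[of 1] by simp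
  then have c1: "c = 1" using irreducible_no_root[OF f(1,3), of 1] by simp
  have "(- 1) ^ degree f * poly f (- 1) = poly f (- 1)"
    using val[of "- 1"] c1 by simp
  then have "(- 1 :: 'a) ^ degree f = 1" using irreducible_no_root[OF f(1,3), of "- 1"] by simp
  moreover have "(- 1 :: 'a) \<noteq> 1"
  proof
    assume "(- 1 :: 'a) = 1"
    then have "(1 :: 'a) + 1 = 0" by (metis add.right_inverse)
    then show False using two by simp
  qed
  ultimately show ev: "even (degree f)" by (metis minus_one_power_iff)
  have "reflect_poly f = f" using h c c1 by simp
  then show "f \<in> palindromics (degree f div 2)" using ev f(2) by (simp add: palindromics_def monics_def)
qed

text \<open>Reflection interchanges the two factors up to the scalar; dividing by the constant
  coefficient makes the product monic.\<close>

lemma norm_palindromic: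
  fixes f :: "'a::field poly"
  assumes f: "lead_coeff f = 1" and c0: "coeff f 0 \<noteq> 0"
  shows "f * Polynomial.smult (inverse (coeff f 0)) (reflect_poly f) \<in> palindromics (degree f)"
proof -
  let ?c = "inverse (coeff f 0)"
  have nz: "f \<noteq> 0" "reflect_poly f \<noteq> 0" "?c \<noteq> 0" using f c0 by auto
  have "lead_coeff (reflect_poly f) = coeff f 0" using c0 by (simp add: coeff_reflect_poly)
  then have "lead_coeff (f * Polynomial.smult ?c (reflect_poly f)) = 1"
    using f c0 by (simp only: lead_coeff_mult lead_coeff_smult) simp
  moreover have "degree (f * Polynomial.smult ?c (reflect_poly f)) = 2 * degree f"
    using nz c0 by (simp add: degree_mult_eq)
  moreover have "reflect_poly (f * Polynomial.smult ?c (reflect_poly f)) = f * Polynomial.smult ?c (reflect_poly f)"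
    using c0 by (simp add: reflect_poly_mult reflect_poly_smult mult.commute)
  ultimately show ?thesis by (simp add: palindromics_def monics_def)
qed

section \<open>Asymptotics\<close>

lemma harm_minus_ln_bounds:
  assumes "0 < n"
  shows "\<bar>harm n - ln (real n)\<bar> \<le> 1"
proof -
  obtain m where m: "n = Suc m" using assms by (cases n) auto
  have "harm (Suc m) - ln (real (Suc m)) \<le> harm (Suc 0) - ln (real (Suc 0))"
    using decseqD[OF decseq_harm_diff_ln, of 0 m] by simp
  then have "harm n - ln (real n) \<le> 1" by (simp add: m harm_expand)
  moreover have "ln (real n) \<le> ln (real n + 1)" using assms by simp
  then have "ln (real n) \<le> harm n" using ln_le_harm[of n] by linarith
  ultimately show ?thesis by simp
qed

text \<open>Partial summation with the error \<open>e n\<close>. The weights 1/d - 1/(d+1) sum to 1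
  - 1/(n+1), and the boundary term carries the missing 1/(n+1), so the constant \<open>C\<close> is
  preserved exactly.\<close>

lemma abel_harmonic:
  fixes A :: "nat \<Rightarrow> real"
  assumes "\<And>n. \<bar>(\<Sum>d=1..n. A d) - real n\<bar> \<le> C"
  shows "\<bar>(\<Sum>d=1..n. A d / real d) - harm n\<bar> \<le> C"
proof -
  define e where "e n = (\<Sum>d=1..n. A d) - real n" for n
  have eC: "\<bar>e n\<bar> \<le> C" for n using assms by (simp add: e_def)
  define r where "r d = 1 / real d - 1 / (real d + 1)" for d :: nat
  have r: "0 \<le> r d" if "1 \<le> d" for d using that by (simp add: r_def frac_le)
  have rsum: "(\<Sum>d=1..n. r d) = 1 - 1 / (real n + 1)" for n
    by (induction n) (simp_all add: r_def)
  have "(\<Sum>d=1..n. A d / real d) - harm n = e n / (real n + 1) + (\<Sum>d=1..n. e d * r d)" for n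
  proof (induction n)
    case (Suc n)
    have "A (Suc n) = e (Suc n) - e n + 1" by (simp add: e_def)
    then have "A (Suc n) / real (Suc n) - inverse (real (Suc n)) = (e (Suc n) - e n) / (real n + 1)"
      by (simp add: add_divide_distrib inverse_eq_divide add.commute)
    moreover have "e (Suc n) * r (Suc n) = e (Suc n) / (real n + 1) - e (Suc n) / (real (Suc n) + 1)"
      by (simp add: r_def right_diff_distrib add.commute)
    ultimately show ?case using Suc by (simp add: harm_Suc diff_divide_distrib)
  qed (simp add: e_def harm_expand)
  then have "\<bar>(\<Sum>d=1..n. A d / real d) - harm n\<bar> \<le> \<bar>e n / (real n + 1)\<bar> + \<bar>\<Sum>d=1..n. e d * r d\<bar>"
    by (simp only: abs_triangle_ineq)
  also have "\<bar>e n / (real n + 1)\<bar> = \<bar>e n\<bar> / (real n + 1)" by simp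
  also have "\<bar>\<Sum>d=1..n. e d * r d\<bar> \<le> (\<Sum>d=1..n. \<bar>e d * r d\<bar>)" by (rule sum_abs)
  also have "(\<Sum>d=1..n. \<bar>e d * r d\<bar>) = (\<Sum>d=1..n. \<bar>e d\<bar> * r d)"
    using r by (intro sum.cong) (auto simp: abs_mult)
  finally have "\<bar>(\<Sum>d=1..n. A d / real d) - harm n\<bar> \<le> \<bar>e n\<bar> / (real n + 1) + (\<Sum>d=1..n. \<bar>e d\<bar> * r d)"
    by simp
  also have "\<dots> \<le> C / (real n + 1) + (\<Sum>d=1..n. C * r d)"
    using eC r by (intro add_mono divide_right_mono sum_mono mult_right_mono) auto
  also have "\<dots> = C"
    unfolding sum_distrib_left[symmetric] rsum by (simp add: right_diff_distrib)
  finally show ?thesis .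
qed

lemma sum_half_power_le: "(\<Sum>d\<le>n. real d / 2 ^ d) \<le> 2"
proof -
  have "(\<Sum>d\<le>n. real d / 2 ^ d) = 2 - (real n + 2) / 2 ^ n"
    by (induction n) (simp_all add: field_simps)
  then show ?thesis by simp
qed

lemma sum_fibres:
  fixes h :: "nat \<Rightarrow> real"
  assumes "finite X" "finite T" "s ` X \<subseteq> T"
  shows "(\<Sum>f\<in>X. h (s f)) = (\<Sum>d\<in>T. real (card {f \<in> X. s f = d}) * h d)"
proof -
  have "(\<Sum>f\<in>X. h (s f)) = (\<Sum>d\<in>T. \<Sum>f | f \<in> X \<and> s f = d. h (s f))"
    by (rule sum.group[OF assms, symmetric])
  also have "\<dots> = (\<Sum>d\<in>T. real (card {f \<in> X. s f = d}) * h d)"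
    by (intro sum.cong) auto
  finally show ?thesis .
qed

text \<open>At most q^d elements have size d, which reduces the sum to that of d/q^d. It bounds all
  second-order errors uniformly in the cut-off, with \<open>s\<close> the degree for non-self-dual
  and half the degree for self-dual polynomials.\<close>

lemma sum_inverse_square_le:
  fixes X :: "'a::{finite,field} poly set" and s :: "'a poly \<Rightarrow> nat"
  assumes X: "finite X" and c: "\<And>d. card {f \<in> X. s f = d} \<le> CARD('a) ^ d"
  shows "(\<Sum>f\<in>X. real (s f) / real CARD('a) ^ (2 * s f)) \<le> 2"
proof -
  let ?q = "real CARD('a)"
  have q: "2 \<le> ?q" using one_less_CARD_field[where 'a = 'a] by simp
  obtain n where n: "s ` X \<subseteq> {..n}"
    using X by (metis finite_imageI finite_nat_iff_bounded_le)
  have "(\<Sum>f\<in>X. real (s f) / ?q ^ (2 * s f))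
      = (\<Sum>d\<le>n. real (card {f \<in> X. s f = d}) * (real d / ?q ^ (2 * d)))"
    by (rule sum_fibres[OF X _ n]) simp
  also have "\<dots> \<le> (\<Sum>d\<le>n. real d / 2 ^ d)"
  proof (intro sum_mono)
    fix d
    have "real (card {f \<in> X. s f = d}) \<le> real (CARD('a) ^ d)" using c by (simp only: of_nat_le_iff)
    then have "real (card {f \<in> X. s f = d}) * (real d / ?q ^ (2 * d)) \<le> ?q ^ d * (real d / ?q ^ (2 * d))"
      by (intro mult_right_mono) simp_all
    also have "\<dots> = real d / ?q ^ d" using q by (simp add: mult_2 power_add)
    also have "\<dots> \<le> real d / 2 ^ d"
      using q by (intro divide_left_mono power_mono) simp_all
    finally show "real (card {f \<in> X. s f = d}) * (real d / ?q ^ (2 * d)) \<le> real d / 2 ^ d" .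
  qed
  also have "\<dots> \<le> 2" by (rule sum_half_power_le)
  finally show ?thesis .
qed

text \<open>Degree one is set apart because X - 1 and X + 1 are self-dual of odd degree; there are
  so few linear polynomials that a crude bound is enough.\<close>

definition linear_irreds :: "nat \<Rightarrow> 'a::field poly set" where
  "linear_irreds n = {f \<in> irreds n. degree f < 2}"

text \<open>For dimension \<open>2 * n\<close> the index \<open>n\<close> is the natural cut-off
  here: above it the mean multiplicity is zero, since an isotropic subspace fills at most half the
  space. Self-dual factors can have any degree up to \<open>2 * n\<close>, hence the different bound
  in \<open>selfdual_irreds\<close>.\<close>

definition nonselfdual_irreds :: "nat \<Rightarrow> 'a::field poly set" where
  "nonselfdual_irreds n = {f \<in> irreds n. 2 \<le> degree f \<and> \<not> f dvd reflect_poly f}"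

definition selfdual_irreds :: "nat \<Rightarrow> 'a::field poly set" where
  "selfdual_irreds n = {f \<in> irreds (2 * n). 2 \<le> degree f \<and> f dvd reflect_poly f}"

lemma finite_irred_classes [simp]:
  "finite (linear_irreds n :: 'a::{finite,field} poly set)"
  "finite (nonselfdual_irreds n :: 'a::{finite,field} poly set)"
  "finite (selfdual_irreds n :: 'a::{finite,field} poly set)"
  by (simp_all add: linear_irreds_def nonselfdual_irreds_def selfdual_irreds_def)

lemma sum_irred_classes:
  fixes g :: "'a::{finite,field} poly \<Rightarrow> real"
  shows "(\<Sum>f\<in>irreds m. g f) = (\<Sum>f\<in>linear_irreds m. g f) + (\<Sum>f\<in>nonselfdual_irreds m. g f)
    + (\<Sum>f\<in>{f \<in> irreds m. 2 \<le> degree f \<and> f dvd reflect_poly f}. g f)"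
proof -
  let ?S = "{f \<in> irreds m. 2 \<le> degree f \<and> f dvd reflect_poly f} :: 'a poly set"
  have "irreds m = (linear_irreds m \<union> nonselfdual_irreds m) \<union> ?S"
    by (auto simp: linear_irreds_def nonselfdual_irreds_def)
  moreover have "sum g ((linear_irreds m \<union> nonselfdual_irreds m) \<union> ?S)
      = sum g (linear_irreds m \<union> nonselfdual_irreds m) + sum g ?S"
    by (rule sum.union_disjoint) (auto simp: linear_irreds_def nonselfdual_irreds_def)
  moreover have "sum g (linear_irreds m \<union> nonselfdual_irreds m)
      = sum g (linear_irreds m) + sum g (nonselfdual_irreds m)"
    by (rule sum.union_disjoint) (auto simp: linear_irreds_def nonselfdual_irreds_def)
  ultimately show ?thesis by simp
qed

lemma degree_linear_irreds: "f \<in> linear_irreds n \<Longrightarrow> degree f = 1"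
  using irreds_degree_pos[of f n] by (auto simp: linear_irreds_def)

lemma card_linear_irreds: "card (linear_irreds n :: 'a::{finite,field} poly set) \<le> CARD('a)"
proof -
  have "linear_irreds n \<subseteq> (monics 1 :: 'a poly set)"
    using degree_linear_irreds by (auto simp: monics_def linear_irreds_def irreds_def)
  then have "card (linear_irreds n :: 'a poly set) \<le> card (monics 1 :: 'a poly set)"
    by (intro card_mono) auto
  then show ?thesis by (simp add: card_monics)
qed

lemma sum_nonselfdual_inverse_square_le:
  "(\<Sum>f\<in>(nonselfdual_irreds n :: 'a::{finite,field} poly set). real (degree f) / real CARD('a) ^ (2 * degree f)) \<le> 2"
proof (rule sum_inverse_square_le)
  fix d
  have "card {f \<in> (nonselfdual_irreds n :: 'a poly set). degree f = d} \<le> card (monics d :: 'a poly set)"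
    by (rule card_mono[OF finite_monics]) (auto simp: nonselfdual_irreds_def irreds_def monics_def)
  then show "card {f \<in> (nonselfdual_irreds n :: 'a poly set). degree f = d} \<le> CARD('a) ^ d"
    by (simp add: card_monics)
qed simp

text \<open>At most \<open>q\<close> linear polynomials, each with the mean bound of
  \<open>mean_multiplicity_half\<close> at y = sqrt q.\<close>

definition linear_bound :: "real \<Rightarrow> real" where
  "linear_bound q = q * (q / ((q - 1) * (sqrt q - 1)))"

context
  fixes ty :: "'a::{finite,field} itself" and q :: real
  assumes two: "(2 :: 'a) \<noteq> 0"
  defines "q \<equiv> real CARD('a)"
begin

lemma q_ge_2: "2 \<le> q"
  using one_less_CARD_field[where 'a = 'a] by (simp add: q_def)

lemma selfdual_irredsD:
  assumes "(f :: 'a poly) \<in> selfdual_irreds n"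
  shows "f \<in> palindromics (degree f div 2)" "degree f = 2 * (degree f div 2)"
    "1 \<le> degree f div 2" "degree f div 2 \<le> n" "irreducible f" "lead_coeff f = 1"
  using self_dual_palindromic[OF two, of f] assms by (auto simp: selfdual_irreds_def irreds_def)

lemma sum_selfdual_inverse_square_le:
  "(\<Sum>f\<in>(selfdual_irreds n :: 'a poly set). real (degree f div 2) / q ^ (2 * (degree f div 2))) \<le> 2"
  unfolding q_def
proof (rule sum_inverse_square_le)
  fix k
  have "card {f \<in> (selfdual_irreds n :: 'a poly set). degree f div 2 = k} \<le> card (palindromics k :: 'a poly set)"
    by (intro card_mono) (use selfdual_irredsD(1) in auto)
  then show "card {f \<in> (selfdual_irreds n :: 'a poly set). degree f div 2 = k} \<le> CARD('a) ^ k"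
    by (simp add: card_palindromics)
qed simp

section \<open>Degree-weighted main terms\<close>

definition "wt_nonselfdual n = (\<Sum>f\<in>(nonselfdual_irreds n :: 'a poly set). real (degree f) / q ^ degree f)"

definition "wt_selfdual n =
  (\<Sum>f\<in>(selfdual_irreds n :: 'a poly set). real (degree f) / q ^ (degree f div 2))"

lemma wt_nonselfdual_le: "wt_nonselfdual n \<le> real n"
proof -
  have "wt_nonselfdual n \<le> (\<Sum>f\<in>(irreds n :: 'a poly set). real (degree f) / q ^ degree f)"
    unfolding wt_nonselfdual_def using q_ge_2
    by (intro sum_mono2) (auto simp: nonselfdual_irreds_def)
  also have "\<dots> \<le> real n" using sum_irreds_le[of n, where 'a = 'a] by (simp add: q_def)
  finally show ?thesis .
qed

lemma inverse_minus_one_le: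
  fixes Q :: real
  assumes "2 \<le> Q"
  shows "1 / (Q - 1) \<le> 1 / Q + 2 / Q ^ 2"
proof -
  have "Q ^ 2 \<le> (Q + 2) * (Q - 1)" using assms by (simp add: algebra_simps power2_eq_square)
  then have "Q ^ 2 / (Q - 1) / Q ^ 2 \<le> (Q + 2) / Q ^ 2"
    using assms by (intro divide_right_mono) (simp_all add: pos_divide_le_eq)
  then show ?thesis using assms by (simp add: add_divide_distrib power2_eq_square)
qed

lemma q_power_ge_2: "1 \<le> d \<Longrightarrow> 2 \<le> q ^ d"
  using power_increasing[of 1 d q] q_ge_2 by simp

text \<open>In the sum of \<open>sum_irreds_ge\<close> the linear polynomials account for at most 2,
  passing from 1/(Q - 1) to 1/Q costs at most 4, and the self-dual ones contribute at most 8,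
  because they are sparse and carry the weight 1/Q here, not its square root. This gives 14.\<close>

lemma wt_nonselfdual_ge: "real n - 14 \<le> wt_nonselfdual n"
proof -
  let ?A = "nonselfdual_irreds n :: 'a poly set"
  let ?g = "\<lambda>f :: 'a poly. real (degree f) * (1 / (q ^ degree f - 1))"
  let ?S = "{f \<in> irreds n. 2 \<le> degree f \<and> f dvd reflect_poly f} :: 'a poly set"
  have g0: "0 \<le> ?g f" for f
    using q_ge_2 one_le_power[of q "degree f"] by simp
  have "(\<Sum>f\<in>linear_irreds n. ?g f) \<le> 2"
  proof -
    have "(\<Sum>f\<in>linear_irreds n. ?g f) = (\<Sum>f\<in>(linear_irreds n :: 'a poly set). 1 / (q - 1))"
      by (intro sum.cong) (auto simp: degree_linear_irreds)
    also have "\<dots> = real (card (linear_irreds n :: 'a poly set)) / (q - 1)" by simp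
    also have "\<dots> \<le> q / (q - 1)"
      using card_linear_irreds[of n, where 'a = 'a] q_ge_2 unfolding q_def
      by (intro divide_right_mono) auto
    also have "\<dots> \<le> 2" using q_ge_2 by (simp add: pos_divide_le_eq)
    finally show ?thesis .
  qed
  moreover have "(\<Sum>f\<in>nonselfdual_irreds n. ?g f) \<le> wt_nonselfdual n + 4"
  proof -
    have "(\<Sum>f\<in>nonselfdual_irreds n. ?g f)
        \<le> (\<Sum>f\<in>?A. real (degree f) / q ^ degree f + 2 * (real (degree f) / q ^ (2 * degree f)))"
    proof (intro sum_mono)
      fix f :: "'a poly" assume "f \<in> nonselfdual_irreds n"
      then have "1 \<le> degree f" by (simp add: nonselfdual_irreds_def)
      from inverse_minus_one_le[OF q_power_ge_2[OF this]]
      have "?g f \<le> real (degree f) * (1 / q ^ degree f + 2 / (q ^ degree f) ^ 2)"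
        by (intro mult_left_mono) simp_all
      then show "?g f \<le> real (degree f) / q ^ degree f + 2 * (real (degree f) / q ^ (2 * degree f))"
        by (simp add: distrib_left power_mult[symmetric] mult.commute)
    qed
    also have "\<dots> \<le> wt_nonselfdual n + 2 * 2"
      unfolding sum.distrib sum_distrib_left[symmetric] wt_nonselfdual_def
      using sum_nonselfdual_inverse_square_le[of n, where 'a = 'a]
      by (intro add_left_mono mult_left_mono) (simp_all add: q_def)
    finally show ?thesis by simp
  qed
  moreover have "(\<Sum>f\<in>?S. ?g f) \<le> 8"
  proof -
    have "(\<Sum>f\<in>?S. ?g f) \<le> (\<Sum>f\<in>selfdual_irreds n. ?g f)"
    proof (rule sum_mono2)
      show "?S \<subseteq> selfdual_irreds n" by (auto simp: selfdual_irreds_def irreds_def)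
    qed (use g0 in simp_all)
    also have "\<dots> \<le> (\<Sum>f\<in>(selfdual_irreds n :: 'a poly set). 4 * (real (degree f div 2) / q ^ (2 * (degree f div 2))))"
    proof (intro sum_mono)
      fix f :: "'a poly" assume f: "f \<in> selfdual_irreds n"
      define k where "k = degree f div 2"
      have k: "degree f = 2 * k" "1 \<le> k" using selfdual_irredsD[OF f] by (auto simp: k_def)
      have Q: "2 \<le> q ^ (2 * k)" using k by (intro q_power_ge_2) simp
      then have "1 / (q ^ (2 * k) - 1) \<le> 2 / q ^ (2 * k)" by (simp add: field_simps)
      then have "real (2 * k) * (1 / (q ^ (2 * k) - 1)) \<le> real (2 * k) * (2 / q ^ (2 * k))"
        by (intro mult_left_mono) auto
      then show "?g f \<le> 4 * (real (degree f div 2) / q ^ (2 * (degree f div 2)))"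
        by (simp add: k)
    qed
    also have "\<dots> \<le> 4 * 2"
      unfolding sum_distrib_left[symmetric] by (intro mult_left_mono sum_selfdual_inverse_square_le) simp
    finally show ?thesis by simp
  qed
  moreover have "real n \<le> (\<Sum>f\<in>irreds n. ?g f)"
    using sum_irreds_ge[of n, where 'a = 'a] by (simp add: q_def)
  ultimately show ?thesis unfolding sum_irred_classes by linarith
qed

lemma wt_sum_le: "wt_nonselfdual n + wt_selfdual n \<le> 2 * real n"
proof -
  let ?A = "nonselfdual_irreds n :: 'a poly set" and ?B = "selfdual_irreds n :: 'a poly set"
  \<comment> \<open>A lower bound for the proportion of palindromic polynomials divisible by
    \<open>f\<close>: a self-dual \<open>f\<close> of degree 2k costs k free coefficients, while any
    other \<open>f\<close> comes with its dual, and the product of half-degree d costs d.\<close>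
  let ?p = "\<lambda>f :: 'a poly. if f dvd reflect_poly f then 1 / q ^ (degree f div 2) else 1 / q ^ degree f"
  have "(\<Sum>f\<in>?A \<union> ?B. real (degree f) * ?p f) \<le> real (2 * n)"
  proof (rule divisor_average[of "palindromics n"])
    show "(palindromics n :: 'a poly set) \<noteq> {}"
      using card_palindromics[of n, where 'a = 'a]
      by (metis card.empty power_eq_0_iff zero_less_card_finite less_irrefl)
    show "palindromics n \<subseteq> (monics (2 * n) :: 'a poly set)" by (auto simp: palindromics_def)
    show "?A \<union> ?B \<subseteq> irreds (2 * n)"
      by (auto simp: nonselfdual_irreds_def selfdual_irreds_def irreds_def)
    fix f assume f: "f \<in> ?A \<union> ?B"
    show "real (card (palindromics n :: 'a poly set)) * ?p f \<le> real (card {F \<in> palindromics n. f dvd F})"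
    proof (cases "f dvd reflect_poly f")
      case True
      then have "f \<in> selfdual_irreds n" using f by (auto simp: nonselfdual_irreds_def)
      note D = selfdual_irredsD[OF this]
      show ?thesis using True card_palindromic_multiples_ge[OF D(1) dvd_refl D(4)] by (simp add: q_def)
    next
      case False
      then have f': "irreducible f" "lead_coeff f = 1" "2 \<le> degree f" "degree f \<le> n"
        using f by (auto simp: nonselfdual_irreds_def selfdual_irreds_def irreds_def)
      have "coeff f 0 \<noteq> 0" using irreducible_no_root[OF f'(1,3), of 0] by (simp add: poly_0_coeff_0)
      from card_palindromic_multiples_ge[OF norm_palindromic[OF f'(2) this] dvd_triv_left f'(4)]
      show ?thesis using False by (simp add: q_def)
    qed
  qed auto
  also have "(\<Sum>f\<in>?A \<union> ?B. real (degree f) * ?p f)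
      = (\<Sum>f\<in>?A. real (degree f) * ?p f) + (\<Sum>f\<in>?B. real (degree f) * ?p f)"
    by (rule sum.union_disjoint) (auto simp: nonselfdual_irreds_def selfdual_irreds_def)
  also have "(\<Sum>f\<in>?A. real (degree f) * ?p f) = wt_nonselfdual n"
    unfolding wt_nonselfdual_def by (intro sum.cong) (auto simp: nonselfdual_irreds_def)
  also have "(\<Sum>f\<in>?B. real (degree f) * ?p f) = wt_selfdual n"
    unfolding wt_selfdual_def by (intro sum.cong) (auto simp: selfdual_irreds_def)
  finally show ?thesis by simp
qed

section \<open>Mean multiplicities against main terms\<close>

definition "lead_nonselfdual n = (\<Sum>f\<in>(nonselfdual_irreds n :: 'a poly set). 1 / q ^ degree f)"

definition "lead_selfdual n = (\<Sum>f\<in>(selfdual_irreds n :: 'a poly set). 1 / q ^ (degree f div 2))"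

lemma linear_bound_nonneg: "0 \<le> linear_bound q"
  using q_ge_2 by (simp add: linear_bound_def)

lemma mean_num_irred_factors:
  fixes J :: "'a mat"
  assumes J: "symplectic_gram N J"
  shows "(\<Sum>A\<in>isometries N J. real (num_irred_factors (char_poly A))) / real (card (isometries N J))
    = (\<Sum>f\<in>irreds N. mean_multiplicity N J f)"
proof -
  let ?G = "isometries N J"
  have "(\<Sum>A\<in>?G. real (num_irred_factors (char_poly A)))
      = (\<Sum>A\<in>?G. \<Sum>f\<in>irreds N. real (multiplicity_in f (char_poly A)))"
  proof (rule sum.cong)
    fix A assume "A \<in> ?G"
    then have "lead_coeff (char_poly A) = 1" "degree (char_poly A) \<le> N"
      using degree_monic_char_poly[of A N] by (auto simp: isometries_def)
    then show "real (num_irred_factors (char_poly A)) = (\<Sum>f\<in>irreds N. real (multiplicity_in f (char_poly A)))"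
      using num_irred_factors_eq_sum[of "char_poly A" N] by simp
  qed simp
  also have "\<dots> = (\<Sum>f\<in>irreds N. \<Sum>A\<in>?G. real (multiplicity_in f (char_poly A)))"
    by (rule sum.swap)
  finally show ?thesis by (simp add: mean_multiplicity_def sum_divide_distrib)
qed

lemma mean_degree_sum:
  fixes J :: "'a mat"
  assumes J: "symplectic_gram N J"
  shows "(\<Sum>f\<in>irreds N. real (degree f) * mean_multiplicity N J f) = real N"
proof -
  let ?G = "isometries N J"
  let ?c = "real (card ?G)"
  have "(\<Sum>f\<in>irreds N. real (degree f) * mean_multiplicity N J f)
      = (\<Sum>f\<in>irreds N. \<Sum>A\<in>?G. real (degree f * multiplicity_in f (char_poly A))) / ?c"
    by (simp add: mean_multiplicity_def sum_distrib_left sum_divide_distrib)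
  also have "(\<Sum>f\<in>irreds N. \<Sum>A\<in>?G. real (degree f * multiplicity_in f (char_poly A)))
      = (\<Sum>A\<in>?G. \<Sum>f\<in>irreds N. real (degree f * multiplicity_in f (char_poly A)))"
    by (rule sum.swap)
  also have "\<dots> = (\<Sum>A\<in>?G. real N)"
  proof (rule sum.cong)
    fix A assume "A \<in> ?G"
    then have "lead_coeff (char_poly A) = 1" "degree (char_poly A) = N"
      using degree_monic_char_poly[of A N] by (auto simp: isometries_def)
    then show "(\<Sum>f\<in>irreds N. real (degree f * multiplicity_in f (char_poly A))) = real N"
      using degree_eq_sum_multiplicity[of "char_poly A" N] by (simp flip: of_nat_sum del: of_nat_mult)
  qed simp
  finally show ?thesis using card_isometries_pos[OF symplectic_gramD(1)[OF J]] by simp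
qed

text \<open>Each mean multiplicity is at most its main term plus a small error, and the identity
  \<open>mean_degree_sum\<close> forces these upper bounds to be sharp in the sum.\<close>

lemma mean_multiplicity_sums:
  fixes J :: "'a mat"
  assumes J: "symplectic_gram (2 * n) J"
  shows "2 * real n \<le> wt_nonselfdual n + wt_selfdual n + 40 + linear_bound q"
    and "\<bar>(\<Sum>f\<in>irreds (2 * n). mean_multiplicity (2 * n) J f) - (lead_nonselfdual n + lead_selfdual n)\<bar>
      \<le> 40 + linear_bound q"
proof -
  let ?d = "\<lambda>f :: 'a poly. real (degree f)" and ?h = "\<lambda>f :: 'a poly. degree f div 2"
  let ?A = "nonselfdual_irreds n :: 'a poly set" and ?B = "selfdual_irreds n :: 'a poly set"
    and ?L = "linear_irreds (2 * n) :: 'a poly set"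
  define mu where "mu f = mean_multiplicity (2 * n) J f" for f
  have mu0: "0 \<le> mu f" for f unfolding mu_def by (rule mean_multiplicity_nonneg)
  define uA where "uA f = 1 / q ^ degree f + 8 / q ^ (2 * degree f)" for f :: "'a poly"
  define uB where "uB f = 1 / q ^ (?h f) + 6 / q ^ (2 * (?h f))" for f :: "'a poly"
  have muA: "mu f \<le> (if degree f \<le> n then uA f else 0)" if "f \<in> nonselfdual_irreds (2 * n)" for f
    using mean_multiplicity_not_self_dual[OF J, of f] that
    by (auto simp: nonselfdual_irreds_def irreds_def mu_def uA_def q_def)
  have muA': "mu f \<le> uA f" if "f \<in> ?A" for f
    using muA[of f] that by (auto simp: nonselfdual_irreds_def irreds_def)
  have muB: "mu f \<le> uB f" if "f \<in> ?B" for f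
    using mean_multiplicity_even_degree[OF J, of f "degree f div 2"] selfdual_irredsD[OF that]
    by (simp add: mu_def uB_def q_def)
  have muL: "mu f \<le> q / ((q - 1) * (sqrt q - 1))" if "f \<in> ?L" for f
  proof -
    have f: "irreducible f" "lead_coeff f = 1" "degree f = 1"
      using that degree_linear_irreds[OF that] by (auto simp: linear_irreds_def irreds_def)
    have "0 < sqrt q" "(sqrt q) ^ 2 = q" using q_ge_2 by simp_all
    then show ?thesis
      using mean_multiplicity_half[OF J f(1,2), of "sqrt q"] f(3) by (simp add: mu_def q_def)
  qed
  have split: "(\<Sum>f\<in>irreds (2 * n). c f * mu f)
      = (\<Sum>f\<in>?L. c f * mu f) + (\<Sum>f\<in>?A. c f * mu f) + (\<Sum>f\<in>?B. c f * mu f)" for c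
  proof -
    \<comment> \<open>Non-self-dual factors of degree above \<open>n\<close> have mean zero, so the
      range shrinks from index \<open>2 * n\<close> to index \<open>n\<close>.\<close>
    have "(\<Sum>f\<in>nonselfdual_irreds (2 * n). c f * mu f) = (\<Sum>f\<in>?A. c f * mu f)"
    proof (rule sum.mono_neutral_right[OF finite_irred_classes(2)])
      show "\<forall>f\<in>nonselfdual_irreds (2 * n) - ?A. c f * mu f = 0"
      proof
        fix f assume f: "f \<in> nonselfdual_irreds (2 * n) - ?A"
        then have "\<not> degree f \<le> n" by (auto simp: nonselfdual_irreds_def irreds_def)
        then have "mu f \<le> 0" using muA[of f] f by simp
        then show "c f * mu f = 0" using mu0[of f] by simp
      qed
    qed (auto simp: nonselfdual_irreds_def irreds_def)
    then show ?thesis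
      using sum_irred_classes[of "\<lambda>f. c f * mu f" "2 * n"] by (simp add: selfdual_irreds_def)
  qed
  define m where "m = (\<Sum>f\<in>?L. mu f)"
  have m0: "0 \<le> m" using mu0 by (simp add: m_def sum_nonneg)
  have mK: "m \<le> linear_bound q"
  proof -
    have "m \<le> (\<Sum>f\<in>?L. q / ((q - 1) * (sqrt q - 1)))"
      unfolding m_def by (intro sum_mono muL)
    also have "\<dots> = real (card ?L) * (q / ((q - 1) * (sqrt q - 1)))" by simp
    also have "\<dots> \<le> linear_bound q"
      unfolding linear_bound_def using card_linear_irreds[of "2 * n", where 'a = 'a] q_ge_2
      by (intro mult_right_mono) (simp_all add: q_def)
    finally show ?thesis .
  qed
  have mL: "(\<Sum>f\<in>?L. ?d f * mu f) = m"
    unfolding m_def by (intro sum.cong) (auto simp: degree_linear_irreds)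
  have deg: "2 * real n = m + (\<Sum>f\<in>?A. ?d f * mu f) + (\<Sum>f\<in>?B. ?d f * mu f)"
    using mean_degree_sum[OF J] split[of ?d] mL by (simp add: mu_def)
  have EX: "(\<Sum>f\<in>irreds (2 * n). mu f) = m + (\<Sum>f\<in>?A. mu f) + (\<Sum>f\<in>?B. mu f)"
    using split[of "\<lambda>_. 1"] by (simp add: m_def)
  have dA: "1 \<le> ?d f" if "f \<in> ?A" for f using that by (simp add: nonselfdual_irreds_def)
  have dB: "1 \<le> ?d f" if "f \<in> ?B" for f using that by (simp add: selfdual_irreds_def)
  have wA: "(\<Sum>f\<in>?A. ?d f * uA f) \<le> wt_nonselfdual n + 16"
  proof -
    have "(\<Sum>f\<in>?A. ?d f * uA f)
        = wt_nonselfdual n + 8 * (\<Sum>f\<in>?A. ?d f / q ^ (2 * degree f))"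
      by (simp add: uA_def wt_nonselfdual_def distrib_left sum.distrib sum_distrib_left mult.commute)
    then show ?thesis
      using sum_nonselfdual_inverse_square_le[of n, where 'a = 'a] by (simp add: q_def)
  qed
  have wB: "(\<Sum>f\<in>?B. ?d f * uB f) \<le> wt_selfdual n + 24"
  proof -
    have "(\<Sum>f\<in>?B. ?d f * uB f)
        = (\<Sum>f\<in>?B. ?d f / q ^ (?h f) + 12 * (real (?h f) / q ^ (2 * (?h f))))"
    proof (rule sum.cong)
      fix f assume f: "f \<in> ?B"
      define k where "k = ?h f"
      have k: "degree f = 2 * k" using selfdual_irredsD(2)[OF f] by (simp add: k_def)
      show "?d f * uB f
          = ?d f / q ^ (?h f) + 12 * (real (?h f) / q ^ (2 * (?h f)))"
        by (simp add: uB_def k distrib_left)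
    qed simp
    also have "\<dots> = wt_selfdual n + 12 * (\<Sum>f\<in>?B. real (?h f) / q ^ (2 * (?h f)))"
      by (simp only: wt_selfdual_def sum.distrib sum_distrib_left)
    finally show ?thesis using sum_selfdual_inverse_square_le[of n] by simp
  qed
  have "(\<Sum>f\<in>?A. ?d f * mu f) \<le> (\<Sum>f\<in>?A. ?d f * uA f)"
    "(\<Sum>f\<in>?B. ?d f * mu f) \<le> (\<Sum>f\<in>?B. ?d f * uB f)"
    by (intro sum_mono mult_left_mono muA' muB; simp)+
  \<comment> \<open>The 40 is 16 + 24: both error series are at most 2, with coefficient 8 for the
    non-self-dual factors and 6 times the weight factor 2 for the self-dual ones.\<close>
  then show "2 * real n \<le> wt_nonselfdual n + wt_selfdual n + 40 + linear_bound q"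
    using deg wA wB mK by linarith
  have uA_le: "(\<Sum>f\<in>?A. uA f) \<le> lead_nonselfdual n + 16"
  proof -
    have "(\<Sum>f\<in>?A. uA f) \<le> (\<Sum>f\<in>?A. 1 / q ^ degree f + 8 * (?d f / q ^ (2 * degree f)))"
    proof (rule sum_mono)
      fix f assume "f \<in> ?A"
      then have "8 * 1 / q ^ (2 * degree f) \<le> 8 * ?d f / q ^ (2 * degree f)"
        using dA q_ge_2 by (intro divide_right_mono mult_left_mono) auto
      then show "uA f \<le> 1 / q ^ degree f + 8 * (?d f / q ^ (2 * degree f))"
        by (simp add: uA_def)
    qed
    also have "\<dots> = lead_nonselfdual n + 8 * (\<Sum>f\<in>?A. ?d f / q ^ (2 * degree f))"
      by (simp only: lead_nonselfdual_def sum.distrib sum_distrib_left)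
    finally show ?thesis
      using sum_nonselfdual_inverse_square_le[of n, where 'a = 'a] by (simp add: q_def)
  qed
  have uB_le: "(\<Sum>f\<in>?B. uB f) \<le> lead_selfdual n + 12"
  proof -
    have "(\<Sum>f\<in>?B. uB f) \<le> (\<Sum>f\<in>?B. 1 / q ^ (?h f) + 6 * (real (?h f) / q ^ (2 * (?h f))))"
    proof (rule sum_mono)
      fix f assume "f \<in> ?B"
      then have "6 * 1 / q ^ (2 * (?h f)) \<le> 6 * real (?h f) / q ^ (2 * (?h f))"
        using selfdual_irredsD(3) q_ge_2 by (intro divide_right_mono mult_left_mono) auto
      then show "uB f \<le> 1 / q ^ (?h f) + 6 * (real (?h f) / q ^ (2 * (?h f)))"
        by (simp add: uB_def)
    qed
    also have "\<dots> = lead_selfdual n + 6 * (\<Sum>f\<in>?B. real (?h f) / q ^ (2 * (?h f)))"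
      by (simp only: lead_selfdual_def sum.distrib sum_distrib_left)
    finally show ?thesis using sum_selfdual_inverse_square_le[of n] by simp
  qed
  have "(\<Sum>f\<in>?A. mu f) \<le> (\<Sum>f\<in>?A. uA f)" "(\<Sum>f\<in>?B. mu f) \<le> (\<Sum>f\<in>?B. uB f)"
    by (intro sum_mono muA' muB; assumption)+
  then have upper: "(\<Sum>f\<in>irreds (2 * n). mu f) \<le> lead_nonselfdual n + lead_selfdual n + 28 + linear_bound q"
    using EX uA_le uB_le mK by linarith
  have "lead_nonselfdual n \<le> (\<Sum>f\<in>?A. uA f)"
    unfolding lead_nonselfdual_def using q_ge_2 by (intro sum_mono) (simp add: uA_def)
  moreover have "lead_selfdual n \<le> (\<Sum>f\<in>?B. uB f)"
    unfolding lead_selfdual_def using q_ge_2 by (intro sum_mono) (simp add: uB_def)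
  \<comment> \<open>Each difference is nonnegative and each degree is at least 1, so the plain
    excess of the upper bounds is at most the weighted excess, which the total degree
    controls.\<close>
  moreover have "(\<Sum>f\<in>?A. uA f - mu f) \<le> (\<Sum>f\<in>?A. ?d f * (uA f - mu f))"
  proof (rule sum_mono)
    fix f assume f: "f \<in> ?A"
    show "uA f - mu f \<le> ?d f * (uA f - mu f)"
      using mult_right_mono[OF dA[OF f], of "uA f - mu f"] muA'[OF f] by simp
  qed
  moreover have "(\<Sum>f\<in>?B. uB f - mu f) \<le> (\<Sum>f\<in>?B. ?d f * (uB f - mu f))"
  proof (rule sum_mono)
    fix f assume f: "f \<in> ?B"
    show "uB f - mu f \<le> ?d f * (uB f - mu f)"
      using mult_right_mono[OF dB[OF f], of "uB f - mu f"] muB[OF f] by simp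
  qed
  \<comment> \<open>The weighted excess of both classes is at most 40 + m, since their weighted
    means add up to \<open>2 * n - m\<close> and their weighted main terms to at most
    \<open>2 * n\<close>. The linear part \<open>m\<close> of the mean itself cancels this
    \<open>m\<close>.\<close>
  ultimately have "lead_nonselfdual n + lead_selfdual n - (\<Sum>f\<in>irreds (2 * n). mu f)
      \<le> 40 + m - m"
    using EX deg wA wB wt_sum_le[of n] m0 unfolding right_diff_distrib sum_subtractf by linarith
  then show "\<bar>(\<Sum>f\<in>irreds (2 * n). mean_multiplicity (2 * n) J f) - (lead_nonselfdual n + lead_selfdual n)\<bar>
      \<le> 40 + linear_bound q"
    using upper linear_bound_nonneg unfolding mu_def by linarith
qed

text \<open>Grouped by degree, the weighted main terms have partial sums n + O(1), and dividing by
  the degree turns them into the unweighted ones.\<close>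

lemma lead_nonselfdual_harm: "\<bar>lead_nonselfdual n - harm n\<bar> \<le> 14"
proof -
  let ?X = "nonselfdual_irreds :: nat \<Rightarrow> 'a poly set"
  \<comment> \<open>The count depends on \<open>d\<close> alone; \<open>n\<close> merely truncates
    the sum, as partial summation requires.\<close>
  define c where "c d = real (card {f :: 'a poly. irreducible f \<and> lead_coeff f = 1 \<and> degree f = d \<and>
    2 \<le> degree f \<and> \<not> f dvd reflect_poly f})" for d
  have fib: "(\<Sum>f\<in>?X n. h (degree f)) = (\<Sum>d=1..n. c d * h d)"
    for h :: "nat \<Rightarrow> real" and n
  proof -
    have "(\<Sum>f\<in>?X n. h (degree f))
        = (\<Sum>d\<in>{1..n}. real (card {f \<in> ?X n. degree f = d}) * h d)"
      by (rule sum_fibres[OF finite_irred_classes(2)]) (auto simp: nonselfdual_irreds_def irreds_def)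
    also have "\<dots> = (\<Sum>d=1..n. c d * h d)"
    proof (intro sum.cong refl arg_cong2[of _ _ _ _ "(*)"])
      fix d assume "d \<in> {1..n}"
      then have "{f \<in> ?X n. degree f = d} = {f. irreducible f \<and> lead_coeff f = 1 \<and>
          degree f = d \<and> 2 \<le> degree f \<and> \<not> f dvd reflect_poly f}"
        by (auto simp: nonselfdual_irreds_def irreds_def)
      then show "real (card {f \<in> ?X n. degree f = d}) = c d"
        unfolding c_def by (rule arg_cong)
    qed
    finally show ?thesis .
  qed
  define A where "A d = c d * (real d / q ^ d)" for d
  have "wt_nonselfdual n = (\<Sum>d=1..n. A d)" for n
    unfolding wt_nonselfdual_def A_def by (rule fib)
  then have "\<bar>(\<Sum>d=1..n. A d) - real n\<bar> \<le> 14" for n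
    using wt_nonselfdual_le[of n] wt_nonselfdual_ge[of n] by simp
  then have "\<bar>(\<Sum>d=1..n. A d / real d) - harm n\<bar> \<le> 14" by (rule abel_harmonic)
  moreover have "(\<Sum>d=1..n. A d / real d) = (\<Sum>d=1..n. c d * (1 / q ^ d))"
    by (intro sum.cong) (auto simp: A_def)
  moreover have "lead_nonselfdual n = (\<Sum>d=1..n. c d * (1 / q ^ d))"
    unfolding lead_nonselfdual_def by (rule fib)
  ultimately show ?thesis by simp
qed

text \<open>The grouping is by half the degree, k. The weight is the full degree 2k, so dividing by
  k leaves twice the unweighted main term, which is the source of the factor 2.\<close>

lemma lead_selfdual_harm:
  assumes wt: "\<And>n. \<bar>wt_selfdual n - real n\<bar> \<le> C"
  shows "\<bar>2 * lead_selfdual n - harm n\<bar> \<le> C"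
proof -
  let ?X = "selfdual_irreds :: nat \<Rightarrow> 'a poly set"
  define c where "c k = real (card {f :: 'a poly. irreducible f \<and> lead_coeff f = 1 \<and> degree f div 2 = k \<and>
    2 \<le> degree f \<and> f dvd reflect_poly f})" for k
  have fib: "(\<Sum>f\<in>?X n. h (degree f div 2)) = (\<Sum>d=1..n. c d * h d)"
    for h :: "nat \<Rightarrow> real" and n
  proof -
    have "(\<Sum>f\<in>?X n. h (degree f div 2))
        = (\<Sum>d\<in>{1..n}. real (card {f \<in> ?X n. degree f div 2 = d}) * h d)"
      by (rule sum_fibres) (use selfdual_irredsD(3,4) in auto)
    also have "\<dots> = (\<Sum>d=1..n. c d * h d)"
    proof (intro sum.cong refl arg_cong2[of _ _ _ _ "(*)"])
      fix d assume d: "d \<in> {1..n}"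
      have "f \<in> selfdual_irreds n \<and> degree f div 2 = d \<longleftrightarrow> irreducible f \<and> lead_coeff f = 1 \<and>
          degree f div 2 = d \<and> 2 \<le> degree f \<and> f dvd reflect_poly f" for f :: "'a poly"
      proof
        assume r: "irreducible f \<and> lead_coeff f = 1 \<and> degree f div 2 = d \<and> 2 \<le> degree f \<and> f dvd reflect_poly f"
        \<comment> \<open>Evenness excludes the degree 2d + 1, which also halves to d and would
          exceed the cut-off \<open>2 * n\<close> for d = n.\<close>
        then have "even (degree f)" by (intro self_dual_palindromic(2)[OF two]) auto
        then have "degree f = 2 * d" using r by auto
        then show "f \<in> selfdual_irreds n \<and> degree f div 2 = d"
          using r d by (auto simp: selfdual_irreds_def irreds_def)
      qed (auto simp: selfdual_irreds_def irreds_def)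
      then show "real (card {f \<in> ?X n. degree f div 2 = d}) = c d"
        unfolding c_def by simp
    qed
    finally show ?thesis .
  qed
  define A where "A k = c k * (real (2 * k) / q ^ k)" for k
  have wtA: "wt_selfdual n = (\<Sum>d=1..n. A d)" for n
  proof -
    have "wt_selfdual n = (\<Sum>f\<in>?X n. real (2 * (degree f div 2)) / q ^ (degree f div 2))"
      unfolding wt_selfdual_def using selfdual_irredsD(2) by (intro sum.cong) auto
    also have "\<dots> = (\<Sum>d=1..n. A d)"
      unfolding A_def by (rule fib)
    finally show ?thesis .
  qed
  have "\<bar>(\<Sum>d=1..n. A d) - real n\<bar> \<le> C" for n
    using wt[of n] wtA[of n] by simp
  then have "\<bar>(\<Sum>d=1..n. A d / real d) - harm n\<bar> \<le> C" by (rule abel_harmonic)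
  moreover have "(\<Sum>d=1..n. A d / real d) = 2 * (\<Sum>d=1..n. c d * (1 / q ^ d))"
    unfolding sum_distrib_left by (intro sum.cong) (auto simp: A_def)
  moreover have "lead_selfdual n = (\<Sum>d=1..n. c d * (1 / q ^ d))"
    unfolding lead_selfdual_def by (rule fib)
  ultimately show ?thesis by simp
qed

text \<open>A form in every dimension is required because partial summation for the self-dual
  factors uses the weight estimate at every index, and half of that estimate comes from the groups.
  Two harmonic sums with coefficients 1 and 1/2 produce 3/2; the stated constant has slack.\<close>

lemma mean_num_irred_factors_bound:
  fixes J :: "nat \<Rightarrow> 'a mat"
  assumes J: "\<And>n. 1 \<le> n \<Longrightarrow> symplectic_gram (2 * n) (J n)" and n: "1 \<le> n"
  shows "\<bar>(\<Sum>A\<in>isometries (2 * n) (J n). real (num_irred_factors (char_poly A)))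
      / real (card (isometries (2 * n) (J n))) - 3 / 2 * ln (real n)\<bar> \<le> 100 + 2 * linear_bound q"
proof -
  \<comment> \<open>The upper bound subtracts \<open>wt_nonselfdual_ge\<close> from
    \<open>wt_sum_le\<close>. The lower bound is the one taken from the group: the means must fill
    the total degree, and the non-self-dual weight is at most \<open>n\<close>.\<close>
  have wt: "\<bar>wt_selfdual n - real n\<bar> \<le> 40 + linear_bound q" for n
  proof (cases "n = 0")
    case True
    have "selfdual_irreds 0 = ({} :: 'a poly set)" by (auto simp: selfdual_irreds_def irreds_def)
    then show ?thesis using True linear_bound_nonneg by (simp add: wt_selfdual_def)
  next
    case False
    then have "2 * real n \<le> wt_nonselfdual n + wt_selfdual n + 40 + linear_bound q"
      using mean_multiplicity_sums(1)[OF J[of n]] by simp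
    then show ?thesis
      using wt_sum_le[of n] wt_nonselfdual_le[of n] wt_nonselfdual_ge[of n] linear_bound_nonneg by simp
  qed
  have "\<bar>harm n - ln (real n)\<bar> \<le> 1" using harm_minus_ln_bounds[of n] n by simp
  moreover note lead_nonselfdual_harm[of n] lead_selfdual_harm[OF wt, of n]
    mean_multiplicity_sums(2)[OF J[OF n]]
  ultimately show ?thesis
    unfolding mean_num_irred_factors[OF J[OF n]] by linarith
qed

end

text \<open>Translation by 1 permutes the field, so comparing the sums of all elements shows that q
  times 1 is zero. If 2 were zero and q odd, this would give 1 = 0.\<close>

lemma two_nonzero_if_odd_card:
  assumes "odd CARD('a::{finite,field})"
  shows "(2 :: 'a) \<noteq> 0"
proof
  assume two: "(2 :: 'a) = 0"
  have "(\<Sum>x\<in>(UNIV :: 'a set). x) = (\<Sum>x\<in>(UNIV :: 'a set). x + 1)"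
    by (rule sum.reindex_bij_witness[of _ "\<lambda>x. x + 1" "\<lambda>x. x - 1"]) auto
  then have "of_nat CARD('a) = (0 :: 'a)" by (simp add: sum.distrib)
  moreover obtain m where "CARD('a) = 2 * m + 1" using assms by (elim oddE)
  ultimately show False using two by simp
qed

theorem theorem23:
  fixes p k :: nat
    and B :: "nat \<Rightarrow> 'a::{finite,field} vec \<Rightarrow> 'a vec \<Rightarrow> 'a"
  assumes "prime p" and "odd p" and "k > 0" and "CARD('a) = p ^ k"
    and "\<And>n. n \<ge> 1 \<Longrightarrow> nondegenerate_alternating_form (2 * n) (B n)"
  shows "(\<lambda>n::nat.
            measure_pmf.expectation (pmf_of_set (symplectic (2 * n) (B n)))
              (\<lambda>\<alpha>. real (num_irred_factors (char_poly \<alpha>)))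
            - 3 / 2 * ln (real n)) \<in> O(\<lambda>_. 1)"
proof -
  have two: "(2 :: 'a) \<noteq> 0" using assms(2,4) by (intro two_nonzero_if_odd_card) simp
  have "\<exists>J. symplectic_gram (2 * n) J \<and> symplectic (2 * n) (B n) = isometries (2 * n) J" if "1 \<le> n" for n
    using symplectic_eq_isometries[OF assms(5)[OF that]] by blast
  then obtain J where J: "\<And>n. 1 \<le> n \<Longrightarrow> symplectic_gram (2 * n) (J n)"
    "\<And>n. 1 \<le> n \<Longrightarrow> symplectic (2 * n) (B n) = isometries (2 * n) (J n)"
    by metis
  obtain C where C: "\<bar>(\<Sum>A\<in>isometries (2 * n) (J n). real (num_irred_factors (char_poly A)))
      / real (card (isometries (2 * n) (J n))) - 3 / 2 * ln (real n)\<bar> \<le> C" if "1 \<le> n" for n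
    using mean_num_irred_factors_bound[OF two J(1)] by blast
  have "\<forall>\<^sub>F n in sequentially. norm (measure_pmf.expectation (pmf_of_set (symplectic (2 * n) (B n)))
      (\<lambda>\<alpha>. real (num_irred_factors (char_poly \<alpha>))) - 3 / 2 * ln (real n)) \<le> C * norm (1 :: real)"
    using eventually_ge_at_top[of 1]
  proof eventually_elim
    case (elim n)
    have "isometries (2 * n) (J n) \<noteq> {}"
      using card_isometries_pos[OF symplectic_gramD(1)[OF J(1)[OF elim]]] by auto
    then show ?case
      using C[OF elim] finite_isometries[of "2 * n" "J n"] by (simp add: J(2)[OF elim] integral_pmf_of_set)
  qed
  then show ?thesis by (rule bigoI)
qed

end
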